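(* Assume the OMv conjecture. Then for every constant $\epsilon>0$ there do not exist fully retroactive data structures with $O(n^{1-\epsilon})$ update and query time, subject to retroactive edge insertions/deletions, for any of the following problems: connectivity; maximal matching (with queries for the size of the matching); minimum spanning forest (with queries for the size of the forest); $(1.5-\epsilon)$-approximation of the maximum density (approximation without additive error). This holds even when edges are unweighted.
   Context: Setting: a graph on a fixed vertex set with $n$ vertices, initially empty. A fully retroactive data structure maintains a sequence $S$ of updates (edge insertions and deletions), each with a distinct real time, modified by $\textsf{Create}(\text{update},t)$ (add an update at time $t$) and $\textsf{Cancel}(t)$ (remove the update at time $t$), all legal; queries may be asked at any time $t$ and are answered on the graph $G_t$ obtained by applying the updates with time at most $t$ in time order. The maximum density of a graph is $\max_{\emptyset\ne U\subseteq V}|E(U)|/|U|$, where $E(U)$ is the set of edges with both endpoints in $U$. OMv problem: given an $n\times n$ Boolean matrix $M$, then $n$ Boolean vectors $v_1,\dots,v_n$ arriving online, output the Boolean product $Mv_i$ before $v_{i+1}$ is revealed. OMv conjecture: for every constant $\epsilon>0$ no algorithm solves OMv in $O(n^{3-\epsilon})$ time. *)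

theory Defs
  imports Complex_Main
begin

section \<open>Word RAM programs\<close>

text \<open>
  Programs are finite pieces of syntax, executed on a word RAM with unit cost per instruction.
  The machine has a word memory, a read-only input array that is refilled with every request, and
  an output array that is cleared with every request.  It also has a memory of time stamps: the
  times of a retroactive data structure are arbitrary reals, which are atomic for the machine
  and can only be moved and compared.  A word can be used as a time stamp, but a time stamp is
  never converted to a word, so time stamps cannot be used to circumvent the bound on words.
\<close>

datatype binop = Add | Sub | Mul | Div | Mod | And | Or | Xor | Shl | Shr

fun eval_binop :: "binop \<Rightarrow> nat \<Rightarrow> nat \<Rightarrow> nat" where
  "eval_binop Add a b = a + b"
| "eval_binop Sub a b = a - b"
| "eval_binop Mul a b = a * b"
| "eval_binop Div a b = a div b"
| "eval_binop Mod a b = a mod b"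
| "eval_binop And a b = Bit_Operations.and a b"
| "eval_binop Or a b = Bit_Operations.or a b"
| "eval_binop Xor a b = Bit_Operations.xor a b"
| "eval_binop Shl a b = push_bit b a"
| "eval_binop Shr a b = drop_bit b a"

record machine =
  mem :: "nat \<Rightarrow> nat"
  tmem :: "nat \<Rightarrow> real"
  inp :: "nat \<Rightarrow> nat"
  tinp :: real
  out :: "nat \<Rightarrow> nat"

datatype operand = Imm nat | Dir nat | Ind nat

fun val :: "machine \<Rightarrow> operand \<Rightarrow> nat" where
  "val s (Imm k) = k"
| "val s (Dir x) = mem s x"
| "val s (Ind x) = mem s (mem s x)"

datatype com =
    Skip
  | Comp nat binop operand operand
  | Store nat operand
  | Input nat operand
  | Output operand operand
  | TInput operand
  | TMove operand operand
  | TWord operand operand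
  | TLess nat operand operand
  | Seq com com
  | Cond operand com com
  | While operand com

text \<open>
  \<open>exec W c s t s'\<close>: started in \<open>s\<close>, program \<open>c\<close> halts in \<open>s'\<close> after \<open>t\<close> steps and never
  produces a word larger than \<open>W\<close>.  An overflow has no transition, so a program whose execution
  overflows has no terminating execution.  The bound \<open>W\<close> is polynomial in the
  instance size wherever \<open>exec\<close> is used below, which gives words of \<open>O(log n)\<close> bits; without
  it, unit-cost arithmetic on huge numbers would make the model unrealistic.
\<close>

inductive exec :: "nat \<Rightarrow> com \<Rightarrow> machine \<Rightarrow> nat \<Rightarrow> machine \<Rightarrow> bool" for W :: nat where
  Skip: "exec W Skip s 1 s"
| Comp: "eval_binop f (val s a) (val s b) = r \<Longrightarrow> r \<le> W
    \<Longrightarrow> exec W (Comp x f a b) s 1 (s\<lparr>mem := (mem s)(x := r)\<rparr>)"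
| Store: "val s a \<le> W
    \<Longrightarrow> exec W (Store x a) s 1 (s\<lparr>mem := (mem s)(mem s x := val s a)\<rparr>)"
| Input: "inp s (val s a) \<le> W
    \<Longrightarrow> exec W (Input x a) s 1 (s\<lparr>mem := (mem s)(x := inp s (val s a))\<rparr>)"
| Output: "val s b \<le> W
    \<Longrightarrow> exec W (Output a b) s 1 (s\<lparr>out := (out s)(val s a := val s b)\<rparr>)"
| TInput: "exec W (TInput a) s 1 (s\<lparr>tmem := (tmem s)(val s a := tinp s)\<rparr>)"
| TMove: "exec W (TMove a b) s 1 (s\<lparr>tmem := (tmem s)(val s a := tmem s (val s b))\<rparr>)"
| TWord: "exec W (TWord a b) s 1 (s\<lparr>tmem := (tmem s)(val s a := real (val s b))\<rparr>)"
| TLess: "r = of_bool (tmem s (val s a) < tmem s (val s b)) \<Longrightarrow> r \<le> W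
    \<Longrightarrow> exec W (TLess x a b) s 1 (s\<lparr>mem := (mem s)(x := r)\<rparr>)"
| Seq: "exec W c1 s t1 s1 \<Longrightarrow> exec W c2 s1 t2 s2 \<Longrightarrow> exec W (Seq c1 c2) s (t1 + t2) s2"
| CondTrue: "val s a \<noteq> 0 \<Longrightarrow> exec W c1 s t s1 \<Longrightarrow> exec W (Cond a c1 c2) s (Suc t) s1"
| CondFalse: "val s a = 0 \<Longrightarrow> exec W c2 s t s1 \<Longrightarrow> exec W (Cond a c1 c2) s (Suc t) s1"
| WhileFalse: "val s a = 0 \<Longrightarrow> exec W (While a c) s 1 s"
| WhileTrue: "val s a \<noteq> 0 \<Longrightarrow> exec W c s t1 s1 \<Longrightarrow> exec W (While a c) s1 t2 s2
    \<Longrightarrow> exec W (While a c) s (Suc (t1 + t2)) s2"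

inductive_cases exec_SkipE: "exec W Skip s t s'"
inductive_cases exec_CompE: "exec W (Comp x f a b) s t s'"
inductive_cases exec_StoreE: "exec W (Store x a) s t s'"
inductive_cases exec_InputE: "exec W (Input x a) s t s'"
inductive_cases exec_OutputE: "exec W (Output a b) s t s'"
inductive_cases exec_TInputE: "exec W (TInput a) s t s'"
inductive_cases exec_TMoveE: "exec W (TMove a b) s t s'"
inductive_cases exec_TWordE: "exec W (TWord a b) s t s'"
inductive_cases exec_TLessE: "exec W (TLess x a b) s t s'"
inductive_cases exec_SeqE: "exec W (Seq c1 c2) s t s'"
inductive_cases exec_CondE: "exec W (Cond a c1 c2) s t s'"
inductive_cases exec_WhileE: "exec W (While a c) s t s'"

lemma exec_deterministic:
  "exec W c s t s' \<Longrightarrow> exec W c s u s'' \<Longrightarrow> u = t \<and> s'' = s'"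
proof (induction arbitrary: u s'' rule: exec.induct)
  case Skip then show ?case by (elim exec_SkipE) simp
next
  case Comp then show ?case by (elim exec_CompE) simp
next
  case Store then show ?case by (elim exec_StoreE) simp
next
  case Input then show ?case by (elim exec_InputE) simp
next
  case Output then show ?case by (elim exec_OutputE) simp
next
  case TInput then show ?case by (elim exec_TInputE) simp
next
  case TMove then show ?case by (elim exec_TMoveE) simp
next
  case TWord then show ?case by (elim exec_TWordE) simp
next
  case TLess then show ?case by (elim exec_TLessE) simp
next
  case (Seq c1 s t1 s1 c2 t2 s2)
  from Seq.prems show ?case
    by (rule exec_SeqE) (auto dest: Seq.IH)
next
  case (CondTrue s a c1 t s1 c2)
  from CondTrue.prems show ?case
    by (rule exec_CondE) (use CondTrue.hyps(1) in \<open>auto dest: CondTrue.IH\<close>)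
next
  case (CondFalse s a c2 t s1 c1)
  from CondFalse.prems show ?case
    by (rule exec_CondE) (use CondFalse.hyps(1) in \<open>auto dest: CondFalse.IH\<close>)
next
  case (WhileFalse s a c)
  from WhileFalse.prems show ?case
    by (rule exec_WhileE) (use WhileFalse.hyps in auto)
next
  case (WhileTrue s a c t1 s1 t2 s2)
  from WhileTrue.prems show ?case
    by (rule exec_WhileE) (use WhileTrue.hyps(1) in \<open>auto dest: WhileTrue.IH\<close>)
qed


section \<open>Online algorithms and data structures\<close>

text \<open>
  An online algorithm is a pair of programs: the first one preprocesses the initial input, the
  second one is run once per request, on the memory left behind by the previous runs.
  A request consists of finitely many words and one time stamp.  Only the current request is
  visible, and its output is fixed when its run ends, before the next request is read.
\<close>

type_synonym algorithm = "com \<times> com"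
type_synonym request = "nat list \<times> real"

definition blank :: machine where
  "blank = \<lparr>mem = (\<lambda>_. 0), tmem = (\<lambda>_. 0), inp = (\<lambda>_. 0), tinp = 0, out = (\<lambda>_. 0)\<rparr>"

definition feed :: "request \<Rightarrow> machine \<Rightarrow> machine" where
  "feed r s = s\<lparr>inp := (\<lambda>i. if i < length (fst r) then fst r ! i else 0),
                tinp := snd r, out := (\<lambda>_. 0)\<rparr>"

inductive serve ::
  "nat \<Rightarrow> com \<Rightarrow> machine \<Rightarrow> request list \<Rightarrow> nat \<Rightarrow> (nat \<Rightarrow> nat) list \<Rightarrow> bool"
  for W :: nat and c :: com where
  Nil: "serve W c s [] 0 []"
| Cons: "exec W c (feed r s) t s' \<Longrightarrow> serve W c s' rs T outs
    \<Longrightarrow> serve W c s (r # rs) (t + T) (out s' # outs)"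

text \<open>
  \<open>T0\<close> is the preprocessing time, \<open>T\<close> the total time spent on the requests.
\<close>

definition run ::
  "nat \<Rightarrow> algorithm \<Rightarrow> nat list \<Rightarrow> request list \<Rightarrow> nat \<Rightarrow> nat \<Rightarrow> (nat \<Rightarrow> nat) list \<Rightarrow> bool" where
  "run W A x rs T0 T outs \<longleftrightarrow>
     (\<exists>s. exec W (fst A) (feed (x, 0) blank) T0 s \<and> serve W (snd A) s rs T outs)"


section \<open>Online Boolean matrix-vector multiplication\<close>

text \<open>An \<open>n \<times> n\<close> matrix is given by its entries with indices below \<open>n\<close>.\<close>

type_synonym bmat = "nat \<Rightarrow> nat \<Rightarrow> bool"
type_synonym bvec = "nat \<Rightarrow> bool"

definition encode_vec :: "nat \<Rightarrow> bvec \<Rightarrow> nat list" where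
  "encode_vec n v = map (\<lambda>j. of_bool (v j)) [0..<n]"

definition encode_mat :: "nat \<Rightarrow> bmat \<Rightarrow> nat list" where
  "encode_mat n M = concat (map (\<lambda>i. encode_vec n (M i)) [0..<n])"

definition bool_mult :: "nat \<Rightarrow> bmat \<Rightarrow> bvec \<Rightarrow> bvec" where
  "bool_mult n M v = (\<lambda>i. \<exists>j<n. M i j \<and> v j)"

text \<open>The time bound is on the total time, including the preprocessing of the matrix.\<close>

definition solves_OMv_within :: "algorithm \<Rightarrow> (nat \<Rightarrow> real) \<Rightarrow> bool" where
  "solves_OMv_within A f \<longleftrightarrow>
     (\<exists>c. \<forall>n\<ge>1. \<forall>(M :: bmat) (V :: nat \<Rightarrow> bvec). \<exists>T0 T outs.
        run ((n + 2) ^ c) A (n # encode_mat n M)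
          (map (\<lambda>k. (encode_vec n (V k), 0)) [0..<n]) T0 T outs \<and>
        (\<forall>k<n. \<forall>i<n. (outs ! k) i = of_bool (bool_mult n M (V k) i)) \<and>
        real (T0 + T) \<le> f n)"

definition OMv_conjecture :: bool where
  "OMv_conjecture \<longleftrightarrow>
     (\<forall>\<epsilon>>0. \<not> (\<exists>A C. solves_OMv_within A (\<lambda>n. C * real n powr (3 - \<epsilon>))))"


section \<open>Graphs and timelines of edge updates\<close>

text \<open>
  The vertex set is \<open>{..<n}\<close>; a (simple, unweighted) graph is given by its set of edges, each
  edge being a two-element set of vertices.
\<close>

type_synonym graph = "nat set set"

datatype update = Ins nat nat | Del nat nat

fun apply_update :: "update \<Rightarrow> graph \<Rightarrow> graph" where
  "apply_update (Ins u v) G = insert {u, v} G"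
| "apply_update (Del u v) G = G - {{u, v}}"

fun legal_update :: "nat \<Rightarrow> graph \<Rightarrow> update \<Rightarrow> bool" where
  "legal_update n G (Ins u v) \<longleftrightarrow> u < n \<and> v < n \<and> u \<noteq> v \<and> {u, v} \<notin> G"
| "legal_update n G (Del u v) \<longleftrightarrow> u < n \<and> v < n \<and> u \<noteq> v \<and> {u, v} \<in> G"

primrec legal_updates :: "nat \<Rightarrow> graph \<Rightarrow> update list \<Rightarrow> bool" where
  "legal_updates n G [] \<longleftrightarrow> True"
| "legal_updates n G (x # xs) \<longleftrightarrow> legal_update n G x \<and> legal_updates n (apply_update x G) xs"

text \<open>The sequence of updates, with their distinct times, is a finite partial map on times.\<close>

type_synonym timeline = "real \<rightharpoonup> update"

definition updates_at :: "timeline \<Rightarrow> real set \<Rightarrow> update list" where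
  "updates_at S R = map (\<lambda>t. the (S t)) (sorted_list_of_set (dom S \<inter> R))"

definition graph_at :: "timeline \<Rightarrow> real \<Rightarrow> graph" where
  "graph_at S t = fold apply_update (updates_at S {..t}) {}"

definition legal_timeline :: "nat \<Rightarrow> timeline \<Rightarrow> bool" where
  "legal_timeline n S \<longleftrightarrow> finite (dom S) \<and> legal_updates n {} (updates_at S UNIV)"


section \<open>Fully retroactive data structures\<close>

text \<open>
  A problem consists of the admissible arguments of a query and of the correct answers to a
  query, given the number of vertices, the graph at the queried time, the arguments and the
  output array.
\<close>

record problem =
  admissible :: "nat \<Rightarrow> nat list \<Rightarrow> bool"
  answer :: "nat \<Rightarrow> graph \<Rightarrow> nat list \<Rightarrow> (nat \<Rightarrow> nat) \<Rightarrow> bool"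

datatype operation = Create update real | Cancel real | Query "nat list" real

fun apply_operation :: "operation \<Rightarrow> timeline \<Rightarrow> timeline" where
  "apply_operation (Create u t) S = S(t \<mapsto> u)"
| "apply_operation (Cancel t) S = S(t := None)"
| "apply_operation (Query xs t) S = S"

fun legal_operation :: "problem \<Rightarrow> nat \<Rightarrow> timeline \<Rightarrow> operation \<Rightarrow> bool" where
  "legal_operation P n S (Create u t) \<longleftrightarrow> t \<notin> dom S \<and> legal_timeline n (S(t \<mapsto> u))"
| "legal_operation P n S (Cancel t) \<longleftrightarrow> t \<in> dom S \<and> legal_timeline n (S(t := None))"
| "legal_operation P n S (Query xs t) \<longleftrightarrow> admissible P n xs"

primrec legal_operations :: "problem \<Rightarrow> nat \<Rightarrow> timeline \<Rightarrow> operation list \<Rightarrow> bool" where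
  "legal_operations P n S [] \<longleftrightarrow> True"
| "legal_operations P n S (x # xs) \<longleftrightarrow>
     legal_operation P n S x \<and> legal_operations P n (apply_operation x S) xs"

fun correct_answer :: "problem \<Rightarrow> nat \<Rightarrow> timeline \<Rightarrow> operation \<Rightarrow> (nat \<Rightarrow> nat) \<Rightarrow> bool" where
  "correct_answer P n S (Query xs t) y \<longleftrightarrow> answer P n (graph_at S t) xs y"
| "correct_answer P n S _ y \<longleftrightarrow> True"

fun correct_answers ::
  "problem \<Rightarrow> nat \<Rightarrow> timeline \<Rightarrow> operation list \<Rightarrow> (nat \<Rightarrow> nat) list \<Rightarrow> bool" where
  "correct_answers P n S [] [] \<longleftrightarrow> True"
| "correct_answers P n S (x # xs) (y # ys) \<longleftrightarrow>
     correct_answer P n S x y \<and> correct_answers P n (apply_operation x S) xs ys"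
| "correct_answers P n S _ _ \<longleftrightarrow> False"

fun encode_operation :: "operation \<Rightarrow> request" where
  "encode_operation (Create (Ins u v) t) = ([0, u, v], t)"
| "encode_operation (Create (Del u v) t) = ([1, u, v], t)"
| "encode_operation (Cancel t) = ([2], t)"
| "encode_operation (Query xs t) = (3 # xs, t)"

text \<open>
  The data structure starts from the empty timeline.  Its preprocessing may take polynomial time
  \<open>O(n^d)\<close>; afterwards every operation takes amortized time \<open>O(f n)\<close> (in particular, this
  covers worst-case bounds).  As a function of \<open>n\<close> alone, such a bound is only meaningful
  for polynomially many operations: merely locating a time among \<open>m\<close> updates takes
  \<open>\<Omega>(log m)\<close> comparisons.  So the bounds are required for every polynomial number of operations,
  where the hidden constants may depend on the exponent \<open>k\<close>, but the algorithm and
  the exponent of the preprocessing time may not.  As every number of operations is at most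
  \<open>(n + 1) ^ k\<close> for some \<open>k\<close>, correctness is required for all sequences of operations.
\<close>

definition fully_retroactive_within :: "problem \<Rightarrow> algorithm \<Rightarrow> (nat \<Rightarrow> real) \<Rightarrow> bool" where
  "fully_retroactive_within P A f \<longleftrightarrow>
     (\<exists>d. \<forall>k. \<exists>c C. \<forall>n\<ge>1. \<forall>ops.
        legal_operations P n Map.empty ops \<and> length ops \<le> (n + 1) ^ k \<longrightarrow>
        (\<exists>T0 T outs. run ((n + 2) ^ c) A [n] (map encode_operation ops) T0 T outs \<and>
           correct_answers P n Map.empty ops outs \<and>
           real T0 \<le> C * real n ^ d \<and>
           real T \<le> C * real (length ops) * f n))"


section \<open>The problems\<close>

definition linked :: "graph \<Rightarrow> nat \<Rightarrow> nat \<Rightarrow> bool" where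
  "linked E u v \<longleftrightarrow> (u, v) \<in> {(x, y). {x, y} \<in> E}\<^sup>*"

definition connectivity :: problem where
  "connectivity = \<lparr>
     admissible = (\<lambda>n xs. \<exists>u<n. \<exists>v<n. xs = [u, v]),
     answer = (\<lambda>n E xs y. y 0 = of_bool (linked E (xs ! 0) (xs ! 1)))\<rparr>"

definition is_matching :: "graph \<Rightarrow> nat set set \<Rightarrow> bool" where
  "is_matching E M \<longleftrightarrow> M \<subseteq> E \<and> (\<forall>e\<in>M. \<forall>f\<in>M. e \<noteq> f \<longrightarrow> e \<inter> f = {})"

definition is_maximal_matching :: "graph \<Rightarrow> nat set set \<Rightarrow> bool" where
  "is_maximal_matching E M \<longleftrightarrow>
     is_matching E M \<and> (\<forall>M'. is_matching E M' \<and> M \<subseteq> M' \<longrightarrow> M' = M)"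

text \<open>A maximal matching is not unique; the size of any of them is a correct answer.\<close>

definition maximal_matching_size :: problem where
  "maximal_matching_size = \<lparr>
     admissible = (\<lambda>n xs. xs = []),
     answer = (\<lambda>n E xs y. \<exists>M. is_maximal_matching E M \<and> y 0 = card M)\<rparr>"

definition is_cycle :: "graph \<Rightarrow> nat list \<Rightarrow> bool" where
  "is_cycle E xs \<longleftrightarrow> length xs \<ge> 3 \<and> distinct xs \<and>
     (\<forall>i<length xs. {xs ! i, xs ! (Suc i mod length xs)} \<in> E)"

definition is_spanning_forest :: "graph \<Rightarrow> graph \<Rightarrow> bool" where
  "is_spanning_forest E F \<longleftrightarrow>
     F \<subseteq> E \<and> (\<nexists>xs. is_cycle F xs) \<and> (\<forall>u v. linked E u v \<longrightarrow> linked F u v)"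

definition is_minimum_spanning_forest :: "(nat set \<Rightarrow> real) \<Rightarrow> graph \<Rightarrow> graph \<Rightarrow> bool" where
  "is_minimum_spanning_forest w E F \<longleftrightarrow>
     is_spanning_forest E F \<and> (\<forall>F'. is_spanning_forest E F' \<longrightarrow> sum w F \<le> sum w F')"

text \<open>Edges are unweighted, i.e. all have weight \<open>1\<close>.\<close>

definition minimum_spanning_forest_size :: problem where
  "minimum_spanning_forest_size = \<lparr>
     admissible = (\<lambda>n xs. xs = []),
     answer = (\<lambda>n E xs y. \<exists>F. is_minimum_spanning_forest (\<lambda>_. 1) E F \<and> y 0 = card F)\<rparr>"

definition density :: "graph \<Rightarrow> nat set \<Rightarrow> real" where
  "density E U = real (card {e \<in> E. e \<subseteq> U}) / real (card U)"

definition maximum_density :: "nat \<Rightarrow> graph \<Rightarrow> real" where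
  "maximum_density n E = Max (density E ` {U. U \<subseteq> {..<n} \<and> U \<noteq> {}})"

text \<open>
  The estimate \<open>x\<close> of the maximum density \<open>\<rho>\<close> is output as a fraction of two words and has to
  satisfy \<open>\<rho> / \<alpha> \<le> x \<le> \<rho>\<close>.
\<close>

definition maximum_density_approximation :: "real \<Rightarrow> problem" where
  "maximum_density_approximation \<alpha> = \<lparr>
     admissible = (\<lambda>n xs. xs = []),
     answer = (\<lambda>n E xs y. let x = real (y 0) / real (y 1) in
       maximum_density n E \<le> \<alpha> * x \<and> x \<le> maximum_density n E)\<rparr>"

end

theory Submission
  imports Defs
begin

text \<open>
  Fix \<open>p \<approx> n powr (1 / (d + 1))\<close>, where the preprocessing of the data structure takes time
  \<open>O(N ^ d)\<close>, and use a single data structure on \<open>N = 8 * p + 8\<close> vertices; its preprocessing then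
  costs only \<open>O(n)\<close>.  Cut the columns of the matrix into \<open>B\<close> blocks of width \<open>p\<close>.  The timeline has one
  interval for each row \<open>i\<close> and block \<open>b\<close>, during which the graph contains an edge for each entry of
  that piece of row \<open>i\<close>.  A vector is handled block by block: insert, before all the intervals, an edge for each entry
  of the block, ask one query in the interval of each row, and cancel the \<open>p\<close> insertions.  A gadget
  makes the answer reveal whether the two sets of edges meet in a common column.  These are
  \<open>O(n ^ 3 / p)\<close> operations, polynomially many in \<open>N\<close>, so time \<open>O(N powr (1 - \<epsilon>))\<close> for each of them
  gives total time \<open>O(n powr (3 - \<epsilon> / (d + 1)))\<close>.  The operations do not depend on
  the answers, so the amortized bound applies to the whole sequence.
\<close>

section \<open>Weakest preconditions with running times\<close>

text \<open>With \<open>N\<close> close to \<open>n\<close>, one query per row and vector would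
  already give \<open>O(n powr (3 - \<epsilon>))\<close>, but a preprocessing of arbitrary
  polynomial degree could then dominate; hence blocks much narrower than \<open>n\<close>. The
  hardness comes from retroactivity: the timeline keeps the pieces of all rows at different times,
  and one insertion before them changes all these graphs at once, so \<open>p\<close> insertions and
  \<open>p\<close> cancellations serve \<open>n\<close> queries. Since the conjecture speaks about
  programs, the reduction must be a program too: it contains the two programs of the data structure,
  relocated in memory, and inherits their running time. The proof fixes the run of the data
  structure for the matrix and all vectors; the reduction can retrace it although it learns the
  vectors one at a time, because an operation depends only on vectors already received. A gadget
  condenses \<open>p\<close> columns into one answer. For the density it also has to leave a gap of
  ratio \<open>3 / 2\<close>: a triangle has density \<open>1\<close>, a path with two edges
  \<open>2 / 3\<close>.\<close>

abbreviation seq :: "com \<Rightarrow> com \<Rightarrow> com" (infixr ";;" 60) where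
  "c ;; d \<equiv> Seq c d"

text \<open>The postcondition also receives the number of steps, so correctness and running time are
  proved together. Overflow or divergence leaves no execution and makes it false.\<close>

definition wp :: "nat \<Rightarrow> com \<Rightarrow> (nat \<Rightarrow> machine \<Rightarrow> bool) \<Rightarrow> machine \<Rightarrow> bool" where
  "wp W c Q s \<longleftrightarrow> (\<exists>t s'. exec W c s t s' \<and> Q t s')"

lemma wp_mono: "wp W c Q s \<Longrightarrow> (\<And>t s'. Q t s' \<Longrightarrow> Q' t s') \<Longrightarrow> wp W c Q' s"
  by (auto simp: wp_def)

lemma wp_Skip [simp]: "wp W Skip Q s \<longleftrightarrow> Q 1 s"
  by (auto simp: wp_def intro: exec.Skip[unfolded One_nat_def] elim!: exec_SkipE)

lemma wp_Comp [simp]: "wp W (Comp x f a b) Q s \<longleftrightarrow>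
    eval_binop f (val s a) (val s b) \<le> W \<and>
    Q 1 (s\<lparr>mem := (mem s)(x := eval_binop f (val s a) (val s b))\<rparr>)"
  by (auto simp: wp_def intro: exec.Comp[OF refl, unfolded One_nat_def] elim!: exec_CompE)

lemma wp_Store [simp]: "wp W (Store x a) Q s \<longleftrightarrow>
    val s a \<le> W \<and> Q 1 (s\<lparr>mem := (mem s)(mem s x := val s a)\<rparr>)"
  by (auto simp: wp_def intro: exec.Store[unfolded One_nat_def] elim!: exec_StoreE)

lemma wp_Input [simp]: "wp W (Input x a) Q s \<longleftrightarrow>
    inp s (val s a) \<le> W \<and> Q 1 (s\<lparr>mem := (mem s)(x := inp s (val s a))\<rparr>)"
  by (auto simp: wp_def intro: exec.Input[unfolded One_nat_def] elim!: exec_InputE)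

lemma wp_Output [simp]: "wp W (Output a b) Q s \<longleftrightarrow>
    val s b \<le> W \<and> Q 1 (s\<lparr>out := (out s)(val s a := val s b)\<rparr>)"
  by (auto simp: wp_def intro: exec.Output[unfolded One_nat_def] elim!: exec_OutputE)

lemma wp_TMove [simp]: "wp W (TMove a b) Q s \<longleftrightarrow>
    Q 1 (s\<lparr>tmem := (tmem s)(val s a := tmem s (val s b))\<rparr>)"
  by (auto simp: wp_def intro: exec.TMove[unfolded One_nat_def] elim!: exec_TMoveE)

lemma wp_TWord [simp]: "wp W (TWord a b) Q s \<longleftrightarrow>
    Q 1 (s\<lparr>tmem := (tmem s)(val s a := real (val s b))\<rparr>)"
  by (auto simp: wp_def intro: exec.TWord[unfolded One_nat_def] elim!: exec_TWordE)

lemma wp_TLess [simp]: "wp W (TLess x a b) Q s \<longleftrightarrow>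
    of_bool (tmem s (val s a) < tmem s (val s b)) \<le> W \<and>
    Q 1 (s\<lparr>mem := (mem s)(x := of_bool (tmem s (val s a) < tmem s (val s b)))\<rparr>)"
  unfolding wp_def by (metis exec.TLess exec_TLessE)

lemma wp_Seq [simp]:
  "wp W (c ;; d) Q s \<longleftrightarrow> wp W c (\<lambda>t1. wp W d (\<lambda>t2. Q (t1 + t2))) s"
  unfolding wp_def by (blast intro: exec.Seq elim: exec_SeqE)

lemma wp_Cond [simp]: "wp W (Cond a c d) Q s \<longleftrightarrow>
    (if val s a \<noteq> 0 then wp W c (\<lambda>t. Q (Suc t)) s else wp W d (\<lambda>t. Q (Suc t)) s)"
  unfolding wp_def by (auto intro: exec.CondTrue exec.CondFalse elim!: exec_CondE)

text \<open>Kept out of the simplifier, where the unfolding would repeat forever.\<close>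

lemma wp_While: "wp W (While a c) Q s \<longleftrightarrow>
    (if val s a \<noteq> 0 then wp W c (\<lambda>t1. wp W (While a c) (\<lambda>t2. Q (Suc (t1 + t2)))) s else Q 1 s)"
  (is "?l \<longleftrightarrow> ?r")
proof
  assume ?l then show ?r
    unfolding wp_def by (auto elim!: exec_WhileE[of W a c s])
next
  assume ?r then show ?l
    unfolding wp_def by (auto split: if_splits intro: exec.WhileTrue exec.WhileFalse[unfolded One_nat_def])
qed

text \<open>Address 12 counts up from 0, address 13 counts the remaining iterations.\<close>

definition for_loop :: "nat \<Rightarrow> com \<Rightarrow> com" where
  "for_loop l c = Comp 12 Add (Imm 0) (Imm 0) ;; Comp 13 Add (Dir l) (Imm 0) ;;
     While (Dir 13) (c ;; Comp 12 Add (Dir 12) (Imm 1) ;; Comp 13 Sub (Dir 13) (Imm 1))"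

text \<open>The bound \<open>b x\<close> depends on the iteration because the costs of simulated
  operations are controlled only in total. An iteration adds 3 steps for the test and the two
  counters; 3 more pay for initialising both counters and for the final test.\<close>

lemma wp_for_loop:
  fixes Inv :: "nat \<Rightarrow> machine \<Rightarrow> bool"
  assumes l: "l \<noteq> 12" "mem s l = L" "L \<le> W"
    and init: "Inv 0 s"
    and cong: "\<And>x s u v. Inv x s \<Longrightarrow> Inv x (s\<lparr>mem := (mem s)(12 := u, 13 := v)\<rparr>)"
    and body: "\<And>x s. x < L \<Longrightarrow> Inv x s \<Longrightarrow> mem s 12 = x \<Longrightarrow>
      wp W c (\<lambda>t s'. Inv (Suc x) s' \<and> mem s' 12 = x \<and> mem s' 13 = mem s 13 \<and> t \<le> b x) s"
  shows "wp W (for_loop l c) (\<lambda>t s'. Inv L s' \<and> t \<le> (\<Sum>x<L. b x + 3) + 3) s"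
proof -
  let ?w = "While (Dir 13) (c ;; Comp 12 Add (Dir 12) (Imm 1) ;; Comp 13 Sub (Dir 13) (Imm 1))"
  \<comment> \<open>Induction on the number \<open>k\<close> of remaining iterations, the content of
    address 13.\<close>
  have loop: "wp W ?w (\<lambda>t s'. Inv L s' \<and> t \<le> (\<Sum>x = L - k..<L. b x + 3) + 1) s"
    if "k \<le> L" "Inv (L - k) s" "mem s 12 = L - k" "mem s 13 = k" for k s
    using that
  proof (induction k arbitrary: s)
    case 0
    then show ?case by (subst wp_While) simp
  next
    case (Suc k)
    have [simp]: "Suc (L - Suc k) = L - k" using Suc.prems by simp
    have sum: "(\<Sum>x = L - Suc k..<L. b x + 3) = b (L - Suc k) + 3 + (\<Sum>x = L - k..<L. b x + 3)"
      using Suc.prems by (subst sum.atLeast_Suc_lessThan) auto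
    let ?Q = "\<lambda>t s'. Inv L s' \<and> t \<le> (\<Sum>x = L - Suc k..<L. b x + 3) + 1"
    have "wp W c (\<lambda>t s'. Inv (Suc (L - Suc k)) s' \<and> mem s' 12 = L - Suc k \<and> mem s' 13 = mem s 13 \<and>
        t \<le> b (L - Suc k)) s"
      using Suc.prems by (intro body) auto
    then have "wp W (c ;; Comp 12 Add (Dir 12) (Imm 1) ;; Comp 13 Sub (Dir 13) (Imm 1))
      (\<lambda>t1. wp W ?w (\<lambda>t2. ?Q (Suc (t1 + t2)))) s"
      unfolding wp_Seq
    proof (rule wp_mono)
      fix t s'
      assume s': "Inv (Suc (L - Suc k)) s' \<and> mem s' 12 = L - Suc k \<and> mem s' 13 = mem s 13
        \<and> t \<le> b (L - Suc k)"
      let ?s = "s'\<lparr>mem := (mem s')(12 := L - k, 13 := k)\<rparr>"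
      have *: "wp W ?w (\<lambda>t s'. Inv L s' \<and> t \<le> (\<Sum>x = L - k..<L. b x + 3) + 1) ?s"
        using Suc.prems s' cong[of "L - k" s' "L - k" k] by (intro Suc.IH) auto
      have "wp W ?w (\<lambda>t2 s'. Inv L s' \<and> Suc (t + 2 + t2) \<le> (\<Sum>x = L - Suc k..<L. b x + 3) + 1) ?s"
        by (rule wp_mono[OF *]) (use s' sum in linarith)
      then show "wp W (Comp 12 Add (Dir 12) (Imm 1)) (\<lambda>t1. wp W (Comp 13 Sub (Dir 13) (Imm 1))
        (\<lambda>t2. wp W ?w (\<lambda>t3. ?Q (Suc (t + (t1 + t2) + t3))))) s'"
        using Suc.prems s' l by simp
    qed
    then show ?case
      by (subst wp_While) (use Suc.prems in simp)
  qed
  have "wp W ?w (\<lambda>t s'. Inv L s' \<and> t \<le> (\<Sum>x = L - L..<L. b x + 3) + 1)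
      (s\<lparr>mem := (mem s)(12 := 0, 13 := L)\<rparr>)"
    using cong[OF init, of 0 L] by (intro loop) auto
  then show ?thesis
    using l by (auto simp: for_loop_def lessThan_atLeast0 elim!: wp_mono)
qed

section \<open>Simulation of a program inside another one\<close>

text \<open>
  The memory of the simulated program is shifted by 32.  Below that, addresses 0 to 2 are scratch
  space of the simulation, 3 and 4 stand for the output cells 0 and 1 (all other output is
  dropped), 5 to 7 for the input cells 0 to 2 (all others read 0), and 8 for the input time stamp.
\<close>

fun prepare :: "nat \<Rightarrow> operand \<Rightarrow> com" where
  "prepare x (Ind y) = Comp x Add (Dir (y + 32)) (Imm 32)"
| "prepare x _ = Skip"

text \<open>A pointer held in the simulated memory is too small by 32. \<open>prepare x\<close> puts
  the corrected pointer into scratch cell \<open>x\<close>, which is dereferenced here.\<close>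

fun shift :: "nat \<Rightarrow> operand \<Rightarrow> operand" where
  "shift x (Imm k) = Imm k"
| "shift x (Dir y) = Dir (y + 32)"
| "shift x (Ind y) = Ind x"

text \<open>
  Input and output cells from 3 on are treated alike, and an immediate index could exceed the
  word bound.
\<close>

fun cap :: "operand \<Rightarrow> operand" where
  "cap (Imm k) = Imm (min k 3)"
| "cap a = a"

text \<open>All times of the reduction are natural numbers, so the current time stamp is held as a
  word and \<open>TInput\<close> becomes \<open>TWord\<close>. Cells of the input and output arrays
  are selected by counting the index down. A loop repeats \<open>prepare\<close> at the end of its
  body because the pointer in its guard may have changed.\<close>

primrec embed :: "com \<Rightarrow> com" where
  "embed Skip = Skip"
| "embed (Comp x f a b) = prepare 0 a ;; prepare 1 b ;; Comp (x + 32) f (shift 0 a) (shift 1 b)"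
| "embed (Store x a) = prepare 0 a ;; Comp 1 Add (Dir (x + 32)) (Imm 32) ;; Store 1 (shift 0 a)"
| "embed (Input x a) = prepare 0 a ;; Comp 2 Add (shift 0 (cap a)) (Imm 0) ;;
     Cond (Dir 2) (Comp 2 Sub (Dir 2) (Imm 1) ;;
       Cond (Dir 2) (Comp 2 Sub (Dir 2) (Imm 1) ;;
         Cond (Dir 2) (Comp (x + 32) Add (Imm 0) (Imm 0))
         (Comp (x + 32) Add (Dir 7) (Imm 0)))
       (Comp (x + 32) Add (Dir 6) (Imm 0)))
     (Comp (x + 32) Add (Dir 5) (Imm 0))"
| "embed (Output a b) = prepare 0 a ;; prepare 1 b ;; Comp 2 Add (shift 0 (cap a)) (Imm 0) ;;
     Cond (Dir 2) (Comp 2 Sub (Dir 2) (Imm 1) ;;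
       Cond (Dir 2) Skip (Comp 4 Add (shift 1 b) (Imm 0)))
     (Comp 3 Add (shift 1 b) (Imm 0))"
| "embed (TInput a) = prepare 0 a ;; TWord (shift 0 a) (Dir 8)"
| "embed (TMove a b) = prepare 0 a ;; prepare 1 b ;; TMove (shift 0 a) (shift 1 b)"
| "embed (TWord a b) = prepare 0 a ;; prepare 1 b ;; TWord (shift 0 a) (shift 1 b)"
| "embed (TLess x a b) = prepare 0 a ;; prepare 1 b ;; TLess (x + 32) (shift 0 a) (shift 1 b)"
| "embed (Seq c d) = embed c ;; embed d"
| "embed (Cond a c d) = prepare 0 a ;; Cond (shift 0 a) (embed c) (embed d)"
| "embed (While a c) = prepare 0 a ;; While (shift 0 a) (embed c ;; prepare 0 a)"

text \<open>The bound on stored words is part of the relation so that adding 32 to a pointer cannot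
  overflow. The time memory is not shifted, as the reduction keeps no time stamps of its own
  there.\<close>

definition sim :: "nat \<Rightarrow> machine \<Rightarrow> machine \<Rightarrow> bool" where
  "sim W s \<sigma> \<longleftrightarrow> (\<forall>a. mem \<sigma> (a + 32) = mem s a \<and> mem s a \<le> W) \<and> tmem \<sigma> = tmem s"

text \<open>\<open>sim\<close> is the relation between two operations, \<open>sim_io\<close> the one
  while an operation is processed; its bound on the output lets a gadget compute with the
  answer.\<close>

definition sim_io :: "nat \<Rightarrow> machine \<Rightarrow> machine \<Rightarrow> bool" where
  "sim_io W s \<sigma> \<longleftrightarrow> sim W s \<sigma> \<and>
     inp s = (\<lambda>i. if i = 0 then mem \<sigma> 5 else if i = 1 then mem \<sigma> 6 else if i = 2 then mem \<sigma> 7 else 0) \<and>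
     tinp s = real (mem \<sigma> 8) \<and> out s 0 = mem \<sigma> 3 \<and> out s 1 = mem \<sigma> 4 \<and> (\<forall>a. out s a \<le> W)"

text \<open>A simulated step must not disturb the matrix or vector being read, the output produced
  so far, or the registers of the reduction.\<close>

definition frame :: "machine \<Rightarrow> machine \<Rightarrow> bool" where
  "frame \<sigma> \<sigma>' \<longleftrightarrow> inp \<sigma>' = inp \<sigma> \<and> out \<sigma>' = out \<sigma> \<and> (\<forall>a. 5 \<le> a \<and> a < 32 \<longrightarrow> mem \<sigma>' a = mem \<sigma> a)"

lemma frame_refl: "frame s s" by (simp add: frame_def)
lemma frame_trans: "frame s s' \<Longrightarrow> frame s' s'' \<Longrightarrow> frame s s''" by (simp add: frame_def)

definition ready :: "nat \<Rightarrow> operand \<Rightarrow> machine \<Rightarrow> machine \<Rightarrow> bool" where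
  "ready x a s \<sigma> \<longleftrightarrow> (\<forall>y. a = Ind y \<longrightarrow> mem \<sigma> x = mem s y + 32)"

lemma val_shift: "sim_io W s \<sigma> \<Longrightarrow> ready x a s \<sigma> \<Longrightarrow> val \<sigma> (shift x a) = val s a"
  by (cases a) (auto simp: sim_io_def sim_def ready_def)

lemma val_shift_cap:
  "sim_io W s \<sigma> \<Longrightarrow> ready x a s \<sigma> \<Longrightarrow> val \<sigma> (shift x (cap a)) \<le> W + 32"
  "sim_io W s \<sigma> \<Longrightarrow> ready x a s \<sigma> \<Longrightarrow> min 3 (val \<sigma> (shift x (cap a))) = min 3 (val s a)"
  by (cases a; auto simp: sim_io_def sim_def ready_def intro: le_trans[of _ W])+

lemma wp_prepare:
  assumes "sim_io W s \<sigma>" "W + 32 \<le> W'" "x < 3"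
    and "\<And>\<sigma>'. sim_io W s \<sigma>' \<Longrightarrow> frame \<sigma> \<sigma>' \<Longrightarrow> ready x a s \<sigma>' \<Longrightarrow>
      \<forall>y. y \<noteq> x \<longrightarrow> mem \<sigma>' y = mem \<sigma> y \<Longrightarrow> Q 1 \<sigma>'"
  shows "wp W' (prepare x a) Q \<sigma>"
proof (cases a)
  case (Ind y)
  let ?s = "\<sigma>\<lparr>mem := (mem \<sigma>)(x := mem s y + 32)\<rparr>"
  have y: "mem s y \<le> W" "mem \<sigma> (y + 32) = mem s y"
    using assms(1) by (auto simp: sim_io_def sim_def)
  have "Q 1 ?s"
    using assms(1,3) Ind
    by (intro assms(4)) (auto simp: sim_io_def sim_def frame_def ready_def)
  then show ?thesis
    using Ind y assms(2) by simp
qed (use assms in \<open>auto intro!: assms(4) simp: frame_refl ready_def\<close>)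

lemma wp_prepare2:
  assumes "sim_io W s \<sigma>" "W + 32 \<le> W'"
    and "\<And>\<sigma>'. sim_io W s \<sigma>' \<Longrightarrow> frame \<sigma> \<sigma>' \<Longrightarrow> ready 0 a s \<sigma>' \<Longrightarrow> ready 1 b s \<sigma>' \<Longrightarrow> Q 1 1 \<sigma>'"
  shows "wp W' (prepare 0 a) (\<lambda>t. wp W' (prepare 1 b) (\<lambda>t2. Q t t2)) \<sigma>"
  using assms(1,2)
proof (rule wp_prepare)
  fix \<sigma>' assume 1: "sim_io W s \<sigma>'" "frame \<sigma> \<sigma>'" "ready 0 a s \<sigma>'"
  show "wp W' (prepare 1 b) (\<lambda>t2. Q 1 t2) \<sigma>'"
    using 1(1) assms(2)
  proof (rule wp_prepare)
    fix \<sigma>'' assume 2: "sim_io W s \<sigma>''" "frame \<sigma>' \<sigma>''" "ready 1 b s \<sigma>''"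
      "\<forall>y. y \<noteq> 1 \<longrightarrow> mem \<sigma>'' y = mem \<sigma>' y"
    then have "ready 0 a s \<sigma>''" using 1 by (simp add: ready_def)
    then show "Q 1 1 \<sigma>''" using 1 2 assms(3) frame_trans by blast
  qed simp
qed simp

lemma sim_io_upd:
  "sim_io W s \<sigma> \<Longrightarrow> v \<le> W \<Longrightarrow>
    sim_io W (s\<lparr>mem := (mem s)(x := v)\<rparr>) (\<sigma>\<lparr>mem := (mem \<sigma>)(x + 32 := v)\<rparr>)"
  "frame \<sigma>0 \<sigma> \<Longrightarrow> frame \<sigma>0 (\<sigma>\<lparr>mem := (mem \<sigma>)(x + 32 := v)\<rparr>)"
  by (auto simp: sim_io_def sim_def frame_def)

lemma sim_io_tmp:
  "sim_io W s \<sigma> \<Longrightarrow> y < 3 \<Longrightarrow> sim_io W s (\<sigma>\<lparr>mem := (mem \<sigma>)(y := v)\<rparr>)"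
  "frame \<sigma>0 \<sigma> \<Longrightarrow> y < 5 \<Longrightarrow> frame \<sigma>0 (\<sigma>\<lparr>mem := (mem \<sigma>)(y := v)\<rparr>)"
  by (auto simp: sim_io_def sim_def frame_def)

lemma sim_io_le: "sim_io W s \<sigma> \<Longrightarrow> mem s x \<le> W"
  by (auto simp: sim_io_def sim_def)

lemma sim_io_mem: "sim_io W s \<sigma> \<Longrightarrow> mem \<sigma> (x + 32) = mem s x"
  by (auto simp: sim_io_def sim_def)

text \<open>Induction on the execution. The factor 10 leaves room: the longest replacement of a
  single instruction, that of \<open>Input\<close>, takes 8 steps.\<close>

lemma embed_correct:
  assumes "exec W c s t s'" "sim_io W s \<sigma>" "W + 32 \<le> W'"
  shows "wp W' (embed c) (\<lambda>t' \<sigma>'. sim_io W s' \<sigma>' \<and> frame \<sigma> \<sigma>' \<and> t' \<le> 10 * t) \<sigma>"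
  using assms
proof (induction arbitrary: \<sigma> rule: exec.induct)
  case (Skip s)
  then show ?case by (simp add: frame_refl)
next
  case (Comp f s a b r x)
  from Comp.prems show ?case
    unfolding embed.simps wp_Seq
    by (rule wp_prepare2) (use Comp in \<open>auto simp: val_shift sim_io_upd\<close>)
next
  case (Store s a x)
  from Store.prems show ?case
    unfolding embed.simps wp_Seq
  proof (rule wp_prepare)
    fix \<sigma>' assume *: "sim_io W s \<sigma>'" "frame \<sigma> \<sigma>'" "ready 0 a s \<sigma>'"
    let ?\<sigma> = "\<sigma>'\<lparr>mem := (mem \<sigma>')(1 := mem s x + 32)\<rparr>"
    have 1: "sim_io W s ?\<sigma>" "frame \<sigma> ?\<sigma>" using * by (auto intro: sim_io_tmp)
    have "ready 0 a s ?\<sigma>" using *(3) by (simp add: ready_def)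
    then have 2: "val ?\<sigma> (shift 0 a) = val s a" using 1 val_shift by blast
    show "wp W' (Comp 1 Add (Dir (x + 32)) (Imm 32)) (\<lambda>t1. wp W' (Store 1 (shift 0 a)) (\<lambda>t2 \<sigma>'.
        sim_io W (s\<lparr>mem := (mem s)(mem s x := val s a)\<rparr>) \<sigma>' \<and> frame \<sigma> \<sigma>' \<and> 1 + (t1 + t2) \<le> 10 * 1)) \<sigma>'"
      using 2 Store.hyps Store.prems sim_io_le[OF *(1), of x] sim_io_mem[OF *(1), of x]
        sim_io_upd(1)[OF 1(1) Store.hyps, of "mem s x"]
        sim_io_upd(2)[OF 1(2), where x = "mem s x" and v = "val s a"]
      by simp
  qed simp
next
  case (Input s a x)
  from Input.prems show ?case
    unfolding embed.simps wp_Seq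
  proof (rule wp_prepare)
    fix \<sigma>' assume *: "sim_io W s \<sigma>'" "frame \<sigma> \<sigma>'" "ready 0 a s \<sigma>'"
    let ?v = "val \<sigma>' (shift 0 (cap a))"
    have v: "?v \<le> W'" "min 3 ?v = min 3 (val s a)"
      using val_shift_cap[OF *(1,3)] Input.prems(2) by auto
    let ?\<sigma> = "\<lambda>u. \<sigma>'\<lparr>mem := (mem \<sigma>')(2 := u)\<rparr>"
    have 1: "sim_io W s (?\<sigma> u)" "frame \<sigma> (?\<sigma> u)" for u
      using * by (auto intro: sim_io_tmp)
    have inp: "mem \<sigma>' 5 = inp s 0" "mem \<sigma>' 6 = inp s 1" "mem \<sigma>' 7 = inp s 2"
      "inp s k = 0" if "k \<ge> 3" for k
      using *(1) that by (simp_all add: sim_io_def)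
    have U: "sim_io W (s\<lparr>mem := (mem s)(x := inp s (val s a))\<rparr>)
        (\<sigma>'\<lparr>mem := (mem \<sigma>')(2 := u, x + 32 := inp s (val s a))\<rparr>)"
      "frame \<sigma> (\<sigma>'\<lparr>mem := (mem \<sigma>')(2 := u, x + 32 := inp s (val s a))\<rparr>)" for u
      using sim_io_upd(1)[OF 1(1) Input.hyps, of x] sim_io_upd(2)[OF 1(2), where x = x and v = "inp s (val s a)"]
      by simp_all
    consider "val s a = 0" "?v = 0" | "val s a = 1" "?v = 1" | "val s a = 2" "?v = 2"
      | "val s a \<ge> 3" "?v \<ge> 3"
      using v(2) by (auto simp: min_def split: if_splits) linarith+
    then show "wp W' (Comp 2 Add (shift 0 (cap a)) (Imm 0)) (\<lambda>t1. wp W'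
       (Cond (Dir 2) (Comp 2 Sub (Dir 2) (Imm 1) ;;
         Cond (Dir 2) (Comp 2 Sub (Dir 2) (Imm 1) ;;
           Cond (Dir 2) (Comp (x + 32) Add (Imm 0) (Imm 0))
           (Comp (x + 32) Add (Dir 7) (Imm 0)))
         (Comp (x + 32) Add (Dir 6) (Imm 0)))
       (Comp (x + 32) Add (Dir 5) (Imm 0))) (\<lambda>t2 \<sigma>'.
        sim_io W (s\<lparr>mem := (mem s)(x := inp s (val s a))\<rparr>) \<sigma>' \<and> frame \<sigma> \<sigma>' \<and> 1 + (t1 + t2) \<le> 10 * 1)) \<sigma>'"
      by cases (use v(1) U Input.hyps Input.prems(2) in \<open>auto simp: inp[OF order.refl] inp(4)\<close>)
  qed simp
next
  case (Output s b a)
  from Output.prems show ?case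
    unfolding embed.simps wp_Seq
  proof (rule wp_prepare2)
    fix \<sigma>' assume *: "sim_io W s \<sigma>'" "frame \<sigma> \<sigma>'" "ready 0 a s \<sigma>'" "ready 1 b s \<sigma>'"
    let ?v = "val \<sigma>' (shift 0 (cap a))"
    let ?s = "s\<lparr>out := (out s)(val s a := val s b)\<rparr>"
    have v: "?v \<le> W'" "min 3 ?v = min 3 (val s a)"
      using val_shift_cap[OF *(1,3)] Output.prems(2) by auto
    have b: "val (\<sigma>'\<lparr>mem := (mem \<sigma>')(2 := u)\<rparr>) (shift 1 b) = val s b" for u
      using *(1,4) by (intro val_shift) (auto intro: sim_io_tmp simp: ready_def)
    let ?\<sigma> = "\<lambda>u. \<sigma>'\<lparr>mem := (mem \<sigma>')(2 := u)\<rparr>"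
    have F: "frame \<sigma> (\<sigma>'\<lparr>mem := (mem \<sigma>')(2 := u, y := w)\<rparr>)" if "y < 5" for y u w
      using *(2) that by (auto simp: frame_def)
    have F': "frame \<sigma> (?\<sigma> u)" for u
      using *(2) by (auto simp: frame_def)
    have O: "val s a = 0 \<Longrightarrow> sim_io W ?s (\<sigma>'\<lparr>mem := (mem \<sigma>')(2 := u, 3 := val s b)\<rparr>)"
      "val s a = 1 \<Longrightarrow> sim_io W ?s (\<sigma>'\<lparr>mem := (mem \<sigma>')(2 := u, 4 := val s b)\<rparr>)"
      "val s a \<ge> 2 \<Longrightarrow> sim_io W ?s (?\<sigma> u)" for u
      using *(1) Output.hyps by (auto simp: sim_io_def sim_def)
    consider "val s a = 0" "?v = 0" | "val s a = 1" "?v = 1" | "val s a \<ge> 2" "?v \<ge> 2"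
      using v(2) by (auto simp: min_def split: if_splits) linarith+
    then show "wp W' (Comp 2 Add (shift 0 (cap a)) (Imm 0)) (\<lambda>t1. wp W'
       (Cond (Dir 2) (Comp 2 Sub (Dir 2) (Imm 1) ;;
         Cond (Dir 2) Skip (Comp 4 Add (shift 1 b) (Imm 0)))
       (Comp 3 Add (shift 1 b) (Imm 0))) (\<lambda>t2 \<sigma>'.
        sim_io W ?s \<sigma>' \<and> frame \<sigma> \<sigma>' \<and> 1 + (1 + (t1 + t2)) \<le> 10 * 1)) \<sigma>'"
      by cases (use v(1) F F' O Output.hyps Output.prems(2) in \<open>auto simp: b[simplified]\<close>)
  qed
next
  case (TInput a s)
  from TInput.prems show ?case
    unfolding embed.simps wp_Seq
    by (rule wp_prepare) (auto simp: val_shift, auto simp: sim_io_def sim_def frame_def)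
next
  case (TMove a b s)
  from TMove.prems show ?case
    unfolding embed.simps wp_Seq
    by (rule wp_prepare2) (auto simp: val_shift, auto simp: sim_io_def sim_def frame_def)
next
  case (TWord a b s)
  from TWord.prems show ?case
    unfolding embed.simps wp_Seq
    by (rule wp_prepare2) (auto simp: val_shift, auto simp: sim_io_def sim_def frame_def)
next
  case (TLess r s a b x)
  from TLess.prems show ?case
    unfolding embed.simps wp_Seq
  proof (rule wp_prepare2)
    fix \<sigma>' assume *: "sim_io W s \<sigma>'" "frame \<sigma> \<sigma>'" "ready 0 a s \<sigma>'" "ready 1 b s \<sigma>'"
    then have "r = of_bool (tmem \<sigma>' (val \<sigma>' (shift 0 a)) < tmem \<sigma>' (val \<sigma>' (shift 1 b)))"
      using TLess by (simp add: val_shift) (simp add: sim_io_def sim_def)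
    then have r: "of_bool (tmem \<sigma>' (val \<sigma>' (shift 0 a)) < tmem \<sigma>' (val \<sigma>' (shift 1 b))) = r"
      by (rule sym)
    show "wp W' (TLess (x + 32) (shift 0 a) (shift 1 b)) (\<lambda>t2 \<sigma>''.
        sim_io W (s\<lparr>mem := (mem s)(x := r)\<rparr>) \<sigma>'' \<and> frame \<sigma> \<sigma>'' \<and> 1 + (1 + t2) \<le> 10 * 1) \<sigma>'"
      unfolding wp_TLess r using * TLess.hyps(2) TLess.prems by (simp add: sim_io_upd)
  qed
next
  case (Seq c1 s t1 s1 c2 t2 s2)
  show ?case
    unfolding embed.simps wp_Seq
  proof (rule wp_mono[OF Seq.IH(1)[OF Seq.prems]])
    fix u1 \<sigma>1 assume *: "sim_io W s1 \<sigma>1 \<and> frame \<sigma> \<sigma>1 \<and> u1 \<le> 10 * t1"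
    show "wp W' (embed c2) (\<lambda>u2 \<sigma>'. sim_io W s2 \<sigma>' \<and> frame \<sigma> \<sigma>' \<and> u1 + u2 \<le> 10 * (t1 + t2)) \<sigma>1"
      by (rule wp_mono[OF Seq.IH(2)[OF _ Seq.prems(2)]]) (use * frame_trans in auto)
  qed
next
  case (CondTrue s a c1 t s1 c2)
  from CondTrue.prems show ?case
    unfolding embed.simps wp_Seq
  proof (rule wp_prepare)
    fix \<sigma>' assume *: "sim_io W s \<sigma>'" "frame \<sigma> \<sigma>'" "ready 0 a s \<sigma>'"
    show "wp W' (Cond (shift 0 a) (embed c1) (embed c2))
        (\<lambda>t2 \<sigma>'. sim_io W s1 \<sigma>' \<and> frame \<sigma> \<sigma>' \<and> 1 + t2 \<le> 10 * Suc t) \<sigma>'"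
      using CondTrue.hyps * by (auto simp: val_shift
        intro!: wp_mono[OF CondTrue.IH[OF _ CondTrue.prems(2)]] elim: frame_trans)
  qed simp
next
  case (CondFalse s a c2 t s1 c1)
  from CondFalse.prems show ?case
    unfolding embed.simps wp_Seq
  proof (rule wp_prepare)
    fix \<sigma>' assume *: "sim_io W s \<sigma>'" "frame \<sigma> \<sigma>'" "ready 0 a s \<sigma>'"
    show "wp W' (Cond (shift 0 a) (embed c1) (embed c2))
        (\<lambda>t2 \<sigma>'. sim_io W s1 \<sigma>' \<and> frame \<sigma> \<sigma>' \<and> 1 + t2 \<le> 10 * Suc t) \<sigma>'"
      using CondFalse.hyps * by (auto simp: val_shift
        intro!: wp_mono[OF CondFalse.IH[OF _ CondFalse.prems(2)]] elim: frame_trans)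
  qed simp
next
  case (WhileFalse s a c)
  from WhileFalse.prems show ?case
    unfolding embed.simps wp_Seq
    by (rule wp_prepare) (use WhileFalse in \<open>auto simp: val_shift wp_While\<close>)
next
  case (WhileTrue s a c t1 s1 t2 s2)
  from WhileTrue.prems show ?case
    unfolding embed.simps wp_Seq
  proof (rule wp_prepare)
    let ?w = "While (shift 0 a) (embed c ;; prepare 0 a)"
    fix \<sigma>' assume *: "sim_io W s \<sigma>'" "frame \<sigma> \<sigma>'" "ready 0 a s \<sigma>'"
    have "wp W' (embed c ;; prepare 0 a) (\<lambda>u1. wp W' ?w (\<lambda>u2 \<sigma>'.
        sim_io W s2 \<sigma>' \<and> frame \<sigma> \<sigma>' \<and> 1 + Suc (u1 + u2) \<le> 10 * Suc (t1 + t2))) \<sigma>'"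
      unfolding wp_Seq
    proof (rule wp_mono[OF WhileTrue.IH(1)[OF *(1) WhileTrue.prems(2)]])
      fix u1 \<sigma>1 assume u1: "sim_io W s1 \<sigma>1 \<and> frame \<sigma>' \<sigma>1 \<and> u1 \<le> 10 * t1"
      \<comment> \<open>The induction hypothesis for the rest of the loop begins with a
        \<open>prepare\<close>; it is the one at the end of the current body.\<close>
      have "wp W' (embed (While a c)) (\<lambda>u \<sigma>'. sim_io W s2 \<sigma>' \<and> frame \<sigma>1 \<sigma>' \<and> u \<le> 10 * t2) \<sigma>1"
        using u1 WhileTrue by blast
      then have "wp W' (prepare 0 a) (\<lambda>u2. wp W' ?w (\<lambda>u3 \<sigma>'.
        sim_io W s2 \<sigma>' \<and> frame \<sigma>1 \<sigma>' \<and> u2 + u3 \<le> 10 * t2)) \<sigma>1"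
        by simp
      then show "wp W' (prepare 0 a) (\<lambda>u2. wp W' ?w (\<lambda>u3 \<sigma>'.
        sim_io W s2 \<sigma>' \<and> frame \<sigma> \<sigma>' \<and> 1 + Suc (u1 + u2 + u3) \<le> 10 * Suc (t1 + t2))) \<sigma>1"
        by (elim wp_mono) (use u1 *(2) in \<open>auto elim: frame_trans\<close>)
    qed
    then show "wp W' ?w (\<lambda>t \<sigma>'. sim_io W s2 \<sigma>' \<and> frame \<sigma> \<sigma>' \<and> 1 + t \<le> 10 * Suc (t1 + t2)) \<sigma>'"
      by (subst wp_While) (use WhileTrue.hyps(1) val_shift[OF *(1,3)] in simp)
  qed simp
qed

text \<open>Cells 3 and 4 are zeroed because every request starts with a cleared output
  array.\<close>

definition call :: "com \<Rightarrow> com" where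
  "call c = Comp 3 Add (Imm 0) (Imm 0) ;; Comp 4 Add (Imm 0) (Imm 0) ;; embed c"

lemma wp_call:
  assumes "exec W c (feed r s) t s'" "sim W s \<sigma>" "W + 32 \<le> W'"
    and r: "length (fst r) \<le> 3" "snd r = real (mem \<sigma> 8)"
      "\<And>i. i < 3 \<Longrightarrow> mem \<sigma> (5 + i) = (if i < length (fst r) then fst r ! i else 0)"
    and Q: "\<And>t' \<sigma>'. sim W s' \<sigma>' \<Longrightarrow> frame \<sigma> \<sigma>' \<Longrightarrow> t' \<le> 10 * t + 2 \<Longrightarrow>
      mem \<sigma>' 3 = out s' 0 \<Longrightarrow> mem \<sigma>' 4 = out s' 1 \<Longrightarrow> out s' 0 \<le> W \<Longrightarrow> out s' 1 \<le> W \<Longrightarrow> Q t' \<sigma>'"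
  shows "wp W' (call c) Q \<sigma>"
proof -
  let ?\<sigma> = "\<sigma>\<lparr>mem := (mem \<sigma>)(3 := 0, 4 := 0)\<rparr>"
  have "(if i < length (fst r) then fst r ! i else 0) =
    (if i = 0 then mem \<sigma> 5 else if i = 1 then mem \<sigma> 6 else if i = 2 then mem \<sigma> 7 else 0)" for i
    using r(1) r(3)[of 0] r(3)[of 1] r(3)[of 2] by (auto split: if_splits)
  then have "sim_io W (feed r s) ?\<sigma>"
    using assms(2) r(2) by (auto simp: sim_io_def sim_def feed_def)
  note E = embed_correct[OF assms(1) this assms(3)]
  have "wp W' (embed c) (\<lambda>t'. Q (Suc (Suc t'))) ?\<sigma>"
  proof (rule wp_mono[OF E])
    fix t' \<sigma>' assume *: "sim_io W s' \<sigma>' \<and> frame ?\<sigma> \<sigma>' \<and> t' \<le> 10 * t"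
    then have "frame \<sigma> \<sigma>'" by (simp add: frame_def)
    moreover have "out s' 0 \<le> W" "out s' 1 \<le> W" using * unfolding sim_io_def by blast+
    ultimately show "Q (Suc (Suc t')) \<sigma>'"
      using * by (intro Q) (simp_all add: sim_io_def)
  qed
  then show ?thesis by (simp add: call_def)
qed

section \<open>Runs on sequences of requests\<close>

text \<open>Breaks a run into the states and costs of its single operations; the amortized guarantee
  bounds only the sum of these costs.\<close>

lemma serve_trace:
  assumes "serve W c s rs T outs"
  shows "\<exists>st \<tau>. st 0 = s \<and> T = (\<Sum>i<length rs. \<tau> i) \<and>
    (\<forall>i<length rs. exec W c (feed (rs ! i) (st i)) (\<tau> i) (st (Suc i)) \<and> outs ! i = out (st (Suc i)))"
  using assms
proof induction
  case (Nil s)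
  then show ?case by auto
next
  case (Cons r s t s' rs T outs)
  then obtain st \<tau> where *: "st 0 = s'" "T = (\<Sum>i<length rs. \<tau> i)"
    "\<And>i. i < length rs \<Longrightarrow>
      exec W c (feed (rs ! i) (st i)) (\<tau> i) (st (Suc i)) \<and> outs ! i = out (st (Suc i))"
    by blast
  show ?case
  proof (intro exI[of _ "case_nat s st"] exI[of _ "case_nat t \<tau>"] conjI allI impI)
    show "t + T = (\<Sum>i<length (r # rs). case_nat t \<tau> i)"
      using * by (simp add: sum.lessThan_Suc_shift del: sum.lessThan_Suc)
  qed (use * Cons.hyps in \<open>auto split: nat.split simp: less_Suc_eq_0_disj\<close>)
qed

text \<open>The opposite direction: a run of the reduction is assembled from one verified execution
  per request, linked by the invariant \<open>I\<close>.\<close>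

lemma serve_build:
  assumes "I 0 s"
    and "\<And>k s. k < m \<Longrightarrow> I k s \<Longrightarrow>
      wp W c (\<lambda>t s'. I (Suc k) s' \<and> good k (out s') \<and> t \<le> b k) (feed (r k) s)"
  shows "\<exists>T outs. serve W c s (map r [0..<m]) T outs \<and> (\<forall>k<m. good k (outs ! k)) \<and> T \<le> (\<Sum>k<m. b k)"
  using assms
proof (induction m arbitrary: I s r good b)
  case 0
  then show ?case by (auto intro: serve.Nil)
next
  case (Suc m)
  from Suc.prems(2)[of 0, OF _ Suc.prems(1)] obtain t s' where
    1: "exec W c (feed (r 0) s) t s'" "I (Suc 0) s'" "good 0 (out s')" "t \<le> b 0"
    by (auto simp: wp_def)
  have "\<exists>T outs. serve W c s' (map (\<lambda>k. r (Suc k)) [0..<m]) T outs \<and>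
      (\<forall>k<m. good (Suc k) (outs ! k)) \<and> T \<le> (\<Sum>k<m. b (Suc k))"
    by (rule Suc.IH[where I = "\<lambda>k. I (Suc k)"])
      (use 1 Suc.prems(2) in auto)
  then obtain T outs where 2: "serve W c s' (map (\<lambda>k. r (Suc k)) [0..<m]) T outs"
    "\<forall>k<m. good (Suc k) (outs ! k)" "T \<le> (\<Sum>k<m. b (Suc k))"
    by blast
  have "map r [0..<Suc m] = r 0 # map (\<lambda>k. r (Suc k)) [0..<m]"
    by (simp add: map_upt_Suc del: upt_Suc)
  moreover have "(\<Sum>k<Suc m. b k) = b 0 + (\<Sum>k<m. b (Suc k))"
    by (rule sum.lessThan_Suc_shift)
  ultimately show ?case
    using serve.Cons[OF 1(1) 2(1)] 1(3,4) 2(2,3)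
    by (intro exI[of _ "t + T"] exI[of _ "out s' # outs"])
      (auto simp: less_Suc_eq_0_disj simp del: sum.lessThan_Suc upt_Suc)
qed

section \<open>The timeline of a matrix\<close>

text \<open>The reduction only uses natural numbers as times, so sorting and initial segments can be
  treated on \<open>nat\<close>.\<close>

definition lift :: "(nat \<rightharpoonup> update) \<Rightarrow> timeline" where
  "lift f = (\<lambda>t. if t \<in> \<nat> then f (nat \<lfloor>t\<rfloor>) else None)"

lemma lift_real [simp]: "lift f (real t) = f t"
  by (simp add: lift_def)

lemma lift_upd: "(lift f)(real t := v) = lift (f(t := v))"
  by (auto simp: lift_def fun_eq_iff elim!: Nats_cases)

lemma dom_lift: "dom (lift f) = real ` dom f"
  by (auto simp: lift_def dom_def image_iff split: if_splits elim!: Nats_cases) 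

lemma sorted_list_of_set_real:
  assumes "finite A" shows "sorted_list_of_set (real ` A) = map real (sorted_list_of_set A)"
  using assms by (intro sorted_distinct_set_unique)
    (auto simp: distinct_map sorted_map inj_on_def intro: sorted_wrt_mono_rel[of _ "(\<le>)"])

lemma updates_at_lift:
  assumes "finite (dom f)"
  shows "updates_at (lift f) UNIV = map (the \<circ> f) (sorted_list_of_set (dom f))"
    and "updates_at (lift f) {..real t} = map (the \<circ> f) (sorted_list_of_set (dom f \<inter> {..t}))"
proof -
  have "real ` dom f \<inter> {..real t} = real ` (dom f \<inter> {..t})" by auto
  with assms show "updates_at (lift f) UNIV = map (the \<circ> f) (sorted_list_of_set (dom f))"
    "updates_at (lift f) {..real t} = map (the \<circ> f) (sorted_list_of_set (dom f \<inter> {..t}))"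
    by (auto simp: updates_at_def dom_lift sorted_list_of_set_real)
qed

lemma legal_updates_append:
  "legal_updates n G (xs @ ys) \<longleftrightarrow>
    legal_updates n G xs \<and> legal_updates n (fold apply_update xs G) ys"
  by (induction xs arbitrary: G) auto

fun edge_of :: "update \<Rightarrow> nat set" where
  "edge_of (Ins u v) = {u, v}"
| "edge_of (Del u v) = {u, v}"

text \<open>Applied with \<open>H\<close> the edges of the current vector block: they are inserted
  before everything else and no later update touches them, so they can be split off.\<close>

lemma updates_frame:
  assumes "\<forall>x\<in>set xs. edge_of x \<notin> H"
  shows "legal_updates n (H \<union> G) xs = legal_updates n G xs"
    and "fold apply_update xs (H \<union> G) = H \<union> fold apply_update xs G"
proof -
  have "legal_updates n (H \<union> G) xs = legal_updates n G xs \<and>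
    fold apply_update xs (H \<union> G) = H \<union> fold apply_update xs G"
    using assms
  proof (induction xs arbitrary: G)
    case (Cons x xs)
    have "apply_update x (H \<union> G) = H \<union> apply_update x G"
      "legal_update n (H \<union> G) x = legal_update n G x"
      using Cons.prems by (cases x; auto)+
    then show ?case using Cons by simp
  qed simp
  then show "legal_updates n (H \<union> G) xs = legal_updates n G xs"
    "fold apply_update xs (H \<union> G) = H \<union> fold apply_update xs G" by auto
qed

definition edge :: "nat \<times> nat \<Rightarrow> nat set" where
  "edge e = {fst e, snd e}"

definition ins :: "nat \<times> nat \<Rightarrow> update" where
  "ins e = Ins (fst e) (snd e)"

definition del :: "nat \<times> nat \<Rightarrow> update" where
  "del e = Del (fst e) (snd e)"

lemma ins_del [simp]:
  "edge_of (ins e) = edge e" "edge_of (del e) = edge e"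
  "apply_update (ins e) G = insert (edge e) G" "apply_update (del e) G = G - {edge e}"
  "legal_update n G (ins e) \<longleftrightarrow> edge e \<subseteq> {..<n} \<and> fst e \<noteq> snd e \<and> edge e \<notin> G"
  "legal_update n G (del e) \<longleftrightarrow> edge e \<subseteq> {..<n} \<and> fst e \<noteq> snd e \<and> edge e \<in> G"
  by (auto simp: edge_def ins_def del_def)

lemma legal_insertions:
  assumes "distinct js" "inj_on (\<lambda>j. edge (e j)) (set js)"
    and "\<And>j. j \<in> set js \<Longrightarrow> edge (e j) \<subseteq> {..<n} \<and> fst (e j) \<noteq> snd (e j)"
  shows "legal_updates n {} (map (\<lambda>j. ins (e j)) js) \<and>
    fold apply_update (map (\<lambda>j. ins (e j)) js) {} = (\<lambda>j. edge (e j)) ` set js"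
  using assms
proof (induction js rule: rev_induct)
  case (snoc j js)
  have "edge (e j) \<notin> (\<lambda>j. edge (e j)) ` set js"
    using snoc.prems(1,2) by (auto simp: inj_on_def)
  with snoc show ?case by (auto simp: legal_updates_append inj_on_def)
qed simp

text \<open>\<open>S x\<close> is the timeline before operation \<open>x\<close>. Once a closed
  formula for it is known, legality and correctness can be checked one operation at a time.\<close>

lemma operations_trace:
  assumes "\<And>x. x < L \<Longrightarrow> legal_operation P n (S x) (op x)"
    and "\<And>x. x < L \<Longrightarrow> apply_operation (op x) (S x) = S (Suc x)"
  shows "legal_operations P n (S 0) (map op [0..<L])"
    and "correct_answers P n (S 0) (map op [0..<L]) outs \<Longrightarrow>
      \<forall>x<L. correct_answer P n (S x) (op x) (outs ! x)"
proof -
  have "legal_operations P n (S a) (map op [a..<a + k]) \<and>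
    (correct_answers P n (S a) (map op [a..<a + k]) outs \<longrightarrow>
      (\<forall>x<k. correct_answer P n (S (a + x)) (op (a + x)) (outs ! x)))" if "a + k \<le> L" for a k outs
    using that
  proof (induction k arbitrary: a outs)
    case (Suc k)
    have *: "map op [a..<a + Suc k] = op a # map op [Suc a..<Suc a + k]"
      by (simp add: upt_conv_Cons del: upt_Suc)
    show ?case
    proof (intro conjI impI allI)
      show "legal_operations P n (S a) (map op [a..<a + Suc k])"
        unfolding * using Suc.IH[of "Suc a"] Suc.prems assms by (simp del: upt_Suc)
    next
      fix x assume "correct_answers P n (S a) (map op [a..<a + Suc k]) outs" "x < Suc k"
      then show "correct_answer P n (S (a + x)) (op (a + x)) (outs ! x)"
        unfolding * using Suc.IH[of "Suc a" "tl outs"] Suc.prems assms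
        by (cases outs; cases x) (auto simp del: upt_Suc)
    qed
  qed simp
  from this[of 0 L] show "legal_operations P n (S 0) (map op [0..<L])"
    and "correct_answers P n (S 0) (map op [0..<L]) outs \<Longrightarrow>
      \<forall>x<L. correct_answer P n (S x) (op x) (outs ! x)" by auto
qed

lemma div_mod_unique: "r < m \<Longrightarrow> (m * q + r) div m = q" "r < m \<Longrightarrow> (m * q + r) mod m = r"
  for q r m :: nat
  by simp_all

text \<open>The timeline for arbitrary families of edges: \<open>fe\<close> permanent,
  \<open>re q\<close> for the row piece \<open>q\<close>, \<open>ve w\<close> for the vector block
  \<open>w\<close>. Through \<open>inj\<close> and \<open>disjoint\<close> every insertion meets an
  absent edge, which is what legality demands.\<close>

locale schedule =
  fixes N p n B :: nat and args :: "nat list"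
    and fe :: "nat \<Rightarrow> nat \<times> nat" and re ve :: "nat \<Rightarrow> nat \<Rightarrow> nat \<times> nat"
  assumes p_pos: "p \<ge> 1" and B_pos: "B \<ge> 1"
    and vertices: "j < p \<Longrightarrow> edge (fe j) \<subseteq> {..<N}" "j < p \<Longrightarrow> edge (re q j) \<subseteq> {..<N}"
      "j < p \<Longrightarrow> edge (ve w j) \<subseteq> {..<N}"
    and loopfree: "fst (fe j) \<noteq> snd (fe j)" "fst (re q j) \<noteq> snd (re q j)" "fst (ve w j) \<noteq> snd (ve w j)"
    and inj: "edge (fe j) = edge (fe j') \<Longrightarrow> j = j'" "edge (re q j) = edge (re q j') \<Longrightarrow> j = j'"
      "edge (ve w j) = edge (ve w j') \<Longrightarrow> j = j'"
    and disjoint: "edge (fe j) \<noteq> edge (re q j')" "edge (fe j) \<noteq> edge (ve w j')"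
      "edge (re q j) \<noteq> edge (ve w j')"
begin

text \<open>
  The times \<open>0, \<dots>, p - 1\<close> are reserved for the edges \<open>ve w j\<close> of the current vector block \<open>w\<close>.  At
  time \<open>p + y\<close> the update \<open>upd y\<close> is placed: first the permanent edges \<open>fe j\<close>, then for each \<open>q\<close>,
  which encodes a pair of a row and a block, \<open>p\<close> insertions and \<open>p\<close> deletions of the edges \<open>re q j\<close>.
\<close>

definition upd :: "nat \<Rightarrow> update" where
  "upd y = (if y < p then ins (fe y) else
     let z = y - p; e = re (z div (2 * p)) (z mod (2 * p) mod p)
     in if z mod (2 * p) < p then ins e else del e)"

text \<open>One condition covers both halves of an interval: at position \<open>r\<close> the
  present edges are those with \<open>j < r\<close> while inserting and those with
  \<open>r - p \<le> j\<close> while deleting. For \<open>y < p\<close> truncated subtraction gives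
  position 0, hence no row edges.\<close>

definition base_graph :: "nat \<Rightarrow> graph" where
  "base_graph y = {edge (fe j) |j. j < p \<and> j < y} \<union>
     {edge (re ((y - p) div (2 * p)) j) |j.
        j < p \<and> j < (y - p) mod (2 * p) \<and> (y - p) mod (2 * p) \<le> p + j}"

lemma base_graph_step:
  "legal_update N (base_graph y) (upd y) \<and> apply_update (upd y) (base_graph y) = base_graph (Suc y)"
proof (cases "y < p")
  case True
  then have "base_graph y = {edge (fe j) |j. j < y}" "base_graph (Suc y) = {edge (fe j) |j. j < Suc y}"
    by (auto simp: base_graph_def)
  moreover have "edge (fe y) \<notin> {edge (fe j) |j. j < y}"
    using inj(1) by blast
  moreover have "upd y = ins (fe y)"
    using True by (simp add: upd_def)
  ultimately show ?thesis
    using vertices(1)[OF True] loopfree(1)[of y] by (auto simp: less_Suc_eq)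
next
  case False
  define z where "z = y - p"
  define q where "q = z div (2 * p)"
  define r where "r = z mod (2 * p)"
  have r: "r < 2 * p" using p_pos by (simp add: r_def)
  have z: "z = 2 * p * q + r" by (simp add: q_def r_def)
  have G: "base_graph y = {edge (fe j) |j. j < p} \<union> {edge (re q j) |j. j < p \<and> j < r \<and> r \<le> p + j}"
    using False by (auto simp: base_graph_def q_def r_def z_def)
  have y: "Suc y - p = Suc z" using False by (simp add: z_def)
  show ?thesis
  proof (cases "r < p")
    case True
    then have "Suc z div (2 * p) = q" "Suc z mod (2 * p) = Suc r"
      using div_mod_unique[of "Suc r" "2 * p" q] p_pos z by simp_all
    then have G': "base_graph (Suc y) = {edge (fe j) |j. j < p} \<union> {edge (re q j) |j. j < Suc r}"
      using False True y by (auto simp: base_graph_def)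
    have G: "base_graph y = {edge (fe j) |j. j < p} \<union> {edge (re q j) |j. j < r}"
      using G True by auto
    have "edge (re q r) \<notin> base_graph y"
      unfolding G using disjoint(1)[symmetric] by (auto dest: inj(2))
    moreover have u: "upd y = ins (re q r)"
      using False True by (simp add: upd_def Let_def z_def[symmetric] r_def[symmetric] q_def[symmetric])
    moreover have "insert (edge (re q r)) (base_graph y) = base_graph (Suc y)"
      unfolding G G' by (auto simp: less_Suc_eq)
    ultimately show ?thesis
      using vertices(2)[OF True, of q] loopfree(2)[of q r] by simp
  next
    case r': False
    have "\<exists>q'. {edge (re (Suc z div (2 * p)) j) |j.
        j < p \<and> j < Suc z mod (2 * p) \<and> Suc z mod (2 * p) \<le> p + j} = {edge (re q j) |j. j < p \<and> Suc (r - p) \<le> j}"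
    proof (cases "Suc r = 2 * p")
      case True
      \<comment> \<open>The last deletion completes the interval: the position wraps to 0 and both
        sets are empty.\<close>
      then have "Suc z = 2 * p * Suc q" by (simp add: z)
      then have "Suc z mod (2 * p) = 0" by (metis mod_mult_self1_is_0)
      then show ?thesis using True by auto
    next
      case False
      then have "Suc r < 2 * p" using r by simp
      then have "Suc z div (2 * p) = q" "Suc z mod (2 * p) = Suc r"
        using div_mod_unique[of "Suc r" "2 * p" q] z by simp_all
      then show ?thesis using r' by auto
    qed
    then have G': "base_graph (Suc y) = {edge (fe j) |j. j < p} \<union> {edge (re q j) |j. j < p \<and> Suc (r - p) \<le> j}"
      using False y unfolding base_graph_def by auto
    have G: "base_graph y = {edge (fe j) |j. j < p} \<union> {edge (re q j) |j. j < p \<and> r - p \<le> j}"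
      using G r' by auto
    have "r mod p = r - p" using r r' by (simp add: le_mod_geq)
    then have u: "upd y = del (re q (r - p))"
      using False r' by (simp add: upd_def Let_def z_def[symmetric] r_def[symmetric] q_def[symmetric])
    have rp: "r - p < p" using r r' by simp
    have "edge (re q (r - p)) \<in> base_graph y"
      unfolding G using rp by blast
    moreover have "edge (re q (r - p)) \<notin> base_graph (Suc y)"
      unfolding G' using disjoint(1)[symmetric] by (auto dest: inj(2))
    moreover have "base_graph y = insert (edge (re q (r - p))) (base_graph (Suc y))"
      unfolding G G' using rp by (auto simp: Suc_le_eq le_eq_less_or_eq)
    ultimately show ?thesis
      using vertices(2)[OF rp, of q] loopfree(2)[of q "r - p"] u by auto
  qed
qed

lemma base_graph:
  "legal_updates N {} (map upd [0..<y])" "fold apply_update (map upd [0..<y]) {} = base_graph y"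
proof -
  have "legal_updates N {} (map upd [0..<y]) \<and> fold apply_update (map upd [0..<y]) {} = base_graph y"
  proof (induction y)
    case 0
    then show ?case by (auto simp: base_graph_def)
  next
    case (Suc y)
    then show ?case using base_graph_step by (simp add: legal_updates_append)
  qed
  then show "legal_updates N {} (map upd [0..<y])"
    "fold apply_update (map upd [0..<y]) {} = base_graph y" by auto
qed

text \<open>\<open>A\<close> is the set of occupied vector slots and \<open>x\<close> the number of
  updates \<open>upd\<close> already placed; every timeline that occurs has this form.\<close>

definition slots :: "nat set \<Rightarrow> nat \<Rightarrow> nat \<Rightarrow> nat \<rightharpoonup> update" where
  "slots A w x y = (if y < p then if y \<in> A then Some (ins (ve w y)) else None
     else if y < p + x then Some (upd (y - p)) else None)"

lemma slots_list:
  assumes "A \<subseteq> {..<p}"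
  shows "dom (slots A w x) = A \<union> {p..<p + x}"
    and "k \<le> x \<Longrightarrow> map (the \<circ> slots A w x) (sorted_list_of_set (A \<union> {p..<p + k})) =
      map (\<lambda>j. ins (ve w j)) (sorted_list_of_set A) @ map upd [0..<k]"
proof -
  show "dom (slots A w x) = A \<union> {p..<p + x}"
    using assms by (auto simp: slots_def split: if_splits)
  have A: "finite A" using assms finite_subset by blast
  have "sorted_list_of_set (A \<union> {p..<p + k}) = sorted_list_of_set A @ [p..<p + k]"
    using assms A by (intro sorted_distinct_set_unique) (fastforce simp: sorted_append)+
  moreover have "[p..<p + k] = map (\<lambda>y. y + p) [0..<k]"
    by (simp add: map_add_upt add.commute)
  ultimately show "map (the \<circ> slots A w x) (sorted_list_of_set (A \<union> {p..<p + k})) =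
      map (\<lambda>j. ins (ve w j)) (sorted_list_of_set A) @ map upd [0..<k]" if "k \<le> x"
    using assms A that by (auto simp: slots_def)
qed

lemma edge_of_upd: "edge_of (upd y) \<notin> (\<lambda>j. edge (ve w j)) ` A"
  using disjoint by (auto simp: upd_def Let_def)

lemma slots_graph:
  assumes "A \<subseteq> {..<p}"
  shows "legal_updates N {} (map (\<lambda>j. ins (ve w j)) (sorted_list_of_set A) @ map upd [0..<k])"
    and "fold apply_update (map (\<lambda>j. ins (ve w j)) (sorted_list_of_set A) @ map upd [0..<k]) {} =
      (\<lambda>j. edge (ve w j)) ` A \<union> base_graph k"
proof -
  have A: "finite A" using assms finite_subset by blast
  have 1: "legal_updates N {} (map (\<lambda>j. ins (ve w j)) (sorted_list_of_set A))"
    "fold apply_update (map (\<lambda>j. ins (ve w j)) (sorted_list_of_set A)) {} =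
      (\<lambda>j. edge (ve w j)) ` A"
  proof -
    have "\<And>j. j \<in> set (sorted_list_of_set A) \<Longrightarrow> edge (ve w j) \<subseteq> {..<N} \<and> fst (ve w j) \<noteq> snd (ve w j)"
      using A assms vertices(3) loopfree(3) by auto
    from legal_insertions[where e = "ve w" and js = "sorted_list_of_set A", OF _ _ this] show "legal_updates N {} (map (\<lambda>j. ins (ve w j)) (sorted_list_of_set A))"
      "fold apply_update (map (\<lambda>j. ins (ve w j)) (sorted_list_of_set A)) {} = (\<lambda>j. edge (ve w j)) ` A"
      using A inj(3) by (simp_all add: inj_on_def)
  qed
  have 2: "\<forall>u\<in>set (map upd [0..<k]). edge_of u \<notin> (\<lambda>j. edge (ve w j)) ` A"
    using edge_of_upd by auto
  show "legal_updates N {} (map (\<lambda>j. ins (ve w j)) (sorted_list_of_set A) @ map upd [0..<k])"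
    "fold apply_update (map (\<lambda>j. ins (ve w j)) (sorted_list_of_set A) @ map upd [0..<k]) {} =
      (\<lambda>j. edge (ve w j)) ` A \<union> base_graph k"
    using updates_frame(1)[OF 2, of N "{}"] updates_frame(2)[OF 2, of "{}"] base_graph[of k] 1
    by (simp_all only: legal_updates_append fold_append o_apply Un_empty_right)
qed

lemma legal_slots:
  assumes "A \<subseteq> {..<p}" shows "legal_timeline N (lift (slots A w x))"
proof -
  have "finite A" using assms finite_subset by blast
  then show ?thesis
    unfolding legal_timeline_def
    using slots_list(1)[OF assms] slots_list(2)[OF assms order.refl] slots_graph(1)[OF assms]
    by (simp add: dom_lift updates_at_lift(1))
qed

text \<open>The queried time is that of the last of the \<open>p\<close> insertions of interval
  \<open>q\<close>: it belongs to \<open>upd (2 * p * q + 2 * p - 1)\<close>, shifted by the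
  \<open>p\<close> reserved times.\<close>

lemma graph_slots:
  assumes "2 * p * Suc q \<le> x"
  shows "graph_at (lift (slots {..<p} w x)) (real (2 * p * q + 3 * p - 1)) =
    {edge (ve w j) |j. j < p} \<union> {edge (fe j) |j. j < p} \<union> {edge (re q j) |j. j < p}"
proof -
  let ?k = "2 * p * q + 2 * p"
  have d: "dom (slots {..<p} w x) \<inter> {..2 * p * q + 3 * p - 1} = {..<p} \<union> {p..<p + ?k}"
    using assms p_pos by (auto simp: slots_list(1)[OF order.refl])
  have "finite (dom (slots {..<p} w x))"
    unfolding slots_list(1)[OF order.refl] by simp
  then have "updates_at (lift (slots {..<p} w x)) {..real (2 * p * q + 3 * p - 1)} =
      map (\<lambda>j. ins (ve w j)) (sorted_list_of_set {..<p}) @ map upd [0..<?k]"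
    unfolding updates_at_lift(2)[OF \<open>finite (dom (slots {..<p} w x))\<close>] d
    using assms by (intro slots_list(2)) auto
  then have "graph_at (lift (slots {..<p} w x)) (real (2 * p * q + 3 * p - 1)) =
      (\<lambda>j. edge (ve w j)) ` {..<p} \<union> base_graph ?k"
    unfolding graph_at_def by (simp only: slots_graph(2)[OF order.refl])
  moreover have "?k - p = 2 * p * q + p" using p_pos by simp
  then have "(?k - p) div (2 * p) = q" "(?k - p) mod (2 * p) = p" using p_pos by simp_all
  then have "base_graph ?k = {edge (fe j) |j. j < p} \<union> {edge (re q j) |j. j < p}"
    unfolding base_graph_def using p_pos by auto
  ultimately show ?thesis by auto
qed

definition setup_ops :: nat where
  "setup_ops = p + 2 * p * (n * B)"

text \<open>Phase \<open>w\<close> after the setup is meant for block \<open>w mod B\<close> of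
  vector \<open>w div B\<close>; it asks about row \<open>i\<close> in interval
  \<open>i * B + w mod B\<close>.\<close>

definition op :: "nat \<Rightarrow> operation" where
  "op x = (if x < setup_ops then Create (upd x) (real (p + x)) else
     let w = (x - setup_ops) div (2 * p + n); r = (x - setup_ops) mod (2 * p + n) in
     if r < p then Create (ins (ve w r)) (real r)
     else if r < p + n then Query args (real (2 * p * ((r - p) * B + w mod B) + 3 * p - 1))
     else Cancel (real (r - p - n)))"

text \<open>Slot \<open>j\<close> is filled at position \<open>j\<close> of a phase and emptied at
  position \<open>p + n + j\<close>. During the setup truncated subtraction gives
  \<open>r = 0\<close>, so no slot is occupied.\<close>

definition state :: "nat \<Rightarrow> timeline" where
  "state x = (let r = (x - setup_ops) mod (2 * p + n) in
     lift (slots {j. j < p \<and> j < r \<and> r \<le> p + n + j} ((x - setup_ops) div (2 * p + n)) (min x setup_ops)))"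

lemma state_0: "state 0 = Map.empty"
proof -
  have "slots {} w 0 = Map.empty" for w by (auto simp: slots_def)
  then show ?thesis by (auto simp: state_def lift_def)
qed

lemma slots_empty_cong: "slots {} w x = slots {} w' x"
  by (auto simp: slots_def)

lemma op_step:
  assumes "admissible P N args"
  shows "legal_operation P N (state x) (op x) \<and> apply_operation (op x) (state x) = state (Suc x)"
proof (cases "x < setup_ops")
  case True
  then have S: "state x = lift (slots {} 0 x)" "state (Suc x) = lift (slots {} 0 (Suc x))"
    by (simp_all add: state_def)
  have "(slots {} 0 x)(p + x \<mapsto> upd x) = slots {} 0 (Suc x)"
    by (auto simp: slots_def fun_eq_iff)
  then have "(lift (slots {} 0 x))(real (p + x) \<mapsto> upd x) = lift (slots {} 0 (Suc x))"
    using lift_upd[of "slots {} 0 x" "p + x" "Some (upd x)"] by (simp only:)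
  moreover have "lift (slots {} 0 x) (real (p + x)) = None"
    by (simp add: slots_def del: of_nat_add)
  ultimately show ?thesis
    using True legal_slots[of "{}" 0 "Suc x"] by (simp add: op_def S dom_def del: of_nat_add)
next
  case False
  define u where "u = x - setup_ops"
  define M where "M = 2 * p + n"
  define w where "w = u div M"
  define r where "r = u mod M"
  have u: "u = M * w + r" by (simp add: w_def r_def)
  have M: "M > 0" using p_pos by (simp add: M_def)
  have r: "r < M" using M by (simp add: r_def)
  let ?A = "\<lambda>r. {j. j < p \<and> j < r \<and> r \<le> p + n + j}"
  have S: "state x = lift (slots (?A r) w setup_ops)"
    using False by (simp add: state_def Let_def u_def w_def r_def M_def)
  have S': "state (Suc x) = lift (slots (?A (Suc r)) w setup_ops)"
  proof (cases "Suc r = M")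
    case True
    \<comment> \<open>At the end of a phase the block index jumps to \<open>Suc w\<close>, but no
      slot is occupied, so the timeline does not show it.\<close>
    then have "Suc u = M * Suc w" by (simp add: u)
    then have "Suc u mod M = 0" by (metis mod_mult_self1_is_0)
    moreover have "?A (Suc r) = {}" using True by (auto simp: M_def)
    ultimately show ?thesis
      using False slots_empty_cong[of "Suc u div M" setup_ops w] unfolding \<open>?A (Suc r) = {}\<close>
      by (simp add: state_def Let_def Suc_diff_le u_def[symmetric] M_def[symmetric])
  next
    case False': False
    then have "Suc u div M = w" "Suc u mod M = Suc r"
      using div_mod_unique[of "Suc r" M w] r u by simp_all
    then show ?thesis
      using False by (simp add: state_def Let_def Suc_diff_le u_def[symmetric] M_def[symmetric])
  qed
  have legal: "legal_timeline N (lift (slots (?A (Suc r)) w setup_ops))"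
    by (rule legal_slots) auto
  have op: "op x = (if r < p then Create (ins (ve w r)) (real r)
     else if r < p + n then Query args (real (2 * p * ((r - p) * B + w mod B) + 3 * p - 1))
     else Cancel (real (r - p - n)))"
    using False by (simp add: op_def Let_def u_def w_def r_def M_def)
  consider "r < p" | "p \<le> r" "r < p + n" | "p + n \<le> r" by linarith
  then show ?thesis
  proof cases
    case 1
    then have "(slots (?A r) w setup_ops)(r \<mapsto> ins (ve w r)) = slots (?A (Suc r)) w setup_ops"
      by (auto simp: slots_def fun_eq_iff)
    then show ?thesis
      using 1 legal by (simp add: op S S' lift_upd dom_def) (simp add: slots_def)
  next
    case 2
    then have "?A (Suc r) = ?A r" by auto
    then show ?thesis using 2 assms by (simp add: op S S')
  next
    case 3
    define c where "c = r - p - n"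
    have *: "c < p" "r = c + p + n" using r 3 by (simp_all add: M_def c_def)
    have "(slots (?A r) w setup_ops)(c := None) = slots (?A (Suc r)) w setup_ops"
    proof
      fix y show "((slots (?A r) w setup_ops)(c := None)) y = slots (?A (Suc r)) w setup_ops y"
        using * by (auto simp: slots_def)
    qed
    then show ?thesis
      using 3 *(1) legal by (simp add: op S S' lift_upd dom_def c_def[symmetric] del: of_nat_diff)
        (simp add: slots_def *(2))
  qed
qed

lemma legal_ops:
  assumes "admissible P N args" shows "legal_operations P N Map.empty (map op [0..<L])"
  using operations_trace(1)[of L P N state op] op_step[OF assms] state_0 by simp

lemma correct_ops:
  assumes "admissible P N args" "correct_answers P N Map.empty (map op [0..<L]) outs"
    and x: "x < L" "x = setup_ops + w * (2 * p + n) + p + i" "i < n"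
  shows "answer P N ({edge (ve w j) |j. j < p} \<union> {edge (fe j) |j. j < p} \<union>
    {edge (re (i * B + w mod B) j) |j. j < p}) args (outs ! x)"
proof -
  have "correct_answer P N (state x) (op x) (outs ! x)"
    using operations_trace(2)[of L P N state op outs] op_step[OF assms(1)] state_0 assms(2) x(1) by simp
  moreover have *: "(x - setup_ops) div (2 * p + n) = w" "(x - setup_ops) mod (2 * p + n) = p + i" "\<not> x < setup_ops"
    using x p_pos by (simp_all add: add.assoc)
  moreover have "{j. j < p \<and> j < p + i \<and> p + i \<le> p + n + j} = {..<p}"
    using x by auto
  ultimately have "answer P N (graph_at (lift (slots {..<p} w setup_ops))
      (real (2 * p * (i * B + w mod B) + 3 * p - 1))) args (outs ! x)"
    using x(3) by (simp add: op_def state_def)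
  moreover have "i * B + w mod B < n * B"
  proof -
    have "i * B + w mod B < Suc i * B" using B_pos by simp
    also have "\<dots> \<le> n * B" using x(3) by (intro mult_right_mono) auto
    finally show ?thesis .
  qed
  then have "2 * p * Suc (i * B + w mod B) \<le> setup_ops"
    unfolding setup_ops_def by (intro trans_le_add2 mult_left_mono) auto
  ultimately show ?thesis by (simp only: graph_slots)
qed

end

section \<open>The reduction program\<close>

type_synonym endpoint = "nat \<times> nat \<times> nat"

text \<open>
  The edge for column \<open>j\<close> and bit \<open>\<beta>\<close> is always inserted, whatever the bit, so that the number and times of the
  operations do not depend on the input; its end vertices are linear in \<open>j\<close> and \<open>\<beta>\<close>.
\<close>

fun lin :: "endpoint \<Rightarrow> nat \<Rightarrow> bool \<Rightarrow> nat" where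
  "lin (a, b, c) j \<beta> = a * j + b + c * of_bool \<beta>"

definition ends :: "endpoint \<times> endpoint \<Rightarrow> nat \<Rightarrow> bool \<Rightarrow> nat \<times> nat" where
  "ends e j \<beta> = (lin (fst e) j \<beta>, lin (snd e) j \<beta>)"

text \<open>
  Addresses of the reduction program: 9 to 11 hold \<open>n\<close>, \<open>p\<close>, \<open>B\<close>; 14 and 15 the current column and bit;
  20 the verdict of the gadget; 22 the number of iterations; 23 and 24 hold \<open>2 * p\<close> and
  \<open>2 * p + n\<close>; 25 the queried row.
\<close>

fun load :: "nat \<Rightarrow> endpoint \<Rightarrow> com" where
  "load x (a, b, c) = Comp x Mul (Imm a) (Dir 14) ;; Comp x Add (Dir x) (Imm b) ;;
     Comp 26 Mul (Imm c) (Dir 15) ;; Comp x Add (Dir x) (Dir 26)"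

lemma wp_load:
  assumes "mem \<sigma> 14 = j" "mem \<sigma> 15 = of_bool \<beta>" "lin e j \<beta> \<le> W" "x \<notin> {14, 15, 26}"
    and "\<And>y. Q 4 (\<sigma>\<lparr>mem := (mem \<sigma>)(26 := y, x := lin e j \<beta>)\<rparr>)"
  shows "wp W (load x e) Q \<sigma>"
proof -
  obtain a b c where e: "e = (a, b, c)" by (cases e)
  have "(mem \<sigma>)(x := u, 26 := y, x := v) = (mem \<sigma>)(26 := y, x := v)" for u v y
    using assms(4) by auto
  then show ?thesis
    using assms(1-4) assms(5)[of "c * of_bool \<beta>"] by (auto simp: e eval_nat_numeral)
qed

text \<open>The exponent is a constant of the program, so the multiplications are unrolled.\<close>

primrec pow_com :: "nat \<Rightarrow> com" where
  "pow_com 0 = Comp 15 Add (Imm 1) (Imm 0)"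
| "pow_com (Suc e) = pow_com e ;; Comp 15 Mul (Dir 15) (Dir 14)"

lemma wp_pow_com:
  assumes "mem \<sigma> 14 = a" "a ^ e \<le> W" "a \<ge> 1"
  shows "wp W (pow_com e) (\<lambda>t \<sigma>'. t = Suc e \<and> \<sigma>' = \<sigma>\<lparr>mem := (mem \<sigma>)(15 := a ^ e)\<rparr>) \<sigma>"
  using assms(2)
proof (induction e)
  case (Suc e)
  have "a ^ e \<le> a ^ Suc e" using assms(3) by simp
  then have *: "wp W (pow_com e) (\<lambda>t \<sigma>'. t = Suc e \<and> \<sigma>' = \<sigma>\<lparr>mem := (mem \<sigma>)(15 := a ^ e)\<rparr>) \<sigma>"
    using Suc by (simp only: order.trans)
  show ?case
    unfolding pow_com.simps wp_Seq
    by (rule wp_mono[OF *]) (use Suc.prems assms(1) in \<open>auto simp: mult.commute\<close>)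
qed simp

text \<open>Cell 16 receives the truncated difference of \<open>n + 1\<close> and
  \<open>(x + 1) ^ e\<close>, which is nonzero iff the candidate \<open>x + 1\<close> satisfies
  \<open>(x + 1) ^ e \<le> n\<close>. By monotonicity the last accepted candidate is the integer
  root; the linear search is cheap compared with reading the matrix.\<close>

definition find_body :: "nat \<Rightarrow> com" where
  "find_body e = Comp 14 Add (Dir 12) (Imm 1) ;; pow_com e ;; Comp 16 Add (Dir 9) (Imm 1) ;;
     Comp 16 Sub (Dir 16) (Dir 15) ;; Cond (Dir 16) (Comp 10 Add (Dir 14) (Imm 0)) Skip"

text \<open>The interface between the reduction and a problem. \<open>hit\<close> reads off the
  first two output words whether some column has both bits set, and \<open>dec\<close> computes this
  into cell 20. Injectivity and disjointness range over different bits, because the columns of one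
  graph carry different bits and each bit moves its edge.\<close>

locale gadget =
  fixes P :: problem and args :: "nat list" and base row vec :: "endpoint \<times> endpoint"
    and dec :: com and hit :: "nat \<Rightarrow> nat \<Rightarrow> nat \<Rightarrow> bool"
  assumes args: "length args \<le> 2" "admissible P (8 * p + 8) args"
    and ends_vertices: "e \<in> {base, row, vec} \<Longrightarrow> j < p \<Longrightarrow> edge (ends e j \<beta>) \<subseteq> {..<8 * p + 8}"
    and ends_loopfree: "e \<in> {base, row, vec} \<Longrightarrow> fst (ends e j \<beta>) \<noteq> snd (ends e j \<beta>)"
    and ends_inj: "e \<in> {base, row, vec} \<Longrightarrow> edge (ends e j \<beta>) = edge (ends e j' \<beta>') \<Longrightarrow> j = j'"
    and ends_disjoint: "edge (ends base j \<beta>) \<noteq> edge (ends row j' \<beta>')"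
      "edge (ends base j \<beta>) \<noteq> edge (ends vec j' \<beta>')" "edge (ends row j \<beta>) \<noteq> edge (ends vec j' \<beta>')"
    and correct: "p \<ge> 1 \<Longrightarrow> answer P (8 * p + 8)
      ({edge (ends vec j (w j)) |j. j < p} \<union> {edge (ends base j False) |j. j < p} \<union>
       {edge (ends row j (m j)) |j. j < p}) args y \<Longrightarrow>
      hit p (y 0) (y 1) \<longleftrightarrow> (\<exists>j<p. m j \<and> w j)"
    and dec: "mem \<sigma> 10 = p \<Longrightarrow> mem \<sigma> 3 \<le> W \<Longrightarrow> mem \<sigma> 4 \<le> W \<Longrightarrow> 3 * W \<le> W' \<Longrightarrow> 8 * p \<le> W' \<Longrightarrow>
      \<exists>h g. (h \<noteq> 0 \<longleftrightarrow> hit p (mem \<sigma> 3) (mem \<sigma> 4)) \<and>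
        wp W' dec (\<lambda>t \<sigma>'. t \<le> 10 \<and> \<sigma>' = \<sigma>\<lparr>mem := (mem \<sigma>)(20 := h, 21 := g)\<rparr>) \<sigma>"
begin

definition send :: "com \<Rightarrow> endpoint \<times> endpoint \<Rightarrow> com" where
  "send c e = load 6 (fst e) ;; load 7 (snd e) ;; call c"

definition base_body :: "com \<Rightarrow> com" where
  "base_body c = Comp 14 Add (Dir 12) (Imm 0) ;; Comp 15 Add (Imm 0) (Imm 0) ;;
     Comp 5 Add (Imm 0) (Imm 0) ;; Comp 8 Add (Dir 12) (Dir 10) ;; send c base"

text \<open>Iteration \<open>z\<close> is decoded into interval \<open>q\<close> (cell 16), position
  (17), column (14), row and block of \<open>q\<close> (18 and 19). The matrix entry is read at an
  index increased by 1, since input cell 0 holds \<open>n\<close>. The position divided by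
  \<open>p\<close> is 0 for the inserting and 1 for the deleting half, which is the request code in
  cell 5.\<close>

definition row_body :: "com \<Rightarrow> com" where
  "row_body c = Comp 16 Div (Dir 12) (Dir 23) ;; Comp 17 Mod (Dir 12) (Dir 23) ;;
     Comp 14 Mod (Dir 17) (Dir 10) ;; Comp 18 Div (Dir 16) (Dir 11) ;; Comp 19 Mod (Dir 16) (Dir 11) ;;
     Comp 18 Mul (Dir 9) (Dir 18) ;; Comp 19 Mul (Dir 10) (Dir 19) ;; Comp 18 Add (Dir 18) (Dir 19) ;;
     Comp 18 Add (Dir 18) (Dir 14) ;; Comp 18 Add (Dir 18) (Imm 1) ;; Input 15 (Dir 18) ;;
     Comp 5 Div (Dir 17) (Dir 10) ;; Comp 8 Add (Dir 12) (Dir 23) ;; send c row"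

definition preprocess :: "nat \<Rightarrow> algorithm \<Rightarrow> com" where
  "preprocess e A = Input 9 (Imm 0) ;; Comp 10 Add (Imm 1) (Imm 0) ;; for_loop 9 (find_body e) ;;
     Comp 11 Div (Dir 9) (Dir 10) ;; Comp 11 Add (Dir 11) (Imm 1) ;; Comp 23 Mul (Imm 2) (Dir 10) ;;
     Comp 24 Add (Dir 23) (Dir 9) ;; Comp 5 Mul (Imm 8) (Dir 10) ;; Comp 5 Add (Dir 5) (Imm 8) ;;
     Comp 6 Add (Imm 0) (Imm 0) ;; Comp 7 Add (Imm 0) (Imm 0) ;; Comp 8 Add (Imm 0) (Imm 0) ;;
     call (fst A) ;; for_loop 10 (base_body (snd A)) ;;
     Comp 22 Mul (Dir 9) (Dir 11) ;; Comp 22 Mul (Dir 22) (Dir 23) ;; for_loop 22 (row_body (snd A))"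

text \<open>In the last block the index may reach \<open>n\<close> or more; the request reads as 0
  there, in agreement with \<open>vbit\<close>.\<close>

definition insert_body :: "com \<Rightarrow> com" where
  "insert_body c = Comp 14 Add (Dir 17) (Imm 0) ;; Comp 18 Mul (Dir 10) (Dir 16) ;;
     Comp 18 Add (Dir 18) (Dir 14) ;; Input 15 (Dir 18) ;; Comp 5 Add (Imm 0) (Imm 0) ;;
     Comp 8 Add (Dir 17) (Imm 0) ;; send c vec"

text \<open>The output array is cleared with each vector and 1 is written only on a hit, so the
  outputs accumulate the disjunction over the blocks.\<close>

definition query_body :: "com \<Rightarrow> com" where
  "query_body c = Comp 5 Add (Imm 3) (Imm 0) ;;
     Comp 6 Add (Imm (if length args \<ge> 1 then args ! 0 else 0)) (Imm 0) ;;
     Comp 7 Add (Imm (if length args \<ge> 2 then args ! 1 else 0)) (Imm 0) ;;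
     Comp 19 Mul (Dir 25) (Dir 11) ;; Comp 19 Add (Dir 19) (Dir 16) ;; Comp 19 Mul (Dir 23) (Dir 19) ;;
     Comp 18 Mul (Imm 3) (Dir 10) ;; Comp 19 Add (Dir 19) (Dir 18) ;; Comp 8 Sub (Dir 19) (Imm 1) ;;
     call c ;; dec ;; Cond (Dir 20) (Output (Dir 25) (Imm 1)) Skip"

definition cancel_body :: "com \<Rightarrow> com" where
  "cancel_body c = Comp 5 Add (Imm 2) (Imm 0) ;; Comp 6 Add (Imm 0) (Imm 0) ;;
     Comp 7 Add (Imm 0) (Imm 0) ;; Comp 8 Sub (Dir 25) (Dir 9) ;; call c"

text \<open>Truncated subtraction serves as comparison: cell 18 is nonzero iff the position lies
  below \<open>p\<close>, and in the other branch iff it lies below \<open>p + n\<close>.\<close>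

definition request_body :: "com \<Rightarrow> com" where
  "request_body c = Comp 16 Div (Dir 12) (Dir 24) ;; Comp 17 Mod (Dir 12) (Dir 24) ;;
     Comp 18 Sub (Dir 10) (Dir 17) ;;
     Cond (Dir 18) (insert_body c)
      (Comp 25 Sub (Dir 17) (Dir 10) ;; Comp 18 Sub (Dir 9) (Dir 25) ;;
       Cond (Dir 18) (query_body c) (cancel_body c))"

definition request_com :: "algorithm \<Rightarrow> com" where
  "request_com A = Comp 22 Mul (Dir 11) (Dir 24) ;; for_loop 22 (request_body (snd A))"

end

section \<open>The matrix as an input array\<close>

lemma length_encode_mat: "length (encode_mat n M) = n * n"
  by (simp add: encode_mat_def encode_vec_def length_concat comp_def sum_list_triv)

lemma encode_mat_nth:
  assumes "i < n" "j < n" shows "encode_mat n M ! (n * i + j) = of_bool (M i j)"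
proof -
  let ?f = "\<lambda>m. concat (map (\<lambda>i. encode_vec n (M i)) [0..<m])"
  have len: "length (?f m) = n * m" for m
    by (simp add: encode_vec_def length_concat comp_def sum_list_triv)
  have "?f m ! (n * i + j) = of_bool (M i j)" if "i < m" for m
    using that
  proof (induction m)
    case (Suc m)
    show ?case
    proof (cases "i = m")
      case True
      then show ?thesis using len[of m] assms(2) by (simp add: nth_append encode_vec_def)
    next
      case False
      then have "n * i + n \<le> n * m"
        using Suc.prems by (metis Suc_leI less_SucE mult_Suc_right mult_le_mono2 add.commute)
      then show ?thesis using False Suc len[of m] assms(2) by (simp add: nth_append)
    qed
  qed simp
  then show ?thesis using assms(1) by (simp add: encode_mat_def)
qed

lemma encode_mat_set: "set (encode_mat n M) \<subseteq> {0, 1}"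
  by (auto simp: encode_mat_def encode_vec_def)

definition matrix_input :: "nat \<Rightarrow> bmat \<Rightarrow> nat \<Rightarrow> nat" where
  "matrix_input n M i = (let x = n # encode_mat n M in if i < length x then x ! i else 0)"

text \<open>The second fact holds at every position: the last block of a row reads beyond the end of
  the row, and what it finds there must still be a bit.\<close>

lemma matrix_input:
  "matrix_input n M 0 = n"
  "matrix_input n M (Suc i) = of_bool (matrix_input n M (Suc i) \<noteq> 0)"
  "i < n \<Longrightarrow> j < n \<Longrightarrow> matrix_input n M (Suc (n * i + j)) = of_bool (M i j)"
proof -
  show "matrix_input n M 0 = n" by (simp add: matrix_input_def)
  show "matrix_input n M (Suc i) = of_bool (matrix_input n M (Suc i) \<noteq> 0)"
    using encode_mat_set[of n M] nth_mem[of i "encode_mat n M"] by (fastforce simp: matrix_input_def)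
  assume "i < n" "j < n"
  moreover from this have "n * Suc i \<le> n * n" by (intro mult_le_mono2) simp
  then have "n * i + j < n * n" using \<open>j < n\<close> by simp
  ultimately show "matrix_input n M (Suc (n * i + j)) = of_bool (M i j)"
    by (simp add: matrix_input_def length_encode_mat encode_mat_nth)
qed

section \<open>The operation sequence of one OMv instance\<close>

text \<open>\<open>W\<close> bounds the words of the data structure, \<open>W'\<close> those of the
  reduction. The bound \<open>20 * (n + 1) ^ 2\<close> dominates counters, times and input
  addresses, as each vector counts its operations from 0; \<open>n ^ d\<close> occurs in the search
  for \<open>p\<close>.\<close>

locale omv_run = gadget +
  fixes A :: algorithm and d n p B W W' :: nat and M :: bmat and V :: "nat \<Rightarrow> bvec"
  assumes n: "n \<ge> 1" and d: "d \<ge> 1" and p: "p \<ge> 1" "p ^ d \<le> n" "n < (p + 1) ^ d"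
    and B: "B = n div p + 1"
    and W: "3 * W + 32 \<le> W'" "20 * (n + 1) ^ 2 \<le> W'" "n ^ d \<le> W'" "\<forall>a\<in>set args. a \<le> W'"
begin

definition mbit :: "nat \<Rightarrow> nat \<Rightarrow> bool" where
  "mbit q j \<longleftrightarrow> matrix_input n M (Suc (n * (q div B) + p * (q mod B) + j)) \<noteq> 0"

text \<open>
  In the last block the columns from \<open>n\<close> on have meaningless matrix bits, but vector bits \<open>False\<close>.
\<close>

definition vbit :: "nat \<Rightarrow> nat \<Rightarrow> bool" where
  "vbit w j \<longleftrightarrow> p * (w mod B) + j < n \<and> V (w div B) (p * (w mod B) + j)"

sublocale schedule "8 * p + 8" p n B args "\<lambda>j. ends base j False" "\<lambda>q j. ends row j (mbit q j)"
  "\<lambda>w j. ends vec j (vbit w j)"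
proof
  show "1 \<le> B" by (simp add: B)
  show "p \<ge> 1" by (rule p)
  fix q w j j' :: nat
  show "j < p \<Longrightarrow> edge (ends base j False) \<subseteq> {..<8 * p + 8}"
    "j < p \<Longrightarrow> edge (ends row j (mbit q j)) \<subseteq> {..<8 * p + 8}"
    "j < p \<Longrightarrow> edge (ends vec j (vbit w j)) \<subseteq> {..<8 * p + 8}"
    by (rule ends_vertices; simp)+
  show "fst (ends base j False) \<noteq> snd (ends base j False)"
    "fst (ends row j (mbit q j)) \<noteq> snd (ends row j (mbit q j))"
    "fst (ends vec j (vbit w j)) \<noteq> snd (ends vec j (vbit w j))"
    by (rule ends_loopfree; simp)+
  show "edge (ends base j False) = edge (ends base j' False) \<Longrightarrow> j = j'"
    by (rule ends_inj[of base]) simp_all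
  show "edge (ends row j (mbit q j)) = edge (ends row j' (mbit q j')) \<Longrightarrow> j = j'"
    by (rule ends_inj[of row]) simp_all
  show "edge (ends vec j (vbit w j)) = edge (ends vec j' (vbit w j')) \<Longrightarrow> j = j'"
    by (rule ends_inj[of vec]) simp_all
  show "edge (ends base j False) \<noteq> edge (ends row j' (mbit q j'))"
    "edge (ends base j False) \<noteq> edge (ends vec j' (vbit w j'))"
    "edge (ends row j (mbit q j)) \<noteq> edge (ends vec j' (vbit w j'))"
    by (rule ends_disjoint)+
qed

lemma p_le_n: "p \<le> n"
proof -
  have "p \<le> p ^ d" using p(1) d by (simp add: self_le_power)
  then show ?thesis using p(2) by simp
qed

lemma blocks: "n < B * p" "p * B \<le> 2 * n" "B \<le> n + 1"
proof -
  have "n = p * (n div p) + n mod p" "n mod p < p" "B * p = p * (n div p) + p"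
    using p(1) by (simp_all add: B)
  then show "n < B * p" by linarith
  have "p * B = p * (n div p) + p" by (simp add: B)
  then show "p * B \<le> 2 * n" using p_le_n times_div_less_eq_dividend[of p n] by linarith
  show "B \<le> n + 1" by (simp add: B)
qed

text \<open>Setup, followed by \<open>B\<close> phases for each of the \<open>n\<close>
  vectors.\<close>

definition total :: nat where
  "total = setup_ops + n * (B * (2 * p + n))"

lemma W': "20 * (n * n) + 40 * n + 20 \<le> W'"
  using W(2) by (simp add: power2_eq_square algebra_simps)

lemma op_base:
  "x < p \<Longrightarrow> encode_operation (op x) =
    ([0, fst (ends base x False), snd (ends base x False)], real (p + x))"
  by (simp add: op_def setup_ops_def upd_def ins_def)

lemma op_row:
  assumes "z < n * B * (2 * p)"
  defines "q \<equiv> z div (2 * p)" and "r \<equiv> z mod (2 * p)"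
  defines "e \<equiv> ends row (r mod p) (mbit q (r mod p))"
  shows "encode_operation (op (p + z)) = ([r div p, fst e, snd e], real (2 * p + z))"
proof -
  have "r < 2 * p" using p by (simp add: r_def)
  then have "r div p = (if r < p then 0 else 1)"
    using p by (auto simp: div_nat_eqI)
  moreover have "p + z < setup_ops" using assms(1) by (simp add: setup_ops_def mult_ac)
  ultimately show ?thesis
    by (simp add: op_def upd_def Let_def ins_def del_def e_def q_def[symmetric] r_def[symmetric])
qed

lemma op_request:
  assumes "k < n" "y < B * (2 * p + n)"
  defines "b \<equiv> y div (2 * p + n)" and "r \<equiv> y mod (2 * p + n)"
  shows "op (setup_ops + k * (B * (2 * p + n)) + y) =
     (if r < p then Create (ins (ends vec r (vbit (k * B + b) r))) (real r)
      else if r < p + n then Query args (real (2 * p * ((r - p) * B + b) + 3 * p - 1))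
      else Cancel (real (r - p - n)))"
    and "b < B" "setup_ops + k * (B * (2 * p + n)) + y < total"
    and "setup_ops + k * (B * (2 * p + n)) + y = setup_ops + (k * B + b) * (2 * p + n) + r"
    and "(k * B + b) div B = k" "(k * B + b) mod B = b"
proof -
  define M' where "M' = 2 * p + n"
  have M': "M' > 0" using p by (simp add: M'_def)
  have y: "y = M' * b + r" by (simp add: b_def r_def M'_def)
  show b: "b < B" using assms(2) M' by (simp add: b_def M'_def div_less_iff_less_mult)
  then show 1: "(k * B + b) div B = k" "(k * B + b) mod B = b" by simp_all
  have eq: "k * (B * M') + y = M' * (k * B + b) + r" unfolding y by (simp add: algebra_simps)
  have "r < M'" using M' by (simp add: r_def M'_def)
  then have 2: "(k * (B * M') + y) div M' = k * B + b" "(k * (B * M') + y) mod M' = r"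
    unfolding eq by simp_all
  show "setup_ops + k * (B * (2 * p + n)) + y = setup_ops + (k * B + b) * (2 * p + n) + r"
    using eq by (simp add: M'_def mult.commute)
  show "op (setup_ops + k * (B * (2 * p + n)) + y) =
     (if r < p then Create (ins (ends vec r (vbit (k * B + b) r))) (real r)
      else if r < p + n then Query args (real (2 * p * ((r - p) * B + b) + 3 * p - 1))
      else Cancel (real (r - p - n)))"
    using 1 2 unfolding op_def M'_def by (simp add: Let_def add.assoc)
  have "k * (B * M') + y < Suc k * (B * M')" using assms(2) by (simp add: M'_def)
  also have "\<dots> \<le> n * (B * M')" using assms(1) by (intro mult_le_mono1) simp
  finally show "setup_ops + k * (B * (2 * p + n)) + y < total" by (simp add: total_def M'_def)
qed

definition regs :: "machine \<Rightarrow> bool" where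
  "regs \<sigma> \<longleftrightarrow> mem \<sigma> 9 = n \<and> mem \<sigma> 10 = p \<and> mem \<sigma> 11 = B \<and> mem \<sigma> 23 = 2 * p \<and> mem \<sigma> 24 = 2 * p + n"

end

section \<open>Simulated operations and the setup phase\<close>

text \<open>A run of the data structure on the operations for the given matrix and all vectors, cut
  into single steps. The reduction is shown to carry a copy of \<open>st x\<close> before operation
  \<open>x\<close>.\<close>

locale ds_run = omv_run +
  fixes st :: "nat \<Rightarrow> machine" and \<tau> :: "nat \<Rightarrow> nat" and T0 :: nat and outs :: "(nat \<Rightarrow> nat) list"
  assumes start: "exec W (fst A) (feed ([8 * p + 8], 0) blank) T0 (st 0)"
    and step: "x < total \<Longrightarrow>
      exec W (snd A) (feed (encode_operation (op x)) (st x)) (\<tau> x) (st (Suc x)) \<and> outs ! x = out (st (Suc x))"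
    and answers: "correct_answers P (8 * p + 8) Map.empty (map op [0..<total]) outs"
begin

lemma wp_op:
  assumes "x < total" "sim W (st x) \<sigma>" "encode_operation (op x) = (ws, real (mem \<sigma> 8))"
    and "length ws \<le> 3" "\<And>i. i < 3 \<Longrightarrow> mem \<sigma> (5 + i) = (if i < length ws then ws ! i else 0)"
    and "\<And>t' \<sigma>'. sim W (st (Suc x)) \<sigma>' \<Longrightarrow> frame \<sigma> \<sigma>' \<Longrightarrow> t' \<le> 10 * \<tau> x + 2 \<Longrightarrow>
      mem \<sigma>' 3 = (outs ! x) 0 \<Longrightarrow> mem \<sigma>' 4 = (outs ! x) 1 \<Longrightarrow>
      (outs ! x) 0 \<le> W \<Longrightarrow> (outs ! x) 1 \<le> W \<Longrightarrow> Q t' \<sigma>'"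
  shows "wp W' (call (snd A)) Q \<sigma>"
proof (rule wp_call)
  show "exec W (snd A) (feed (encode_operation (op x)) (st x)) (\<tau> x) (st (Suc x))"
    using step[OF assms(1)] ..
  show "W + 32 \<le> W'" using W(1) by simp
  fix t' \<sigma>'
  assume "sim W (st (Suc x)) \<sigma>'" "frame \<sigma> \<sigma>'" "t' \<le> 10 * \<tau> x + 2"
    "mem \<sigma>' 3 = out (st (Suc x)) 0" "mem \<sigma>' 4 = out (st (Suc x)) 1"
    "out (st (Suc x)) 0 \<le> W" "out (st (Suc x)) 1 \<le> W"
  then show "Q t' \<sigma>'" using step[OF assms(1)] by (intro assms(6)) simp_all
qed (use assms(2-5) in simp_all)

lemma wp_send:
  assumes "x < total" "sim W (st x) \<sigma>" "mem \<sigma> 14 = j" "mem \<sigma> 15 = of_bool \<beta>" "j < p"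
    and e: "e \<in> {base, row, vec}"
    and op: "encode_operation (op x) = ([mem \<sigma> 5, fst (ends e j \<beta>), snd (ends e j \<beta>)], real (mem \<sigma> 8))"
    and Q: "\<And>t' \<sigma>'. sim W (st (Suc x)) \<sigma>' \<Longrightarrow> inp \<sigma>' = inp \<sigma> \<Longrightarrow> out \<sigma>' = out \<sigma> \<Longrightarrow>
      \<forall>a. 9 \<le> a \<and> a < 26 \<longrightarrow> mem \<sigma>' a = mem \<sigma> a \<Longrightarrow> t' \<le> 10 * \<tau> x + 10 \<Longrightarrow> Q t' \<sigma>'"
  shows "wp W' (send (snd A) e) Q \<sigma>"
proof -
  have "8 * p + 8 \<le> W'" using W' p_le_n by linarith
  then have b: "lin (fst e) j \<beta> \<le> W'" "lin (snd e) j \<beta> \<le> W'"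
    using ends_vertices[OF e assms(5), of \<beta>] by (auto simp: edge_def ends_def)
  show ?thesis
    unfolding send_def wp_Seq
  proof (rule wp_load[OF assms(3,4) b(1)])
    fix y
    let ?\<sigma> = "\<sigma>\<lparr>mem := (mem \<sigma>)(26 := y, 6 := lin (fst e) j \<beta>)\<rparr>"
    show "wp W' (load 7 (snd e)) (\<lambda>t1. wp W' (call (snd A)) (\<lambda>t2. Q (4 + (t1 + t2)))) ?\<sigma>"
    proof (rule wp_load[OF _ _ b(2)])
      fix y'
      show "wp W' (call (snd A)) (\<lambda>t2. Q (4 + (4 + t2)))
        (?\<sigma>\<lparr>mem := (mem ?\<sigma>)(26 := y', 7 := lin (snd e) j \<beta>)\<rparr>)"
      proof (rule wp_op[OF assms(1)])
        show "encode_operation (op x) = ([mem \<sigma> 5, lin (fst e) j \<beta>, lin (snd e) j \<beta>],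
          real (mem (?\<sigma>\<lparr>mem := (mem ?\<sigma>)(26 := y', 7 := lin (snd e) j \<beta>)\<rparr>) 8))"
          using op by (simp add: ends_def)
      next
        fix i :: nat assume "i < 3"
        then consider "i = 0" | "i = 1" | "i = 2" by linarith
        then show "mem (?\<sigma>\<lparr>mem := (mem ?\<sigma>)(26 := y', 7 := lin (snd e) j \<beta>)\<rparr>) (5 + i) =
          (if i < length [mem \<sigma> 5, lin (fst e) j \<beta>, lin (snd e) j \<beta>]
           then [mem \<sigma> 5, lin (fst e) j \<beta>, lin (snd e) j \<beta>] ! i else 0)"
          by cases simp_all
      next
        fix t' \<sigma>'
        assume "sim W (st (Suc x)) \<sigma>'" "t' \<le> 10 * \<tau> x + 2"
          "frame (?\<sigma>\<lparr>mem := (mem ?\<sigma>)(26 := y', 7 := lin (snd e) j \<beta>)\<rparr>) \<sigma>'"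
        then show "Q (4 + (4 + t')) \<sigma>'" by (intro Q) (auto simp: frame_def)
      qed (use assms(2) in \<open>auto simp: sim_def\<close>)
    qed (use assms in auto)
  qed simp
qed

definition setup_inv :: "nat \<Rightarrow> machine \<Rightarrow> bool" where
  "setup_inv x \<sigma> \<longleftrightarrow> regs \<sigma> \<and> sim W (st x) \<sigma> \<and> inp \<sigma> = matrix_input n M"

lemma wp_base_body:
  assumes "x < p" "setup_inv x \<sigma>" "mem \<sigma> 12 = x"
  shows "wp W' (base_body (snd A)) (\<lambda>t \<sigma>'. setup_inv (Suc x) \<sigma>' \<and> mem \<sigma>' 12 = x \<and>
    mem \<sigma>' 13 = mem \<sigma> 13 \<and> t \<le> 10 * \<tau> x + 40) \<sigma>"
proof -
  have b: "p + x \<le> W'" "x \<le> W'" using W' p_le_n assms(1) by linarith+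
  have r: "mem \<sigma> 10 = p" using assms(2) by (simp add: setup_inv_def regs_def)
  have x: "x < total" using assms(1) by (simp add: total_def setup_ops_def)
  show ?thesis
    unfolding base_body_def
  proof (simp add: assms(3) r b add.commute, rule wp_send[OF x, where j = x and \<beta> = False and e = base])
  qed (use assms op_base[OF assms(1)] in \<open>auto simp: setup_inv_def regs_def sim_def add.commute\<close>)
qed

lemma wp_row_body:
  assumes "z < n * B * (2 * p)" "setup_inv (p + z) \<sigma>" "mem \<sigma> 12 = z"
  shows "wp W' (row_body (snd A)) (\<lambda>t \<sigma>'. setup_inv (p + Suc z) \<sigma>' \<and> mem \<sigma>' 12 = z \<and>
    mem \<sigma>' 13 = mem \<sigma> 13 \<and> t \<le> 10 * \<tau> (p + z) + 40) \<sigma>"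
proof -
  define q r where "q = z div (2 * p)" and "r = z mod (2 * p)"
  define j i b where "j = r mod p" and "i = q div B" and "b = q mod B"
  have B0: "B > 0" by (simp add: B)
  have j: "j < p" and rlt: "r < 2 * p" and blt: "b < B"
    using p B0 by (simp_all add: j_def r_def b_def)
  have "q < n * B" using assms(1) p by (simp add: q_def div_less_iff_less_mult)
  then have i: "i < n" using B0 by (simp add: i_def div_less_iff_less_mult)
  have "n * B * (2 * p) = n * (2 * (p * B))" by simp
  also have "\<dots> \<le> n * (2 * (2 * n))"
    using blocks(2) by (intro mult_le_mono2)
  also have "\<dots> = 4 * (n * n)" by simp
  finally have "z < 4 * (n * n)" using assms(1) by linarith
  moreover have "n * i \<le> n * n" using i by simp
  moreover have "p * b \<le> p * B" using blt by simp
  moreover have "q \<le> z" by (simp add: q_def)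
  moreover have "i \<le> q" by (simp add: i_def)
  moreover have "r div p \<le> r" by simp
  ultimately have bounds: "z + 2 * p \<le> W'" "q \<le> W'" "r \<le> W'" "j \<le> W'" "i \<le> W'" "b \<le> W'"
    "n * i \<le> W'" "p * b \<le> W'" "n * i + p * b \<le> W'" "n * i + p * b + j \<le> W'"
    "Suc (n * i + p * b + j) \<le> W'" "r div p \<le> W'" "1 \<le> W'"
    using W' p_le_n blocks j rlt blt i by linarith+
  have x: "p + z < total" using assms(1) by (simp add: total_def setup_ops_def mult_ac)
  have regs: "mem \<sigma> 9 = n" "mem \<sigma> 10 = p" "mem \<sigma> 11 = B" "mem \<sigma> 23 = 2 * p"
    using assms(2) by (simp_all add: setup_inv_def regs_def)
  note eqs = q_def[symmetric] r_def[symmetric] j_def[symmetric] i_def[symmetric] b_def[symmetric]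
  define c :: nat where "c = of_bool (mbit q j)"
  have c: "c \<le> W'" using bounds by (simp add: c_def)
  have inp: "inp \<sigma> (Suc (n * i + p * b + j)) = c"
    unfolding c_def using assms(2) matrix_input(2)[of n M] by (simp add: setup_inv_def mbit_def i_def b_def)
  show ?thesis
    unfolding row_body_def
  proof (simp add: assms(3) regs eqs bounds inp c,
      rule wp_send[OF x, where j = j and \<beta> = "mbit q j" and e = row])
  qed (use assms op_row[OF assms(1), folded q_def r_def, folded j_def] j in
      \<open>auto simp: setup_inv_def regs_def sim_def add.commute c_def\<close>)
qed

end

section \<open>Answering one vector\<close>

context ds_run
begin

definition hits :: "nat \<Rightarrow> nat \<Rightarrow> nat \<Rightarrow> bool" where
  "hits k i b \<longleftrightarrow> (\<exists>j<p. mbit (i * B + b) j \<and> vbit (k * B + b) j)"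

text \<open>The query about row \<open>i\<close> in block \<open>b\<close> is operation
  \<open>b * (2 * p + n) + p + i\<close> of the vector, so exactly the queries already answered are
  counted.\<close>

definition output_inv :: "nat \<Rightarrow> nat \<Rightarrow> (nat \<Rightarrow> nat) \<Rightarrow> bool" where
  "output_inv k y o' \<longleftrightarrow> (\<forall>i<n. o' i = of_bool (\<exists>b. b * (2 * p + n) + p + i < y \<and> hits k i b))"

lemma output_step:
  assumes "r < 2 * p + n" "y = b * (2 * p + n) + r" "output_inv k y o'"
  shows "\<not> (p \<le> r \<and> r < p + n) \<Longrightarrow> output_inv k (Suc y) o'"
    and "r = p + i \<Longrightarrow> \<not> hits k i b \<Longrightarrow> output_inv k (Suc y) o'"
    and "r = p + i \<Longrightarrow> hits k i b \<Longrightarrow> output_inv k (Suc y) (o'(i := 1))"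
proof -
  have *: "b' * (2 * p + n) + p + i < Suc y \<longleftrightarrow>
      b' * (2 * p + n) + p + i < y \<or> (b' = b \<and> p + i = r)" if "i < n" for b' i
  proof -
    have "b' = b \<and> p + i = r" if "(2 * p + n) * b' + (p + i) = (2 * p + n) * b + r"
    proof -
      have "p + i < 2 * p + n" using \<open>i < n\<close> by simp
      then show ?thesis
        using div_mod_unique[of "p + i" "2 * p + n" b'] div_mod_unique[OF assms(1), of b] that by simp
    qed
    then show ?thesis unfolding less_Suc_eq assms(2) by (auto simp: algebra_simps)
  qed
  show "\<not> (p \<le> r \<and> r < p + n) \<Longrightarrow> output_inv k (Suc y) o'"
    using assms(3) unfolding output_inv_def by (auto simp: * )
  show "r = p + i \<Longrightarrow> \<not> hits k i b \<Longrightarrow> output_inv k (Suc y) o'"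
    using assms(3) unfolding output_inv_def by (auto simp: * )
  show "r = p + i \<Longrightarrow> hits k i b \<Longrightarrow> output_inv k (Suc y) (o'(i := 1))"
    using assms(3) unfolding output_inv_def by (auto simp: * )
qed

lemma output_final:
  assumes "k < n" "i < n" "output_inv k (B * (2 * p + n)) o'"
  shows "o' i = of_bool (bool_mult n M (V k) i)"
proof -
  have *: "b * (2 * p + n) + p + i < B * (2 * p + n) \<longleftrightarrow> b < B" for b
  proof
    assume "b < B"
    then have "Suc b * (2 * p + n) \<le> B * (2 * p + n)" by (intro mult_le_mono1) simp
    then show "b * (2 * p + n) + p + i < B * (2 * p + n)" using assms(2) p by simp
  next
    assume a: "b * (2 * p + n) + p + i < B * (2 * p + n)"
    show "b < B"
    proof (rule ccontr)
      assume "\<not> b < B"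
      then have "B * (2 * p + n) \<le> b * (2 * p + n)" by (intro mult_le_mono1) simp
      then show False using a by linarith
    qed
  qed
  have hits: "hits k i b \<longleftrightarrow> (\<exists>j<p. p * b + j < n \<and> M i (p * b + j) \<and> V k (p * b + j))" if "b < B" for b
  proof -
    have D: "(m * B + b) div B = m" "(m * B + b) mod B = b" for m using that by simp_all
    have "mbit (i * B + b) j \<and> vbit (k * B + b) j \<longleftrightarrow>
        p * b + j < n \<and> M i (p * b + j) \<and> V k (p * b + j)" for j
    proof (cases "p * b + j < n")
      case True
      then show ?thesis
        using matrix_input(3)[OF assms(2) True, of M] unfolding mbit_def vbit_def D add.assoc by simp
    next
      case False
      then show ?thesis unfolding vbit_def D by simp
    qed
    then show ?thesis unfolding hits_def by blast
  qed
  have "(\<exists>b<B. hits k i b) \<longleftrightarrow> bool_mult n M (V k) i"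
  proof
    assume "bool_mult n M (V k) i"
    then obtain c where c: "c < n" "M i c" "V k c" by (auto simp: bool_mult_def)
    have "c div p < B" using c(1) blocks(1) p by (simp add: div_less_iff_less_mult)
    moreover have "c mod p < p" "p * (c div p) + c mod p = c" using p by simp_all
    ultimately show "\<exists>b<B. hits k i b" using hits c by metis
  qed (auto simp: hits bool_mult_def)
  then show ?thesis using assms(2,3) by (simp add: output_inv_def *)
qed

definition request_inv :: "nat \<Rightarrow> nat \<Rightarrow> machine \<Rightarrow> bool" where
  "request_inv k y \<sigma> \<longleftrightarrow> regs \<sigma> \<and> sim W (st (setup_ops + k * (B * (2 * p + n)) + y)) \<sigma> \<and>
     (\<forall>i. inp \<sigma> i = of_bool (i < n \<and> V k i)) \<and> output_inv k y (out \<sigma>)"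

context
  fixes k y b r x :: nat
  assumes ky: "k < n" "y < B * (2 * p + n)"
  defines "b \<equiv> y div (2 * p + n)" and "r \<equiv> y mod (2 * p + n)"
    and "x \<equiv> setup_ops + k * (B * (2 * p + n)) + y"
begin

lemma r_less: "r < 2 * p + n"
  using p by (simp add: r_def)

lemma y_eq: "y = b * (2 * p + n) + r"
  by (simp add: b_def r_def mult.commute)

lemmas op_x = op_request[OF ky, folded b_def r_def x_def]

lemma y_bounds: "b \<le> y" "y \<le> W'" "b * p \<le> 2 * n" "b < B"
proof -
  show "b < B" by (rule op_x(2))
  show "b \<le> y" by (simp add: b_def)
  have "b * p \<le> p * B" using \<open>b < B\<close> by simp
  then show "b * p \<le> 2 * n" using blocks(2) by linarith
  have "B * (2 * p + n) = 2 * (p * B) + B * n" by (simp add: algebra_simps)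
  moreover have "B * n \<le> n * n + n"
    using mult_le_mono1[OF blocks(3), of n] by simp
  ultimately show "y \<le> W'" using ky(2) W' blocks(2) by linarith
qed

lemma request_inv_x:
  "request_inv k y \<sigma> \<longleftrightarrow> regs \<sigma> \<and> sim W (st x) \<sigma> \<and>
     (\<forall>i. inp \<sigma> i = of_bool (i < n \<and> V k i)) \<and> output_inv k y (out \<sigma>)"
  "request_inv k (Suc y) \<sigma> \<longleftrightarrow> regs \<sigma> \<and> sim W (st (Suc x)) \<sigma> \<and>
     (\<forall>i. inp \<sigma> i = of_bool (i < n \<and> V k i)) \<and> output_inv k (Suc y) (out \<sigma>)"
  unfolding request_inv_def x_def add_Suc_right by (rule refl)+

lemma wp_insert_body:
  assumes "r < p" "request_inv k y \<sigma>" "mem \<sigma> 16 = b" "mem \<sigma> 17 = r"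
  shows "wp W' (insert_body (snd A)) (\<lambda>t \<sigma>'. request_inv k (Suc y) \<sigma>' \<and> mem \<sigma>' 12 = mem \<sigma> 12 \<and>
    mem \<sigma>' 13 = mem \<sigma> 13 \<and> t \<le> 10 * \<tau> x + 40) \<sigma>"
proof -
  define c :: nat where "c = of_bool (vbit (k * B + b) r)"
  have inp: "inp \<sigma> (p * b + r) = c"
    using assms(2) op_x(5,6) by (simp add: request_inv_x c_def vbit_def)
  have bounds: "r \<le> W'" "p * b \<le> W'" "p * b + r \<le> W'" "c \<le> W'"
    using y_bounds W' r_less p_le_n by (simp_all add: mult.commute c_def)
  have op: "op x = Create (ins (ends vec r (vbit (k * B + b) r))) (real r)"
    using op_x(1) assms(1) by simp
  have regs: "mem \<sigma> 10 = p" using assms(2) by (simp add: request_inv_x regs_def)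
  have "output_inv k (Suc y) (out \<sigma>)"
    using output_step(1)[OF r_less y_eq] assms(1,2) by (simp add: request_inv_x)
  then show ?thesis
    unfolding insert_body_def
  proof (simp add: assms(3,4) regs inp bounds,
      intro wp_send[OF op_x(3), where j = r and \<beta> = "vbit (k * B + b) r" and e = vec])
    show "sim W (st x) (\<sigma>\<lparr>mem := (mem \<sigma>)(14 := r, 18 := p * b + r, 15 := c, 5 := 0, 8 := r)\<rparr>)"
      using assms(2) by (simp add: request_inv_x sim_def)
  next
    fix t' \<sigma>'
    assume s: "sim W (st (Suc x)) \<sigma>'"
      "inp \<sigma>' = inp (\<sigma>\<lparr>mem := (mem \<sigma>)(14 := r, 18 := p * b + r, 15 := c, 5 := 0, 8 := r)\<rparr>)"
      "out \<sigma>' = out (\<sigma>\<lparr>mem := (mem \<sigma>)(14 := r, 18 := p * b + r, 15 := c, 5 := 0, 8 := r)\<rparr>)"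
      "\<forall>a. 9 \<le> a \<and> a < 26 \<longrightarrow> mem \<sigma>' a =
        mem (\<sigma>\<lparr>mem := (mem \<sigma>)(14 := r, 18 := p * b + r, 15 := c, 5 := 0, 8 := r)\<rparr>) a"
      "t' \<le> 10 * \<tau> x + 10" "output_inv k (Suc y) (out \<sigma>)"
    then show "request_inv k (Suc y) \<sigma>' \<and> mem \<sigma>' 12 = mem \<sigma> 12 \<and> mem \<sigma>' 13 = mem \<sigma> 13 \<and> t' \<le> 34 + 10 * \<tau> x"
      using assms(2) unfolding request_inv_x by (simp add: regs_def)
  qed (simp_all add: c_def assms op ins_def)
qed

lemma wp_cancel_body:
  assumes "p + n \<le> r" "request_inv k y \<sigma>" "mem \<sigma> 25 = r - p"
  shows "wp W' (cancel_body (snd A)) (\<lambda>t \<sigma>'. request_inv k (Suc y) \<sigma>' \<and> mem \<sigma>' 12 = mem \<sigma> 12 \<and>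
    mem \<sigma>' 13 = mem \<sigma> 13 \<and> t \<le> 10 * \<tau> x + 40) \<sigma>"
proof -
  have "r \<le> W'" using W' r_less p_le_n by linarith
  then have bounds: "r - p - n \<le> W'" by (metis diff_le_self le_trans)
  have bound2: "2 \<le> W'" using W' by linarith
  have regs: "mem \<sigma> 9 = n" using assms(2) by (simp add: request_inv_x(1) regs_def)
  have "output_inv k y (out \<sigma>)" using assms(2) by (simp add: request_inv_x(1))
  moreover have "\<not> (p \<le> r \<and> r < p + n)" using assms(1) by linarith
  ultimately have out: "output_inv k (Suc y) (out \<sigma>)"
    by (intro output_step(1)[OF r_less y_eq])
  have "\<not> r < p" "\<not> r < p + n" using assms(1) by linarith+
  then have op: "op x = Cancel (real (r - p - n))" by (simp only: op_x(1) if_False)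
  show ?thesis
    unfolding cancel_body_def
  proof (simp add: assms(3) regs bounds bound2 del: diff_diff_left,
      intro wp_op[OF op_x(3), where ws = "[2]"])
    show "encode_operation (op x) = ([2], real (mem (\<sigma>\<lparr>mem := (mem \<sigma>)(5 := 2, 6 := 0, 7 := 0,
        8 := r - p - n)\<rparr>) 8))"
      by (simp add: op)
  next
    fix i :: nat assume "i < 3"
    then consider "i = 0" | "i = 1" | "i = 2" by linarith
    then show "mem (\<sigma>\<lparr>mem := (mem \<sigma>)(5 := 2, 6 := 0, 7 := 0, 8 := r - p - n)\<rparr>) (5 + i) =
        (if i < length [2] then [2] ! i else 0)"
      by cases simp_all
  next
    show "sim W (st x) (\<sigma>\<lparr>mem := (mem \<sigma>)(5 := 2, 6 := 0, 7 := 0, 8 := r - p - n)\<rparr>)"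
      using assms(2) by (simp add: request_inv_x sim_def)
  next
    fix t' \<sigma>'
    assume "sim W (st (Suc x)) \<sigma>'" "t' \<le> 10 * \<tau> x + 2"
      "frame (\<sigma>\<lparr>mem := (mem \<sigma>)(5 := 2, 6 := 0, 7 := 0, 8 := r - p - n)\<rparr>) \<sigma>'"
    then show "request_inv k (Suc y) \<sigma>' \<and> mem \<sigma>' 12 = mem \<sigma> 12 \<and> mem \<sigma>' 13 = mem \<sigma> 13 \<and> t' \<le> 36 + 10 * \<tau> x"
      using assms(2) out unfolding request_inv_x by (simp add: regs_def frame_def)
  qed simp
qed

text \<open>Here the correctness of the data structure enters: at the queried time the graph is
  exactly the one described by the gadget.\<close>

lemma hit_iff:
  assumes "r = p + i" "i < n"
  shows "hit p ((outs ! x) 0) ((outs ! x) 1) \<longleftrightarrow> hits k i b"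
proof -
  have x': "x = setup_ops + (k * B + b) * (2 * p + n) + p + i"
    using op_x(4) unfolding assms(1) by (simp only: add.assoc)
  show ?thesis
    unfolding hits_def
    by (rule correct[OF p(1) correct_ops[OF args(2) answers op_x(3) x' assms(2), unfolded op_x(6)]])
qed

lemma wp_query_body:
  assumes "r = p + i" "i < n" "request_inv k y \<sigma>" "mem \<sigma> 16 = b" "mem \<sigma> 25 = i"
  shows "wp W' (query_body (snd A)) (\<lambda>t \<sigma>'. request_inv k (Suc y) \<sigma>' \<and> mem \<sigma>' 12 = mem \<sigma> 12 \<and>
    mem \<sigma>' 13 = mem \<sigma> 13 \<and> t \<le> 10 * \<tau> x + 40) \<sigma>"
proof -
  define a1 where "a1 = (if length args \<ge> 1 then args ! 0 else 0)"
  define a2 where "a2 = (if length args \<ge> 2 then args ! 1 else 0)"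
  define q where "q = i * B + b"
  define z where "z = 2 * p * q + 3 * p"
  have "q < Suc i * B" using op_x(2) by (simp add: q_def)
  also have "\<dots> \<le> n * B" using assms(2) by (intro mult_le_mono1) simp
  finally have q: "q < n * B" .
  then have "2 * p * q \<le> 2 * p * (n * B)" by simp
  also have "\<dots> = 2 * n * (p * B)" by simp
  also have "\<dots> \<le> 2 * n * (2 * n)" using blocks(2) by (intro mult_le_mono2)
  finally have z1: "2 * p * q \<le> 4 * (n * n)" by simp
  have "n * B \<le> n * (n + 1)" using blocks(3) by (intro mult_le_mono2)
  then have q2: "q \<le> n * n + n" using q by simp
  have "a1 \<le> W'" "a2 \<le> W'" using W(4) nth_mem[of 0 args] nth_mem[of 1 args] by (auto simp: a1_def a2_def Suc_le_eq)
  moreover have "i * B \<le> q" by (simp add: q_def)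
  ultimately have bounds: "3 \<le> W'" "a1 \<le> W'" "a2 \<le> W'" "i * B \<le> W'" "q \<le> W'" "2 * p * q \<le> W'"
    "3 * p \<le> W'" "z \<le> W'" "z - 1 \<le> W'" "8 * p \<le> W'" "3 * W \<le> W'" "1 \<le> W'"
    using z1 q2 W' W(1) p_le_n unfolding z_def by linarith+
  have regs: "mem \<sigma> 9 = n" "mem \<sigma> 10 = p" "mem \<sigma> 11 = B" "mem \<sigma> 23 = 2 * p"
    using assms(3) by (simp_all add: request_inv_x regs_def)
  have op: "op x = Query args (real (z - 1))"
    unfolding op_x(1) assms(1) z_def q_def using assms(2) by (simp del: of_nat_add of_nat_mult of_nat_diff)
  \<comment> \<open>The straight-line prefix is executed on its own, so that the call starts in one
    explicit state.\<close>
  define pre where "pre = Comp 5 Add (Imm 3) (Imm 0) ;; Comp 6 Add (Imm a1) (Imm 0) ;;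
     Comp 7 Add (Imm a2) (Imm 0) ;;
     Comp 19 Mul (Dir 25) (Dir 11) ;; Comp 19 Add (Dir 19) (Dir 16) ;; Comp 19 Mul (Dir 23) (Dir 19) ;;
     Comp 18 Mul (Imm 3) (Dir 10) ;; Comp 19 Add (Dir 19) (Dir 18) ;; Comp 8 Sub (Dir 19) (Imm 1)"
  let ?\<sigma> = "\<sigma>\<lparr>mem := (mem \<sigma>)(5 := 3, 6 := a1, 7 := a2, 19 := 2 * p * q,
      18 := 3 * p, 19 := z, 8 := z - 1)\<rparr>"
  have pre: "wp W' pre (\<lambda>t \<sigma>'. t = 9 \<and> \<sigma>' = ?\<sigma>) \<sigma>"
    unfolding pre_def
    using bounds by (simp add: assms(4,5) regs q_def[symmetric] z_def)
  let ?post = "\<lambda>t0 t \<sigma>'. request_inv k (Suc y) \<sigma>' \<and> mem \<sigma>' 12 = mem \<sigma> 12 \<and>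
    mem \<sigma>' 13 = mem \<sigma> 13 \<and> t0 + t \<le> 10 * \<tau> x + 40"
  have "wp W' (call (snd A)) (\<lambda>t1. wp W' dec (\<lambda>t2. wp W' (Cond (Dir 20) (Output (Dir 25) (Imm 1)) Skip)
      (\<lambda>t3. ?post 9 (t1 + (t2 + t3))))) ?\<sigma>"
  proof (rule wp_op[OF op_x(3), where ws = "3 # args"])
    show "encode_operation (op x) = (3 # args, real (mem ?\<sigma> 8))"
      by (simp add: op)
    show "sim W (st x) ?\<sigma>"
      using assms(3) by (simp add: request_inv_x sim_def)
    show "length (3 # args) \<le> 3" using args(1) by simp
  next
    fix i :: nat assume "i < 3"
    then consider "i = 0" | "i = 1" | "i = 2" by linarith
    then show "mem ?\<sigma> (5 + i) = (if i < length (3 # args) then (3 # args) ! i else 0)"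
      by cases (auto simp: a1_def a2_def Suc_le_eq numeral_2_eq_2)
  next
    fix t' \<sigma>'
    assume s: "sim W (st (Suc x)) \<sigma>'" "frame ?\<sigma> \<sigma>'" "t' \<le> 10 * \<tau> x + 2"
      "mem \<sigma>' 3 = (outs ! x) 0" "mem \<sigma>' 4 = (outs ! x) 1" "(outs ! x) 0 \<le> W" "(outs ! x) 1 \<le> W"
    have m10: "mem \<sigma>' 10 = p" using s(2) regs by (simp add: frame_def)
    obtain h g where h: "h \<noteq> 0 \<longleftrightarrow> hits k i b"
      and d: "wp W' dec (\<lambda>t \<sigma>''. t \<le> 10 \<and> \<sigma>'' = \<sigma>'\<lparr>mem := (mem \<sigma>')(20 := h, 21 := g)\<rparr>) \<sigma>'"
      using dec[OF m10, of W W'] s(4-7) bounds hit_iff[OF assms(1,2)] by auto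
    show "wp W' dec (\<lambda>t2. wp W' (Cond (Dir 20) (Output (Dir 25) (Imm 1)) Skip)
      (\<lambda>t3. ?post 9 (t' + (t2 + t3)))) \<sigma>'"
    proof (rule wp_mono[OF d])
      fix t2 :: nat and \<sigma>'' assume t2: "t2 \<le> 10 \<and> \<sigma>'' = \<sigma>'\<lparr>mem := (mem \<sigma>')(20 := h, 21 := g)\<rparr>"
      have out: "output_inv k y (out \<sigma>')" using assms(3) s(2) by (simp add: request_inv_x frame_def)
      have 25: "mem \<sigma>' 25 = i" using s(2) assms(5) by (simp add: frame_def)
      have sim'': "sim W (st (Suc x)) \<sigma>''"
        using s(1) t2 by (simp add: sim_def)
      show "wp W' (Cond (Dir 20) (Output (Dir 25) (Imm 1)) Skip)
        (\<lambda>t3. ?post 9 (t' + (t2 + t3))) \<sigma>''"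
      proof (cases "hits k i b")
        case True
        then have "output_inv k (Suc y) ((out \<sigma>')(i := 1))"
          using output_step(3)[OF r_less y_eq out assms(1)] by simp
        then show ?thesis
          using t2 h True s(2,3) sim'' 25 bounds(12) assms(3) unfolding request_inv_x
          by (simp add: regs_def frame_def sim_def)
      next
        case False
        then have "output_inv k (Suc y) (out \<sigma>')"
          using output_step(2)[OF r_less y_eq out assms(1)] by simp
        then show ?thesis
          using t2 h False s(2,3) sim'' assms(3) unfolding request_inv_x
          by (simp add: regs_def frame_def)
      qed
    qed
  qed
  then have "wp W' pre (\<lambda>t0. wp W' (call (snd A)) (\<lambda>t1. wp W' dec (\<lambda>t2.
      wp W' (Cond (Dir 20) (Output (Dir 25) (Imm 1)) Skip) (\<lambda>t3. ?post t0 (t1 + (t2 + t3)))))) \<sigma>"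
    by (intro wp_mono[OF pre]) auto
  then show ?thesis
    unfolding query_body_def pre_def a1_def[symmetric] a2_def[symmetric] wp_Seq
    by (simp only: add.assoc)
qed

lemma wp_request_body:
  assumes "request_inv k y \<sigma>" "mem \<sigma> 12 = y"
  shows "wp W' (request_body (snd A)) (\<lambda>t \<sigma>'. request_inv k (Suc y) \<sigma>' \<and> mem \<sigma>' 12 = y \<and>
    mem \<sigma>' 13 = mem \<sigma> 13 \<and> t \<le> 10 * \<tau> x + 50) \<sigma>"
proof -
  have regs: "mem \<sigma> 9 = n" "mem \<sigma> 10 = p" "mem \<sigma> 24 = 2 * p + n"
    using assms(1) by (simp_all add: request_inv_def regs_def)
  have bounds: "b \<le> W'" "r \<le> W'" "p - r \<le> W'" "r - p \<le> W'" "n - (r - p) \<le> W'" "n + p - r \<le> W'"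
    using y_bounds W' r_less p_le_n by linarith+
  have inv: "request_inv k y (\<sigma>\<lparr>mem := (mem \<sigma>)(16 := u, 17 := v, 18 := w)\<rparr>)"
    "request_inv k y (\<sigma>\<lparr>mem := (mem \<sigma>)(16 := u, 17 := v, 25 := u', 18 := w)\<rparr>)" for u v w u'
    using assms(1) by (auto simp: request_inv_def regs_def sim_def)
  have s: "wp W' (request_body (snd A)) Q \<sigma> \<longleftrightarrow>
    (if r < p then wp W' (insert_body (snd A)) (\<lambda>t. Q (Suc (Suc (Suc (Suc t))))) (\<sigma>\<lparr>mem := (mem \<sigma>)(16 := b, 17 := r, 18 := p - r)\<rparr>)
     else if r < p + n then wp W' (query_body (snd A)) (\<lambda>t. Q (Suc (Suc (Suc (Suc (Suc (Suc (Suc t))))))))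
        (\<sigma>\<lparr>mem := (mem \<sigma>)(16 := b, 17 := r, 25 := r - p, 18 := n - (r - p))\<rparr>)
     else wp W' (cancel_body (snd A)) (\<lambda>t. Q (Suc (Suc (Suc (Suc (Suc (Suc (Suc t))))))))
        (\<sigma>\<lparr>mem := (mem \<sigma>)(16 := b, 17 := r, 25 := r - p, 18 := n - (r - p))\<rparr>))" for Q
    unfolding request_body_def
    by (auto simp: assms(2) regs bounds b_def[symmetric] r_def[symmetric] fun_upd_twist)
  consider "r < p" | "p \<le> r" "r < p + n" | "p + n \<le> r" by linarith
  then show ?thesis
  proof cases
    case 1
    then show ?thesis
      by (subst s) (auto intro!: wp_mono[OF wp_insert_body[OF _ inv(1)]] simp: assms(2))
  next
    case 2
    then show ?thesis
      by (subst s) (auto intro!: wp_mono[OF wp_query_body[of "r - p", OF _ _ inv(2)]] simp: assms(2))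
  next
    case 3
    then show ?thesis
      by (subst s) (auto intro!: wp_mono[OF wp_cancel_body[OF _ inv(2)]] simp: assms(2))
  qed
qed

end

end

section \<open>Summing the costs of the loops\<close>

lemma sum_lessThan_add: "(\<Sum>x<a. f x) + (\<Sum>z<b. f (a + z)) = (\<Sum>x<a + b. f x)"
  for f :: "nat \<Rightarrow> nat"
  by (induction b) (simp_all add: add.assoc[symmetric])

lemma sum_lessThan_mult: "(\<Sum>k<m. \<Sum>y<b. f (k * b + y)) = (\<Sum>x<m * b. f x)"
  for f :: "nat \<Rightarrow> nat"
proof (induction m)
  case (Suc m)
  then show ?case
    using sum_lessThan_add[of f "m * b" b] by (simp add: add.commute[of b])
qed simp

context ds_run
begin

lemma wp_find:
  assumes "mem \<sigma> 9 = n" "mem \<sigma> 10 = 1" "sim W blank \<sigma>"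
  shows "wp W' (for_loop 9 (find_body d)) (\<lambda>t \<sigma>'. (mem \<sigma>' 9 = n \<and> mem \<sigma>' 10 = p \<and> sim W blank \<sigma>' \<and>
    inp \<sigma>' = inp \<sigma>) \<and> t \<le> n * (d + 13) + 3) \<sigma>"
proof -
  \<comment> \<open>After \<open>x\<close> candidates the largest accepted one is
    \<open>min x p\<close>; the maximum with 1 accounts for the initial value of cell 10.\<close>
  define I where "I x \<sigma>' \<longleftrightarrow> mem \<sigma>' 9 = n \<and> mem \<sigma>' 10 = max 1 (min x p) \<and> sim W blank \<sigma>' \<and>
    inp \<sigma>' = inp \<sigma>" for x \<sigma>'
  have "wp W' (for_loop 9 (find_body d)) (\<lambda>t \<sigma>'. I n \<sigma>' \<and> t \<le> (\<Sum>x<n. (d + 10) + 3) + 3) \<sigma>"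
  proof (rule wp_for_loop)
    show "n \<le> W'" using W' by linarith
    show "I 0 \<sigma>" using assms by (simp add: I_def)
  next
    fix x \<sigma>' u v
    assume "I x \<sigma>'"
    then show "I x (\<sigma>'\<lparr>mem := (mem \<sigma>')(12 := u, 13 := v)\<rparr>)"
      by (simp add: I_def sim_def)
  next
    fix x \<sigma>'
    assume x: "x < n" "I x \<sigma>'" "mem \<sigma>' 12 = x"
    have regs: "mem \<sigma>' 9 = n" "mem \<sigma>' 10 = max 1 (min x p)" using x(2) by (simp_all add: I_def)
    have "Suc x ^ d \<le> n ^ d" using x(1) by (intro power_mono) auto
    then have a: "Suc x ^ d \<le> W'" using W(3) by simp
    have b: "Suc n \<le> W'" "Suc x \<le> W'" using W' x(1) by linarith+
    have iff: "Suc x ^ d \<le> n \<longleftrightarrow> Suc x \<le> p"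
    proof
      assume *: "Suc x ^ d \<le> n"
      show "Suc x \<le> p"
      proof (rule ccontr)
        assume "\<not> Suc x \<le> p"
        then have "(p + 1) ^ d \<le> Suc x ^ d" by (intro power_mono) auto
        then show False using p(3) * by linarith
      qed
    next
      assume "Suc x \<le> p"
      then have "Suc x ^ d \<le> p ^ d" by (intro power_mono) auto
      then show "Suc x ^ d \<le> n" using p(2) by linarith
    qed
    let ?\<sigma> = "\<sigma>'\<lparr>mem := (mem \<sigma>')(14 := Suc x)\<rparr>"
    have P: "wp W' (pow_com d) (\<lambda>t \<sigma>''. t = Suc d \<and> \<sigma>'' = ?\<sigma>\<lparr>mem := (mem ?\<sigma>)(15 := Suc x ^ d)\<rparr>) ?\<sigma>"
      by (rule wp_pow_com) (use a in simp_all)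
    have "max 1 (min (Suc x) p) = (if Suc x \<le> p then Suc x else max 1 (min x p))"
      by (auto simp: min_def max_def)
    then have "wp W' (pow_com d) (\<lambda>t2. wp W' (Comp 16 Add (Dir 9) (Imm 1)) (\<lambda>t3. wp W'
        (Comp 16 Sub (Dir 16) (Dir 15)) (\<lambda>t4. wp W' (Cond (Dir 16) (Comp 10 Add (Dir 14) (Imm 0)) Skip)
        (\<lambda>t5 \<sigma>''. I (Suc x) \<sigma>'' \<and> mem \<sigma>'' 12 = x \<and> mem \<sigma>'' 13 = mem \<sigma>' 13 \<and>
          1 + (t2 + (t3 + (t4 + t5))) \<le> d + 10)))) ?\<sigma>"
      using x(2,3) a b iff by (intro wp_mono[OF P]) (auto simp: I_def sim_def not_less less_Suc_eq_le)
    then show "wp W' (find_body d) (\<lambda>t \<sigma>''. I (Suc x) \<sigma>'' \<and> mem \<sigma>'' 12 = x \<and>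
        mem \<sigma>'' 13 = mem \<sigma>' 13 \<and> t \<le> d + 10) \<sigma>'"
      using x(3) b unfolding find_body_def wp_Seq by simp
  qed (use assms in simp_all)
  then show ?thesis
    by (rule wp_mono) (use p_le_n p(1) in \<open>auto simp: I_def min_def max_def add.commute\<close>)
qed

lemma wp_base_loop:
  assumes "setup_inv 0 \<sigma>"
  shows "wp W' (for_loop 10 (base_body (snd A))) (\<lambda>t \<sigma>'. setup_inv p \<sigma>' \<and>
    t \<le> (\<Sum>x<p. 10 * \<tau> x + 40 + 3) + 3) \<sigma>"
proof (rule wp_for_loop[where Inv = setup_inv])
  show "mem \<sigma> 10 = p" using assms by (simp add: setup_inv_def regs_def)
  show "p \<le> W'" using W' p_le_n by linarith
  fix x s assume "x < p" "setup_inv x s" "mem s 12 = x"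
  then show "wp W' (base_body (snd A)) (\<lambda>t s'. setup_inv (Suc x) s' \<and> mem s' 12 = x \<and>
      mem s' 13 = mem s 13 \<and> t \<le> 10 * \<tau> x + 40) s"
    by (rule wp_base_body)
qed (use assms in \<open>simp_all add: setup_inv_def regs_def sim_def\<close>)

lemma wp_row_loop:
  assumes "setup_inv p \<sigma>" "mem \<sigma> 22 = n * B * (2 * p)" "n * B * (2 * p) \<le> W'"
  shows "wp W' (for_loop 22 (row_body (snd A))) (\<lambda>t \<sigma>'. setup_inv setup_ops \<sigma>' \<and>
    t \<le> (\<Sum>z<n * B * (2 * p). 10 * \<tau> (p + z) + 40 + 3) + 3) \<sigma>"
proof -
  have "wp W' (for_loop 22 (row_body (snd A))) (\<lambda>t \<sigma>'. setup_inv (p + n * B * (2 * p)) \<sigma>' \<and>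
    t \<le> (\<Sum>z<n * B * (2 * p). 10 * \<tau> (p + z) + 40 + 3) + 3) \<sigma>"
  proof (rule wp_for_loop[where Inv = "\<lambda>z. setup_inv (p + z)"])
    fix x s assume "x < n * B * (2 * p)" "setup_inv (p + x) s" "mem s 12 = x"
    then show "wp W' (row_body (snd A)) (\<lambda>t s'. setup_inv (p + Suc x) s' \<and> mem s' 12 = x \<and>
        mem s' 13 = mem s 13 \<and> t \<le> 10 * \<tau> (p + x) + 40) s"
      by (rule wp_row_body)
  qed (use assms in \<open>simp_all add: setup_inv_def regs_def sim_def\<close>)
  moreover have "p + n * B * (2 * p) = setup_ops" by (simp add: setup_ops_def mult_ac)
  ultimately show ?thesis by simp
qed

lemma wp_request_loop:
  assumes "k < n" "request_inv k 0 \<sigma>" "mem \<sigma> 22 = B * (2 * p + n)" "B * (2 * p + n) \<le> W'"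
  shows "wp W' (for_loop 22 (request_body (snd A))) (\<lambda>t \<sigma>'. request_inv k (B * (2 * p + n)) \<sigma>' \<and>
    t \<le> (\<Sum>y<B * (2 * p + n). 10 * \<tau> (setup_ops + k * (B * (2 * p + n)) + y) + 50 + 3) + 3) \<sigma>"
proof (rule wp_for_loop)
  fix y s assume "y < B * (2 * p + n)" "request_inv k y s" "mem s 12 = y"
  then show "wp W' (request_body (snd A)) (\<lambda>t s'. request_inv k (Suc y) s' \<and> mem s' 12 = y \<and>
      mem s' 13 = mem s 13 \<and> t \<le> 10 * \<tau> (setup_ops + k * (B * (2 * p + n)) + y) + 50) s"
    by (rule wp_request_body[OF assms(1)])
qed (use assms in \<open>simp_all add: request_inv_def regs_def sim_def\<close>)

lemma limits: "n * B \<le> W'" "n * B * (2 * p) \<le> W'" "B * (2 * p + n) \<le> W'" "B \<le> W'" "n \<le> W'"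
  "2 * p + n \<le> W'" "8 * p + 8 \<le> W'"
proof -
  have 1: "n * B \<le> n * n + n" using mult_le_mono2[OF blocks(3), of n] by simp
  have "n * (p * B) \<le> n * (2 * n)" by (rule mult_le_mono2[OF blocks(2)])
  moreover have "n * B * (2 * p) = 2 * (n * (p * B))" by simp
  ultimately have 2: "n * B * (2 * p) \<le> 4 * (n * n)" by linarith
  have 3: "B * (2 * p + n) = 2 * (p * B) + n * B" by (simp add: algebra_simps)
  show "n * B \<le> W'" "n * B * (2 * p) \<le> W'" "B * (2 * p + n) \<le> W'" "B \<le> W'" "n \<le> W'"
    "2 * p + n \<le> W'" "8 * p + 8 \<le> W'"
    using 1 2 3 W' blocks p_le_n by linarith+
qed

lemma wp_preprocess:
  assumes "sim W blank \<sigma>" "inp \<sigma> = matrix_input n M"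
  shows "wp W' (preprocess d A) (\<lambda>t \<sigma>'. setup_inv setup_ops \<sigma>' \<and>
    t \<le> 10 * (T0 + (\<Sum>x<setup_ops. \<tau> x)) + 43 * setup_ops + (d + 13) * n + 40) \<sigma>"
proof -
  let ?G = "\<lambda>t \<sigma>'. setup_inv setup_ops \<sigma>' \<and>
    t \<le> 10 * (T0 + (\<Sum>x<setup_ops. \<tau> x)) + 43 * setup_ops + (d + 13) * n + 40"
  \<comment> \<open>The program is cut into pieces around its calls and loops, and the pieces are
    verified from the last to the first.\<close>
  define c4 where "c4 = Comp 22 Mul (Dir 9) (Dir 11) ;; Comp 22 Mul (Dir 22) (Dir 23) ;;
    for_loop 22 (row_body (snd A))"
  define c3 where "c3 = call (fst A) ;; for_loop 10 (base_body (snd A)) ;; c4"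
  define c2 where "c2 = Comp 11 Div (Dir 9) (Dir 10) ;; Comp 11 Add (Dir 11) (Imm 1) ;;
    Comp 23 Mul (Imm 2) (Dir 10) ;;
    Comp 24 Add (Dir 23) (Dir 9) ;; Comp 5 Mul (Imm 8) (Dir 10) ;; Comp 5 Add (Dir 5) (Imm 8) ;;
    Comp 6 Add (Imm 0) (Imm 0) ;; Comp 7 Add (Imm 0) (Imm 0) ;; Comp 8 Add (Imm 0) (Imm 0) ;; c3"
  define U where "U = (\<Sum>x<p. 10 * \<tau> x + 40 + 3)"
  define U' where "U' = (\<Sum>z<n * B * (2 * p). 10 * \<tau> (p + z) + 40 + 3)"
  have U: "U + U' = 10 * (\<Sum>x<setup_ops. \<tau> x) + 43 * setup_ops"
  proof -
    have "U + U' = (\<Sum>x<p + n * B * (2 * p). 10 * \<tau> x + 40 + 3)"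
      unfolding U_def U'_def by (rule sum_lessThan_add)
    also have "p + n * B * (2 * p) = setup_ops" by (simp add: setup_ops_def mult_ac)
    finally show ?thesis by (simp add: sum.distrib sum_distrib_left)
  qed
  have C4: "wp W' c4 (\<lambda>t \<sigma>'. setup_inv setup_ops \<sigma>' \<and> t \<le> U' + 5) \<sigma>"
    if s: "setup_inv p \<sigma>" for \<sigma>
  proof -
    have regs: "mem \<sigma> 9 = n" "mem \<sigma> 11 = B" "mem \<sigma> 23 = 2 * p" using s by (simp_all add: setup_inv_def regs_def)
    let ?\<sigma> = "\<sigma>\<lparr>mem := (mem \<sigma>)(22 := n * B * (2 * p))\<rparr>"
    have "setup_inv p ?\<sigma>" using s by (simp add: setup_inv_def regs_def sim_def)
    from wp_row_loop[OF this _ limits(2)]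
    have "wp W' (for_loop 22 (row_body (snd A))) (\<lambda>t \<sigma>'. setup_inv setup_ops \<sigma>' \<and> t \<le> U' + 3) ?\<sigma>"
      by (simp add: U'_def)
    then show ?thesis
      unfolding c4_def using limits regs by (auto elim: wp_mono)
  qed
  have C3: "wp W' c3 (\<lambda>t \<sigma>'. setup_inv setup_ops \<sigma>' \<and> t \<le> 10 * T0 + U + U' + 10) \<sigma>"
    if s: "sim W blank \<sigma>" "regs \<sigma>" "inp \<sigma> = matrix_input n M" and
      r: "mem \<sigma> 5 = 8 * p + 8" "mem \<sigma> 6 = 0" "mem \<sigma> 7 = 0" "mem \<sigma> 8 = 0" for \<sigma>
    unfolding c3_def wp_Seq
  proof (rule wp_call[OF start s(1)])
    fix i :: nat assume "i < 3"
    then consider "i = 0" | "i = 1" | "i = 2" by linarith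
    then show "mem \<sigma> (5 + i) = (if i < length (fst ([8 * p + 8], 0)) then fst ([8 * p + 8], 0) ! i else 0)"
      by cases (simp_all add: r)
  next
    fix t' \<sigma>' assume t': "sim W (st 0) \<sigma>'" "frame \<sigma> \<sigma>'" "t' \<le> 10 * T0 + 2"
    have "setup_inv 0 \<sigma>'" using t' s by (simp add: setup_inv_def regs_def frame_def)
    from wp_base_loop[OF this]
    show "wp W' (for_loop 10 (base_body (snd A))) (\<lambda>t1. wp W' c4 (\<lambda>t2 \<sigma>'.
        setup_inv setup_ops \<sigma>' \<and> t' + (t1 + t2) \<le> 10 * T0 + U + U' + 10)) \<sigma>'"
    proof (rule wp_mono)
      fix t1 \<sigma>1 assume *: "setup_inv p \<sigma>1 \<and> t1 \<le> (\<Sum>x<p. 10 * \<tau> x + 40 + 3) + 3"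
      then show "wp W' c4 (\<lambda>t2 \<sigma>'.
        setup_inv setup_ops \<sigma>' \<and> t' + (t1 + t2) \<le> 10 * T0 + U + U' + 10) \<sigma>1"
        using t'(3) by (intro wp_mono[OF C4]) (auto simp: U_def)
    qed
  qed (use W(1) r in simp_all)
  have C2: "wp W' c2 (\<lambda>t \<sigma>'. setup_inv setup_ops \<sigma>' \<and> t \<le> 10 * T0 + U + U' + 19) \<sigma>"
    if s: "mem \<sigma> 9 = n" "mem \<sigma> 10 = p" "sim W blank \<sigma>" "inp \<sigma> = matrix_input n M" for \<sigma>
  proof -
    let ?\<sigma> = "\<sigma>\<lparr>mem := (mem \<sigma>)(11 := B, 23 := 2 * p, 24 := 2 * p + n, 5 := 8 * p + 8,
      6 := 0, 7 := 0, 8 := 0)\<rparr>"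
    have *: "wp W' c3 (\<lambda>t \<sigma>'. setup_inv setup_ops \<sigma>' \<and> t \<le> 10 * T0 + U + U' + 10) ?\<sigma>"
      by (rule C3) (use s in \<open>simp_all add: sim_def regs_def\<close>)
    have B': "Suc (n div p) = B" by (simp add: B)
    have "n div p \<le> W'" "2 * p \<le> W'" "8 * p \<le> W'" using limits B' by linarith+
    then show ?thesis
      unfolding c2_def using limits * s by (auto simp: B' elim: wp_mono)
  qed
  let ?\<sigma> = "\<sigma>\<lparr>mem := (mem \<sigma>)(9 := n, 10 := 1)\<rparr>"
  have "wp W' (for_loop 9 (find_body d)) (\<lambda>t1. wp W' c2 (\<lambda>t2. ?G (2 + (t1 + t2)))) ?\<sigma>"
  proof (rule wp_mono[OF wp_find])
    fix t1 \<sigma>1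
    assume *: "(mem \<sigma>1 9 = n \<and> mem \<sigma>1 10 = p \<and> sim W blank \<sigma>1 \<and> inp \<sigma>1 = inp ?\<sigma>) \<and> t1 \<le> n * (d + 13) + 3"
    then have "wp W' c2 (\<lambda>t \<sigma>'. setup_inv setup_ops \<sigma>' \<and> t \<le> 10 * T0 + U + U' + 19) \<sigma>1"
      using assms(2) by (intro C2) simp_all
    then show "wp W' c2 (\<lambda>t2. ?G (2 + (t1 + t2))) \<sigma>1"
    proof (rule wp_mono, intro conjI)
      fix t2 \<sigma>2 assume "setup_inv setup_ops \<sigma>2 \<and> t2 \<le> 10 * T0 + U + U' + 19"
      then show "2 + (t1 + t2) \<le> 10 * (T0 + (\<Sum>x<setup_ops. \<tau> x)) + 43 * setup_ops + (d + 13) * n + 40"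
        using * U by (simp add: algebra_simps)
    qed simp
  qed (use assms(1) in \<open>simp_all add: sim_def\<close>)
  moreover have "1 \<le> W'" using W' by linarith
  ultimately show ?thesis
    unfolding preprocess_def c2_def c3_def c4_def
    using assms(2) matrix_input(1)[of n M] limits(5) by simp
qed

lemma wp_request:
  assumes "k < n" "regs \<sigma>" "sim W (st (setup_ops + k * (B * (2 * p + n)))) \<sigma>"
  shows "wp W' (request_com A) (\<lambda>t \<sigma>'. (regs \<sigma>' \<and> sim W (st (setup_ops + Suc k * (B * (2 * p + n)))) \<sigma>') \<and>
    (\<forall>i<n. out \<sigma>' i = of_bool (bool_mult n M (V k) i)) \<and>
    t \<le> (\<Sum>y<B * (2 * p + n). 10 * \<tau> (setup_ops + (k * (B * (2 * p + n)) + y)) + 53) + 4)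
    (feed (encode_vec n (V k), 0) \<sigma>)"
proof -
  let ?\<sigma> = "feed (encode_vec n (V k), 0) \<sigma>"
  let ?\<sigma>' = "?\<sigma>\<lparr>mem := (mem ?\<sigma>)(22 := B * (2 * p + n))\<rparr>"
  have regs: "mem ?\<sigma> 11 = B" "mem ?\<sigma> 24 = 2 * p + n"
    using assms(2) by (simp_all add: regs_def feed_def)
  have inp: "\<forall>i. inp ?\<sigma>' i = of_bool (i < n \<and> V k i)"
    by (simp add: feed_def encode_vec_def)
  have "request_inv k 0 ?\<sigma>'"
    unfolding request_inv_def using assms inp
    by (simp add: regs_def sim_def output_inv_def) (simp add: feed_def)
  from wp_request_loop[OF assms(1) this _ limits(3)]
  have "wp W' (for_loop 22 (request_body (snd A))) (\<lambda>t \<sigma>'. request_inv k (B * (2 * p + n)) \<sigma>' \<and>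
    t \<le> (\<Sum>y<B * (2 * p + n). 10 * \<tau> (setup_ops + k * (B * (2 * p + n)) + y) + 50 + 3) + 3) ?\<sigma>'"
    by simp
  then have "wp W' (for_loop 22 (request_body (snd A))) (\<lambda>t \<sigma>'.
    (regs \<sigma>' \<and> sim W (st (setup_ops + Suc k * (B * (2 * p + n)))) \<sigma>') \<and>
    (\<forall>i<n. out \<sigma>' i = of_bool (bool_mult n M (V k) i)) \<and>
    1 + t \<le> (\<Sum>y<B * (2 * p + n). 10 * \<tau> (setup_ops + (k * (B * (2 * p + n)) + y)) + 53) + 4) ?\<sigma>'"
  proof (rule wp_mono)
    fix t \<sigma>' assume *: "request_inv k (B * (2 * p + n)) \<sigma>' \<and>
      t \<le> (\<Sum>y<B * (2 * p + n). 10 * \<tau> (setup_ops + k * (B * (2 * p + n)) + y) + 50 + 3) + 3"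
    then have "regs \<sigma>'" "sim W (st (setup_ops + k * (B * (2 * p + n)) + B * (2 * p + n))) \<sigma>'"
      "output_inv k (B * (2 * p + n)) (out \<sigma>')"
      by (simp_all only: request_inv_def)
    moreover have "setup_ops + k * (B * (2 * p + n)) + B * (2 * p + n) = setup_ops + Suc k * (B * (2 * p + n))"
      by simp
    ultimately show "(regs \<sigma>' \<and> sim W (st (setup_ops + Suc k * (B * (2 * p + n)))) \<sigma>') \<and>
      (\<forall>i<n. out \<sigma>' i = of_bool (bool_mult n M (V k) i)) \<and>
      1 + t \<le> (\<Sum>y<B * (2 * p + n). 10 * \<tau> (setup_ops + (k * (B * (2 * p + n)) + y)) + 53) + 4"
      using output_final[OF assms(1)] * by (simp only: add.assoc) simp
  qed
  then show ?thesis
    unfolding request_com_def using regs limits(3) by simp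
qed

text \<open>The factor 10 is the overhead of simulation and 53 bounds the bookkeeping per operation.
  The term linear in \<open>n\<close> pays for the search for \<open>p\<close> and for starting the
  loop of each vector.\<close>

lemma run_OMv:
  "\<exists>T1 T outs'. run W' (preprocess d A, request_com A) (n # encode_mat n M)
      (map (\<lambda>k. (encode_vec n (V k), 0)) [0..<n]) T1 T outs' \<and>
    (\<forall>k<n. \<forall>i<n. (outs' ! k) i = of_bool (bool_mult n M (V k) i)) \<and>
    T1 + T \<le> 10 * (T0 + (\<Sum>x<total. \<tau> x)) + 53 * total + (d + 17) * n + 40"
proof -
  let ?b = "\<lambda>k. (\<Sum>y<B * (2 * p + n). 10 * \<tau> (setup_ops + (k * (B * (2 * p + n)) + y)) + 53) + 4"
  let ?\<sigma> = "feed (n # encode_mat n M, 0) blank"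
  have "sim W blank ?\<sigma>" by (simp add: sim_def feed_def blank_def)
  moreover have "inp ?\<sigma> = matrix_input n M" by (simp add: feed_def matrix_input_def fun_eq_iff Let_def)
  ultimately obtain T1 \<sigma>1 where 1: "exec W' (preprocess d A) ?\<sigma> T1 \<sigma>1" "setup_inv setup_ops \<sigma>1"
    "T1 \<le> 10 * (T0 + (\<Sum>x<setup_ops. \<tau> x)) + 43 * setup_ops + (d + 13) * n + 40"
    using wp_preprocess[of ?\<sigma>] unfolding wp_def by blast
  have "\<exists>T outs'. serve W' (request_com A) \<sigma>1 (map (\<lambda>k. (encode_vec n (V k), 0)) [0..<n]) T outs' \<and>
    (\<forall>k<n. \<forall>i<n. (outs' ! k) i = of_bool (bool_mult n M (V k) i)) \<and> T \<le> (\<Sum>k<n. ?b k)"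
    by (rule serve_build[where I = "\<lambda>k \<sigma>. regs \<sigma> \<and> sim W (st (setup_ops + k * (B * (2 * p + n)))) \<sigma>"])
      (use 1(2) wp_request in \<open>simp_all add: setup_inv_def\<close>)
  then obtain T outs' where 2: "serve W' (request_com A) \<sigma>1 (map (\<lambda>k. (encode_vec n (V k), 0)) [0..<n]) T outs'"
    "\<forall>k<n. \<forall>i<n. (outs' ! k) i = of_bool (bool_mult n M (V k) i)" "T \<le> (\<Sum>k<n. ?b k)"
    by blast
  define R where "R = n * (B * (2 * p + n))"
  have "(\<Sum>k<n. ?b k) = (\<Sum>u<R. 10 * \<tau> (setup_ops + u) + 53) + 4 * n"
    unfolding R_def
    using sum_lessThan_mult[of "\<lambda>u. 10 * \<tau> (setup_ops + u) + 53" "B * (2 * p + n)" n]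
    by (simp only: sum.distrib) simp
  then have T: "T \<le> 10 * (\<Sum>u<R. \<tau> (setup_ops + u)) + 53 * R + 4 * n"
    using 2(3) by (simp add: sum.distrib sum_distrib_left)
  have "(\<Sum>x<total. \<tau> x) = (\<Sum>x<setup_ops. \<tau> x) + (\<Sum>u<R. \<tau> (setup_ops + u))"
    unfolding total_def R_def by (rule sum_lessThan_add[symmetric])
  moreover have "total = setup_ops + R" by (simp add: total_def R_def)
  ultimately have "T1 + T \<le> 10 * (T0 + (\<Sum>x<total. \<tau> x)) + 53 * total + (d + 17) * n + 40"
    using 1(3) T by (simp add: algebra_simps)
  moreover have "run W' (preprocess d A, request_com A) (n # encode_mat n M)
      (map (\<lambda>k. (encode_vec n (V k), 0)) [0..<n]) T1 T outs'"
    unfolding run_def using 1(1) 2(1) by auto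
  ultimately show ?thesis using 2(2) by blast
qed

end

section \<open>Running time\<close>

lemma exists_root:
  fixes n d :: nat
  assumes "n \<ge> 1" "d \<ge> 1"
  obtains p where "p \<ge> 1" "p ^ d \<le> n" "n < (p + 1) ^ d"
proof -
  define q where "q = (LEAST q. n < q ^ d)"
  have "n < Suc n ^ d" using assms(2) self_le_power[of "Suc n" d] by simp
  then have q: "n < q ^ d" unfolding q_def by (rule LeastI)
  have "q \<noteq> 0" using q assms(2) by (intro notI) (simp add: power_0_left)
  moreover have "q \<noteq> 1" using q assms(1) by (intro notI) simp
  ultimately obtain p where p: "q = Suc p" "p \<ge> 1" by (cases q) auto
  have "\<not> n < p ^ d" using not_less_Least[of p "\<lambda>q. n < q ^ d"] p(1) by (simp add: q_def)
  then show thesis using that[of p] p q by simp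
qed

text \<open>Constants are absorbed by powers of \<open>n + 2 \<ge> 3\<close>, so the exponent does
  not depend on \<open>n\<close> or \<open>p\<close>; \<open>s\<close> will be the sum of the query
  arguments.\<close>

lemma word_bounds:
  fixes n p c d :: nat
  assumes "n \<ge> 1" "p \<le> n"
  shows "3 * (8 * p + 8 + 2) ^ c + 32 \<le> (n + 2) ^ (4 * c + 5 + d + s)"
    and "20 * (n + 1) ^ 2 \<le> (n + 2) ^ (4 * c + 5 + d + s)"
    and "n ^ d \<le> (n + 2) ^ (4 * c + 5 + d + s)"
    and "s \<le> (n + 2) ^ (4 * c + 5 + d + s)"
proof -
  have up: "(n + 2) ^ a \<le> (n + 2) ^ (4 * c + 5 + d + s)" if "a \<le> 4 * c + 5 + d + s" for a
    using that by (intro power_increasing) auto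
  have n3: "3 ^ a \<le> (n + 2) ^ a" for a using assms(1) by (intro power_mono) auto
  have "8 * p + 10 \<le> 3 ^ 3 * (n + 2)" using assms by simp
  also have "\<dots> \<le> (n + 2) ^ 3 * (n + 2)" by (intro mult_le_mono1 n3)
  also have "\<dots> = (n + 2) ^ 4" by (simp add: eval_nat_numeral)
  finally have "(8 * p + 10) ^ c \<le> ((n + 2) ^ 4) ^ c" by (intro power_mono) auto
  then have 1: "(8 * p + 10) ^ c \<le> (n + 2) ^ (4 * c)" by (simp add: power_mult)
  have "(1::nat) \<le> (n + 2) ^ (4 * c)" by simp
  moreover have "8 * p + 8 + 2 = 8 * p + 10" by simp
  ultimately have "3 * (8 * p + 8 + 2) ^ c + 32 \<le> 35 * (n + 2) ^ (4 * c)"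
    using 1 by presburger
  also have "\<dots> \<le> 3 ^ 4 * (n + 2) ^ (4 * c)" by (intro mult_le_mono1) simp
  also have "\<dots> \<le> (n + 2) ^ 4 * (n + 2) ^ (4 * c)" by (intro mult_le_mono1 n3)
  also have "\<dots> = (n + 2) ^ (4 + 4 * c)" by (simp only: power_add)
  also have "\<dots> \<le> (n + 2) ^ (4 * c + 5 + d + s)" by (rule up) simp
  finally show "3 * (8 * p + 8 + 2) ^ c + 32 \<le> (n + 2) ^ (4 * c + 5 + d + s)" .
  have "20 * (n + 1) ^ 2 \<le> 3 ^ 3 * (n + 2) ^ 2" by (intro mult_mono power_mono) auto
  also have "\<dots> \<le> (n + 2) ^ 3 * (n + 2) ^ 2" by (intro mult_le_mono1 n3)
  also have "\<dots> = (n + 2) ^ 5" by (simp flip: power_add)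
  also have "\<dots> \<le> (n + 2) ^ (4 * c + 5 + d + s)" by (rule up) simp
  finally show "20 * (n + 1) ^ 2 \<le> (n + 2) ^ (4 * c + 5 + d + s)" .
  have "n ^ d \<le> (n + 2) ^ d" by (intro power_mono) auto
  also have "\<dots> \<le> (n + 2) ^ (4 * c + 5 + d + s)" by (rule up) simp
  finally show "n ^ d \<le> (n + 2) ^ (4 * c + 5 + d + s)" .
  have "s < 2 ^ s" by (rule less_exp)
  also have "(2::nat) ^ s \<le> (n + 2) ^ s" by (intro power_mono) auto
  also have "\<dots> \<le> (n + 2) ^ (4 * c + 5 + d + s)" by (rule up) simp
  finally show "s \<le> (n + 2) ^ (4 * c + 5 + d + s)" by simp
qed

context omv_run
begin

text \<open>The dominating part is the \<open>n * n * B\<close> queries; since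
  \<open>p * B \<le> 2 * n\<close>, these are about \<open>n ^ 3 / p\<close>.\<close>

lemma total_mult: "total * p \<le> 11 * n ^ 3"
proof -
  have "total * p = p * p + (p * B) * (4 * (n * p)) + (p * B) * (n * n)"
    by (simp add: total_def setup_ops_def algebra_simps)
  also have "\<dots> \<le> n * (n * n) + (2 * n) * (4 * (n * n)) + (2 * n) * (n * n)"
  proof (intro add_mono)
    have "p * p \<le> n * n" using p_le_n by (intro mult_mono) auto
    also have "\<dots> \<le> n * (n * n)" by simp
    finally show "p * p \<le> n * (n * n)" .
    show "(p * B) * (4 * (n * p)) \<le> (2 * n) * (4 * (n * n))"
      by (rule mult_le_mono[OF blocks(2)]) (use p_le_n in simp)
    show "(p * B) * (n * n) \<le> (2 * n) * (n * n)"
      by (rule mult_le_mono1[OF blocks(2)])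
  qed
  also have "\<dots> = 11 * n ^ 3" by (simp add: power3_eq_cube)
  finally show ?thesis .
qed

text \<open>The operations have to be polynomially many in the number of vertices:
  \<open>n < (p + 1) ^ d\<close> turns \<open>n ^ 3\<close> into exponent \<open>3 * d\<close>, and
  the remaining 2 absorbs the factor 11.\<close>

lemma total_le: "total \<le> (8 * p + 8 + 1) ^ (3 * d + 2)"
proof -
  have "total * 1 \<le> total * p" using p(1) by (intro mult_le_mono2)
  then have "total \<le> 11 * n ^ 3" using total_mult by linarith
  also have "\<dots> \<le> (8 * p + 9) ^ 2 * ((8 * p + 9) ^ d) ^ 3"
  proof (intro mult_mono power_mono)
    have "9 ^ 2 \<le> (8 * p + 9) ^ 2" by (intro power_mono) auto
    then show "11 \<le> (8 * p + 9) ^ 2" by simp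
    have "(p + 1) ^ d \<le> (8 * p + 9) ^ d" by (intro power_mono) auto
    then show "n \<le> (8 * p + 9) ^ d" using p(3) by linarith
  qed auto
  also have "\<dots> = (8 * p + 8 + 1) ^ (3 * d + 2)"
  proof -
    have "a ^ 2 * (a ^ d) ^ 3 = a ^ (3 * d + 2)" for a :: nat
      by (simp add: power2_eq_square mult_ac flip: power_mult)
    moreover have "8 * p + 8 + 1 = 8 * p + 9" by simp
    ultimately show ?thesis by (simp only:)
  qed
  finally show ?thesis .
qed

text \<open>From \<open>n \<le> (p + 1) ^ d \<le> (2 * p) ^ d\<close>, the integer root loses at
  most a factor 2; for \<open>e \<le> 1\<close> this stays a factor 2 after taking powers.\<close>

lemma p_powr:
  assumes "0 < e" "e \<le> 1"
  shows "real p powr (- e) \<le> 2 * real n powr (- (e / real d))"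
proof -
  have pn: "real p > 0" "real n > 0" "real d > 0" using p n d by auto
  have "real n \<le> real ((p + 1) ^ d)" using p(3) by (intro of_nat_mono) simp
  also have "\<dots> = (real p + 1) ^ d" by (simp add: add.commute)
  also have "\<dots> \<le> (2 * real p) ^ d" using p(1) by (intro power_mono) auto
  also have "\<dots> = (2 * real p) powr real d" using pn by (simp add: powr_realpow)
  finally have "real n powr (- (e / real d)) \<ge> ((2 * real p) powr real d) powr (- (e / real d))"
    using pn assms by (intro powr_mono2') auto
  then have "(2 * real p) powr (- e) \<le> real n powr (- (e / real d))"
    using pn by (simp add: powr_powr)
  then have "2 powr (- e) * real p powr (- e) \<le> real n powr (- (e / real d))"
    using pn by (simp add: powr_mult)
  then have "2 powr e * (2 powr (- e) * real p powr (- e)) \<le> 2 powr e * real n powr (- (e / real d))"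
    by (intro mult_left_mono) auto
  also have "2 powr e * (2 powr (- e) * real p powr (- e)) = real p powr (- e)"
    by (simp add: powr_minus)
  also have "2 powr e * real n powr (- (e / real d)) \<le> 2 powr 1 * real n powr (- (e / real d))"
    using assms by (intro mult_right_mono powr_mono) auto
  finally show ?thesis by simp
qed

lemma time_bound:
  fixes C \<epsilon> :: real and T0 T T' :: nat
  assumes \<epsilon>: "\<epsilon> > 0" and d: "d = Suc d0"
    and T0: "real T0 \<le> C * real (8 * p + 8) ^ d0"
    and T: "real T \<le> C * real total * real (8 * p + 8) powr (1 - \<epsilon>)"
    and T': "T' \<le> 10 * (T0 + T) + 53 * total + (d + 17) * n + 40"
  defines "\<delta> \<equiv> min \<epsilon> 1 / real d"
  shows "real T' \<le> (10 * 16 ^ d0 * \<bar>C\<bar> + 3520 * \<bar>C\<bar> + 1166 + real d + 57) * real n powr (3 - \<delta>)"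
proof -
  \<comment> \<open>Capping the saving at 1 keeps the exponent \<open>1 - e\<close> nonnegative, as
    needed for monotonicity in the base.\<close>
  define e where "e = min \<epsilon> 1"
  have e: "0 < e" "e \<le> 1" "e \<le> \<epsilon>" using \<epsilon> by (auto simp: e_def)
  have \<delta>: "\<delta> = e / real d" by (simp add: \<delta>_def e_def)
  have \<delta>1: "\<delta> \<le> 1" using e d by (simp add: \<delta> divide_le_eq)
  define X where "X = real n powr (3 - \<delta>)"
  have pn: "real p \<ge> 1" "real n \<ge> 1" using p n by auto
  have "real n powr 1 \<le> X" unfolding X_def using \<delta>1 pn by (intro powr_mono) auto
  then have nX: "real n \<le> X" using pn by simp
  then have X1: "1 \<le> X" using pn by linarith
  have N: "real (8 * p + 8) \<le> 16 * real p" using pn by simp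
  have "real (p ^ d0) \<le> real (p ^ d)" using p(1) d by (intro of_nat_mono power_increasing) auto
  also have "\<dots> \<le> real n" using p(2) by (intro of_nat_mono)
  finally have "real (p ^ d0) \<le> X" using nX by (rule order_trans)
  then have pd: "real p ^ d0 \<le> X" by simp
  have "real T0 \<le> \<bar>C\<bar> * real (8 * p + 8) ^ d0"
    using T0 by (rule order_trans) (intro mult_right_mono, auto)
  also have "\<dots> \<le> \<bar>C\<bar> * (16 * real p) ^ d0"
    using N by (intro mult_left_mono power_mono) auto
  also have "\<dots> = \<bar>C\<bar> * 16 ^ d0 * real p ^ d0" by (simp add: power_mult_distrib)
  also have "\<dots> \<le> \<bar>C\<bar> * 16 ^ d0 * X"
    using pd by (intro mult_left_mono) auto
  finally have 1: "real T0 \<le> \<bar>C\<bar> * 16 ^ d0 * X" .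
  have tp: "real total * real p \<le> 11 * real n ^ 3"
    using of_nat_mono[OF total_mult, where 'a = real] by simp
  \<comment> \<open>The saving per operation becomes a saving overall: the number of operations
    times \<open>p powr (1 - e)\<close> is at most \<open>11 * n ^ 3 * p powr (- e)\<close>.\<close>
  have "real n ^ 3 * real p powr (- e) \<le> real n powr 3 * (2 * real n powr (- \<delta>))"
    using p_powr[OF e(1,2)] pn by (intro mult_mono) (auto simp: \<delta> powr_numeral)
  also have "\<dots> = 2 * X" using pn by (simp add: X_def powr_diff powr_minus divide_inverse)
  finally have n3: "real n ^ 3 * real p powr (- e) \<le> 2 * X" .
  have tpe: "(real total * real p) * real p powr (- e) \<le> 22 * X"
  proof -
    have "(real total * real p) * real p powr (- e) \<le> (11 * real n ^ 3) * real p powr (- e)"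
      using tp by (intro mult_right_mono) auto
    then show ?thesis using n3 by simp
  qed
  have pe: "real p * real p powr (- e) = real p powr (1 - e)"
    using pn by (simp add: powr_diff powr_minus divide_inverse)
  \<comment> \<open>The constant overhead per operation is thus covered by the same bound as the
    operations themselves.\<close>
  have "1 \<le> real p powr (1 - e)" using pn e by (intro ge_one_powr_ge_zero) auto
  then have "real total * 1 \<le> real total * real p powr (1 - e)" by (intro mult_left_mono) auto
  also have "\<dots> \<le> 22 * X" using tpe by (simp add: pe mult.assoc)
  finally have 2: "real total \<le> 22 * X" by simp
  have "real (8 * p + 8) powr (1 - \<epsilon>) \<le> real (8 * p + 8) powr (1 - e)"
    using e by (intro powr_mono) auto
  also have "\<dots> \<le> (16 * real p) powr (1 - e)"
    using N e by (intro powr_mono2) auto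
  also have "\<dots> = 16 powr (1 - e) * real p powr (1 - e)" using pn by (simp add: powr_mult)
  also have "\<dots> \<le> 16 powr 1 * real p powr (1 - e)"
    using e by (intro mult_right_mono powr_mono) auto
  finally have Ne: "real (8 * p + 8) powr (1 - \<epsilon>) \<le> 16 * real p powr (1 - e)" by simp
  have "real T \<le> \<bar>C\<bar> * real total * real (8 * p + 8) powr (1 - \<epsilon>)"
    using T by (rule order_trans) (intro mult_right_mono, auto)
  also have "\<dots> \<le> \<bar>C\<bar> * real total * (16 * real p powr (1 - e))"
    using Ne by (intro mult_left_mono) auto
  also have "\<dots> = 16 * \<bar>C\<bar> * ((real total * real p) * real p powr (- e))"
    by (simp add: pe[symmetric])
  also have "\<dots> \<le> 16 * \<bar>C\<bar> * (22 * X)"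
    using tpe by (intro mult_left_mono) auto
  finally have 3: "real T \<le> 352 * \<bar>C\<bar> * X" by simp
  have "real T' \<le> 10 * (real T0 + real T) + 53 * real total + (real d + 17) * real n + 40"
    using of_nat_mono[OF T', where 'a = real] by simp
  also have "\<dots> \<le> 10 * (\<bar>C\<bar> * 16 ^ d0 * X + 352 * \<bar>C\<bar> * X) + 53 * (22 * X) + (real d + 17) * X + 40 * X"
    using 1 2 3 nX X1 by (intro add_mono mult_left_mono) auto
  also have "\<dots> = (10 * 16 ^ d0 * \<bar>C\<bar> + 3520 * \<bar>C\<bar> + 1166 + real d + 57) * X"
    by (simp add: algebra_simps)
  finally show ?thesis by (simp add: X_def)
qed

end

theorem (in gadget) lower_bound:
  fixes \<epsilon> :: real
  assumes "OMv_conjecture" "\<epsilon> > 0"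
  shows "\<not> fully_retroactive_within P A (\<lambda>n. real n powr (1 - \<epsilon>))"
proof
  assume "fully_retroactive_within P A (\<lambda>n. real n powr (1 - \<epsilon>))"
  then obtain d0 where "\<forall>k. \<exists>c C. \<forall>n\<ge>1. \<forall>ops.
        legal_operations P n Map.empty ops \<and> length ops \<le> (n + 1) ^ k \<longrightarrow>
        (\<exists>T0 T outs. run ((n + 2) ^ c) A [n] (map encode_operation ops) T0 T outs \<and>
           correct_answers P n Map.empty ops outs \<and>
           real T0 \<le> C * real n ^ d0 \<and>
           real T \<le> C * real (length ops) * real n powr (1 - \<epsilon>))"
    unfolding fully_retroactive_within_def by blast
  \<comment> \<open>The degree \<open>d0\<close> is obtained before the exponent \<open>k\<close>.
    So \<open>d\<close>, and with it \<open>p\<close>, is fixed first and the guarantee is then used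
    with \<open>k = 3 * d + 2\<close>; \<open>c\<close> and \<open>C\<close> may depend on that
    choice.\<close>
  moreover define d where "d = Suc d0"
  ultimately obtain c C where DS: "\<And>n ops. n \<ge> 1 \<Longrightarrow> legal_operations P n Map.empty ops \<Longrightarrow>
        length ops \<le> (n + 1) ^ (3 * d + 2) \<Longrightarrow>
        (\<exists>T0 T outs. run ((n + 2) ^ c) A [n] (map encode_operation ops) T0 T outs \<and>
           correct_answers P n Map.empty ops outs \<and>
           real T0 \<le> C * real n ^ d0 \<and>
           real T \<le> C * real (length ops) * real n powr (1 - \<epsilon>))"
    by meson
  define s where "s = sum_list args"
  define C' where "C' = 10 * 16 ^ d0 * \<bar>C\<bar> + 3520 * \<bar>C\<bar> + 1166 + real d + 57"
  define \<delta> where "\<delta> = min \<epsilon> 1 / real d"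
  have "solves_OMv_within (preprocess d A, request_com A) (\<lambda>n. C' * real n powr (3 - \<delta>))"
    unfolding solves_OMv_within_def
  proof (rule exI[of _ "4 * c + 5 + d + s"], intro allI impI)
    fix n :: nat and M :: bmat and V :: "nat \<Rightarrow> bvec"
    assume n: "1 \<le> n"
    obtain p where p: "p \<ge> 1" "p ^ d \<le> n" "n < (p + 1) ^ d"
      using exists_root[of n d] n by (auto simp: d_def)
    have "p \<le> p ^ d" using p(1) by (simp add: self_le_power d_def)
    then have pn: "p \<le> n" using p(2) by simp
    define W where "W = (8 * p + 8 + 2) ^ c"
    define W' where "W' = (n + 2) ^ (4 * c + 5 + d + s)"
    note wb = word_bounds[OF n pn, where c = c and d = d and s = s, folded W_def W'_def]
    have args_le: "\<forall>a\<in>set args. a \<le> W'"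
      using member_le_sum_list[of _ args] wb(4) by (force simp: s_def)
    interpret omv_run P args base row vec dec hit A d n p "n div p + 1" W W' M V
      by unfold_locales (use n p wb args_le in \<open>auto simp: d_def\<close>)
    let ?ops = "map op [0..<total]"
    have "legal_operations P (8 * p + 8) Map.empty ?ops" by (rule legal_ops[OF args(2)])
    moreover have "length ?ops \<le> (8 * p + 8 + 1) ^ (3 * d + 2)" using total_le by simp
    ultimately obtain T0 T outs where R: "run W A [8 * p + 8] (map encode_operation ?ops) T0 T outs"
      "correct_answers P (8 * p + 8) Map.empty ?ops outs"
      "real T0 \<le> C * real (8 * p + 8) ^ d0"
      "real T \<le> C * real total * real (8 * p + 8) powr (1 - \<epsilon>)"
      using DS[of "8 * p + 8" ?ops] unfolding W_def by auto
    from R(1) obtain s0 where s0: "exec W (fst A) (feed ([8 * p + 8], 0) blank) T0 s0"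
      "serve W (snd A) s0 (map encode_operation ?ops) T outs"
      unfolding run_def by blast
    from serve_trace[OF s0(2)] obtain st \<tau> where st: "st 0 = s0"
      "T = (\<Sum>i<total. \<tau> i)"
      "\<And>i. i < total \<Longrightarrow> exec W (snd A) (feed (encode_operation (op i)) (st i)) (\<tau> i) (st (Suc i)) \<and>
        outs ! i = out (st (Suc i))"
      by auto
    interpret ds_run P args base row vec dec hit A d n p "n div p + 1" W W' M V st \<tau> T0 outs
      by unfold_locales (use s0(1) st R(2) in auto)
    obtain T1 T2 outs' where run: "run W' (preprocess d A, request_com A) (n # encode_mat n M)
        (map (\<lambda>k. (encode_vec n (V k), 0)) [0..<n]) T1 T2 outs'"
      "\<forall>k<n. \<forall>i<n. (outs' ! k) i = of_bool (bool_mult n M (V k) i)"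
      "T1 + T2 \<le> 10 * (T0 + T) + 53 * total + (d + 17) * n + 40"
      using run_OMv[folded st(2)] by (elim exE conjE) (rule that)
    have "real (T1 + T2) \<le> C' * real n powr (3 - \<delta>)"
      using time_bound[OF assms(2) d_def R(3,4) run(3)] unfolding C'_def \<delta>_def .
    then show "\<exists>T0 T outs. run ((n + 2) ^ (4 * c + 5 + d + s)) (preprocess d A, request_com A)
        (n # encode_mat n M) (map (\<lambda>k. (encode_vec n (V k), 0)) [0..<n]) T0 T outs \<and>
        (\<forall>k<n. \<forall>i<n. (outs ! k) i = of_bool (bool_mult n M (V k) i)) \<and>
        real (T0 + T) \<le> C' * real n powr (3 - \<delta>)"
      using run(1,2) unfolding W'_def by blast
  qed
  moreover have "\<delta> > 0" using assms(2) by (simp add: \<delta>_def d_def)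
  ultimately show False using assms(1) unfolding OMv_conjecture_def by blast
qed

section \<open>Gadgets\<close>

lemmas edge_simps = edge_def ends_def doubleton_eq_iff

definition copy_dec :: com where
  "copy_dec = Comp 20 Add (Dir 3) (Imm 0) ;; Comp 21 Add (Imm 0) (Imm 0)"

definition less_dec :: "nat \<Rightarrow> com" where
  "less_dec k = Comp 20 Mul (Imm k) (Dir 10) ;; Comp 20 Sub (Dir 20) (Dir 3) ;; Comp 21 Add (Imm 0) (Imm 0)"

text \<open>Tests whether the fraction exceeds \<open>2 / 3\<close> without dividing. A zero
  denominator makes the fraction 0 in HOL and is therefore no hit.\<close>

definition ratio_dec :: com where
  "ratio_dec = Cond (Dir 4)
     (Comp 20 Mul (Imm 3) (Dir 3) ;; Comp 21 Mul (Imm 2) (Dir 4) ;; Comp 20 Sub (Dir 20) (Dir 21))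
     (Comp 20 Add (Imm 0) (Imm 0) ;; Comp 21 Add (Imm 0) (Imm 0))"

lemma copy_dec:
  assumes "mem \<sigma> 3 \<le> W" "3 * W \<le> W'"
  shows "\<exists>h g. (h \<noteq> 0 \<longleftrightarrow> mem \<sigma> 3 \<noteq> 0) \<and>
    wp W' copy_dec (\<lambda>t \<sigma>'. t \<le> 10 \<and> \<sigma>' = \<sigma>\<lparr>mem := (mem \<sigma>)(20 := h, 21 := g)\<rparr>) \<sigma>"
  by (rule exI[of _ "mem \<sigma> 3"], rule exI[of _ 0]) (use assms in \<open>simp add: copy_dec_def\<close>)

lemma less_dec:
  assumes "mem \<sigma> 10 = p" "8 * p \<le> W'" "k \<le> 8"
  shows "\<exists>h g. (h \<noteq> 0 \<longleftrightarrow> mem \<sigma> 3 < k * p) \<and>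
    wp W' (less_dec k) (\<lambda>t \<sigma>'. t \<le> 10 \<and> \<sigma>' = \<sigma>\<lparr>mem := (mem \<sigma>)(20 := h, 21 := g)\<rparr>) \<sigma>"
proof -
  have "k * p \<le> 8 * p" using assms(3) by simp
  then have "k * p \<le> W'" "k * p - mem \<sigma> 3 \<le> W'" using assms(2) by linarith+
  then have "wp W' (less_dec k) (\<lambda>t \<sigma>'. t \<le> 10 \<and>
      \<sigma>' = \<sigma>\<lparr>mem := (mem \<sigma>)(20 := k * p - mem \<sigma> 3, 21 := 0)\<rparr>) \<sigma>"
    using assms(1) by (simp add: less_dec_def)
  moreover have "k * p - mem \<sigma> 3 \<noteq> 0 \<longleftrightarrow> mem \<sigma> 3 < k * p" by auto
  ultimately show ?thesis by blast
qed

lemma ratio_dec: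
  assumes "mem \<sigma> 3 \<le> W" "mem \<sigma> 4 \<le> W" "3 * W \<le> W'"
  shows "\<exists>h g. (h \<noteq> 0 \<longleftrightarrow> mem \<sigma> 4 \<noteq> 0 \<and> 2 * mem \<sigma> 4 < 3 * mem \<sigma> 3) \<and>
    wp W' ratio_dec (\<lambda>t \<sigma>'. t \<le> 10 \<and> \<sigma>' = \<sigma>\<lparr>mem := (mem \<sigma>)(20 := h, 21 := g)\<rparr>) \<sigma>"
proof (cases "mem \<sigma> 4 = 0")
  case True
  then show ?thesis by (intro exI[of _ 0]) (simp add: ratio_dec_def)
next
  case False
  have "3 * mem \<sigma> 3 \<le> W'" "2 * mem \<sigma> 4 \<le> W'" "3 * mem \<sigma> 3 - 2 * mem \<sigma> 4 \<le> W'"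
    using assms by linarith+
  then have "wp W' ratio_dec (\<lambda>t \<sigma>'. t \<le> 10 \<and>
      \<sigma>' = \<sigma>\<lparr>mem := (mem \<sigma>)(20 := 3 * mem \<sigma> 3 - 2 * mem \<sigma> 4, 21 := 2 * mem \<sigma> 4)\<rparr>) \<sigma>"
    using False by (simp add: ratio_dec_def fun_upd_twist)
  moreover have "3 * mem \<sigma> 3 - 2 * mem \<sigma> 4 \<noteq> 0 \<longleftrightarrow> mem \<sigma> 4 \<noteq> 0 \<and> 2 * mem \<sigma> 4 < 3 * mem \<sigma> 3"
    using False by auto
  ultimately show ?thesis by blast
qed

section \<open>Connectivity\<close>

text \<open>
  Vertices \<open>0\<close> and \<open>1\<close> are linked through \<open>8 * j + 4\<close> iff both bits of column \<open>j\<close> are set.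
\<close>

lemma linked_connectivity_gadget:
  fixes m w :: "nat \<Rightarrow> bool" and p :: nat
  defines "E \<equiv> {{1, 8 * j + 3 + of_bool (w j)} |j. j < p} \<union> {{8 * j + 5, 8 * j + 6} |j. j < p} \<union>
    {{0, 8 * j + 2 + 2 * of_bool (m j)} |j. j < p}"
  shows "linked E 0 1 \<longleftrightarrow> (\<exists>j<p. m j \<and> w j)"
proof
  assume "\<exists>j<p. m j \<and> w j"
  then obtain j where j: "j < p" "m j" "w j" by blast
  have 1: "{0, 8 * j + 2 + 2 * of_bool (m j)} \<in> E" "{1, 8 * j + 3 + of_bool (w j)} \<in> E"
    unfolding E_def using j(1) by blast+
  have "(0, 8 * j + 4) \<in> {(x, y). {x, y} \<in> E}" "(8 * j + 4, 1) \<in> {(x, y). {x, y} \<in> E}"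
  proof -
    have "8 * j + 2 + 2 * of_bool (m j) = 8 * j + 4" "8 * j + 3 + of_bool (w j) = 8 * j + 4"
      using j(2,3) by simp_all
    with 1 show "(0, 8 * j + 4) \<in> {(x, y). {x, y} \<in> E}" "(8 * j + 4, 1) \<in> {(x, y). {x, y} \<in> E}"
      by (simp_all only: mem_Collect_eq case_prod_conv insert_commute[of "8 * j + 4" 1])
  qed
  then show "linked E 0 1"
    unfolding linked_def by (rule converse_rtrancl_into_rtrancl[OF _ r_into_rtrancl])
next
  assume "linked E 0 1"
  show "\<exists>j<p. m j \<and> w j"
  proof (rule ccontr)
    assume no: "\<not> (\<exists>j<p. m j \<and> w j)"
    \<comment> \<open>\<open>S\<close> contains the component of 0. It could be left towards vertex
      1 only through some \<open>8 * j + 4\<close> with both bits of column \<open>j\<close>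
      set.\<close>
    define S where "S = insert 0 ({8 * j + 2 |j. j < p} \<union> {8 * j + 4 |j. j < p \<and> m j})"
    have closed: "z \<in> S" if xz: "x \<in> S" "{x, z} \<in> E" for x z
    proof -
      consider j where "j < p" "{x, z} = {1, 8 * j + 3 + of_bool (w j)}"
        | j where "j < p" "{x, z} = {8 * j + 5, 8 * j + 6}"
        | j where "j < p" "{x, z} = {0, 8 * j + 2 + 2 * of_bool (m j)}"
        using xz(2) unfolding E_def by blast
      then show ?thesis
      proof cases
        case 1
        then have "x = 1 \<or> x = 8 * j + 3 + of_bool (w j)" by (auto simp: doubleton_eq_iff)
        then have False
        proof
          assume x: "x = 8 * j + 3 + of_bool (w j)"
          show False
          proof (cases "w j")
            case True
            then have "x = 8 * j + 4" using x by simp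
            then have "m j"
              using xz(1) unfolding S_def by (auto; presburger)
            then show False using no True 1(1) by blast
          next
            case False
            then have "x = 8 * j + 3" using x by simp
            then show False using xz(1) unfolding S_def by (auto; presburger)
          qed
        qed (use xz(1) in \<open>auto simp: S_def\<close>)
        then show ?thesis ..
      next
        case 2
        then have "x = 8 * j + 5 \<or> x = 8 * j + 6" by (auto simp: doubleton_eq_iff)
        then show ?thesis using xz(1) unfolding S_def by (auto; presburger)
      next
        case 3
        then have "z = 0 \<or> z = 8 * j + 2 + 2 * of_bool (m j)" by (auto simp: doubleton_eq_iff)
        then show ?thesis using 3(1) by (cases "m j") (auto simp: S_def)
      qed
    qed
    have "(0, 1) \<in> {(x, y). {x, y} \<in> E}\<^sup>*" using \<open>linked E 0 1\<close> by (simp add: linked_def)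
    then have "1 \<in> S"
    proof (induction rule: rtrancl_induct)
      case base
      then show ?case by (simp add: S_def)
    next
      case (step y z)
      then show ?case using closed by blast
    qed
    then show False by (auto simp: S_def)
  qed
qed

text \<open>Row edges start at vertex 0 and vector edges at vertex 1. A set bit moves the other end
  to \<open>8 * j + 4\<close>, a cleared one to the dead end \<open>8 * j + 2\<close> or
  \<open>8 * j + 3\<close>.\<close>

interpretation connectivity: gadget connectivity "[0, 1]" "((8, 5, 0), (8, 6, 0))" "((0, 0, 0), (8, 2, 2))"
  "((0, 1, 0), (8, 3, 1))" copy_dec "\<lambda>p y0 y1. y0 \<noteq> 0"
proof
  fix p :: nat
  show "length [0, 1::nat] \<le> 2" "admissible connectivity (8 * p + 8) [0, 1]"
    by (auto simp: connectivity_def)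
next
  fix p :: nat and w m y
  assume "answer connectivity (8 * p + 8)
     ({edge (ends ((0, 1, 0), (8, 3, 1)) j (w j)) |j. j < p} \<union>
      {edge (ends ((8, 5, 0), (8, 6, 0)) j False) |j. j < p} \<union>
      {edge (ends ((0, 0, 0), (8, 2, 2)) j (m j)) |j. j < p}) [0, 1] y"
  then show "y 0 \<noteq> 0 \<longleftrightarrow> (\<exists>j<p. m j \<and> w j)"
    using linked_connectivity_gadget[where w = w and p = p and m = m] by (auto simp: connectivity_def edge_def ends_def)
next
  fix \<sigma> :: machine and p W W'
  assume "mem \<sigma> 3 \<le> W" "3 * W \<le> W'"
  then show "\<exists>h g. (h \<noteq> 0 \<longleftrightarrow> mem \<sigma> 3 \<noteq> 0) \<and>
    wp W' copy_dec (\<lambda>t \<sigma>'. t \<le> 10 \<and> \<sigma>' = \<sigma>\<lparr>mem := (mem \<sigma>)(20 := h, 21 := g)\<rparr>) \<sigma>"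
    by (rule copy_dec)
\<comment> \<open>The obligations about end vertices are left to linear arithmetic: multiples of 8
  separate the columns, residues the roles within a column.\<close>
qed (auto simp: edge_simps of_bool_def split: if_splits; presburger)+

section \<open>Maximal matching\<close>

text \<open>\<open>g\<close> sends each vertex to the centre of its star. Two edges meet iff their
  centres agree, so a maximal matching has exactly one edge for each centre that occurs. Hence the
  answer is the same whichever maximal matching the data structure maintains.\<close>

lemma card_maximal_matching_stars:
  assumes centre: "\<And>e. e \<in> E \<Longrightarrow> \<exists>c\<in>e. \<forall>v\<in>e. g v = c"
    and M: "is_maximal_matching E M"
  shows "card M = card (g ` \<Union>E)"
proof -
  obtain cen where cen: "\<And>e. e \<in> E \<Longrightarrow> cen e \<in> e" "\<And>e v. e \<in> E \<Longrightarrow> v \<in> e \<Longrightarrow> g v = cen e"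
    using centre by metis
  have ME: "M \<subseteq> E" "\<And>e f. e \<in> M \<Longrightarrow> f \<in> M \<Longrightarrow> e \<noteq> f \<Longrightarrow> e \<inter> f = {}"
    and max: "\<And>M'. is_matching E M' \<Longrightarrow> M \<subseteq> M' \<Longrightarrow> M' = M"
    using M by (auto simp: is_maximal_matching_def is_matching_def)
  have "inj_on cen M"
  proof (rule inj_onI)
    fix e f assume *: "e \<in> M" "f \<in> M" "cen e = cen f"
    then have "cen e \<in> e \<inter> f" using cen(1) ME(1) by (metis IntI subsetD)
    then show "e = f" using ME(2) * by blast
  qed
  moreover have "cen ` M = cen ` E"
  proof
    show "cen ` M \<subseteq> cen ` E" using ME(1) by (rule image_mono)
    show "cen ` E \<subseteq> cen ` M"
    proof
      fix c assume "c \<in> cen ` E"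
      then obtain e where e: "e \<in> E" "c = cen e" by blast
      show "c \<in> cen ` M"
      proof (rule ccontr)
        assume c: "c \<notin> cen ` M"
        have "e \<inter> f = {}" if "f \<in> M" for f
        proof (rule ccontr)
          assume "e \<inter> f \<noteq> {}"
          then obtain v where "v \<in> e" "v \<in> f" by blast
          then have "cen f = c" using cen(2) e ME(1) that by (metis subsetD)
          then show False using c that by blast
        qed
        then have "is_matching E (insert e M)"
          using ME e(1) unfolding is_matching_def by blast
        then have "insert e M = M" using max by blast
        then show False using c e(2) by blast
      qed
    qed
  qed
  moreover have "cen ` E = g ` \<Union>E"
    using cen by (auto simp: image_iff) metis+
  ultimately show ?thesis by (metis card_image)
qed

text \<open>
  The graph consists of stars with centres \<open>8 * j\<close> and \<open>8 * j + 3\<close>, and a maximal matching has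
  exactly one edge in each nonempty star.  The star at \<open>8 * j + 3\<close> is never empty; the one at
  \<open>8 * j\<close> is empty iff both bits of column \<open>j\<close> are set.
\<close>

definition star_centre :: "nat \<Rightarrow> nat" where
  "star_centre v = (if v mod 8 \<le> 2 then 8 * (v div 8) else 8 * (v div 8) + 3)"

lemma star_centre:
  "star_centre (8 * j) = 8 * j" "star_centre (Suc (8 * j)) = 8 * j" "star_centre (Suc (Suc (8 * j))) = 8 * j"
  "star_centre (8 * j + 3) = 8 * j + 3" "star_centre (8 * j + 4) = 8 * j + 3"
  "star_centre (8 * j + 5) = 8 * j + 3" "star_centre (8 * j + 6) = 8 * j + 3"
proof -
  have "Suc (8 * j) mod 8 = 1" "Suc (8 * j) div 8 = j" "Suc (Suc (8 * j)) mod 8 = 2"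
    "Suc (Suc (8 * j)) div 8 = j" by presburger+
  then show "star_centre (8 * j) = 8 * j" "star_centre (Suc (8 * j)) = 8 * j"
    "star_centre (Suc (Suc (8 * j))) = 8 * j"
    "star_centre (8 * j + 3) = 8 * j + 3" "star_centre (8 * j + 4) = 8 * j + 3"
    "star_centre (8 * j + 5) = 8 * j + 3" "star_centre (8 * j + 6) = 8 * j + 3"
    by (simp_all add: star_centre_def)
qed

text \<open>The size is \<open>2 * p\<close> minus the number of columns with both bits set.\<close>

lemma card_matching_gadget:
  fixes m w :: "nat \<Rightarrow> bool" and p :: nat
  defines "E \<equiv> {{8 * j + 3 * of_bool (w j), 8 * j + 2 + 3 * of_bool (w j)} |j. j < p} \<union>
    {{8 * j + 3, 8 * j + 6} |j. j < p} \<union>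
    {{8 * j + 3 * of_bool (m j), Suc (8 * j + 3 * of_bool (m j))} |j. j < p}"
  assumes "is_maximal_matching E M"
  shows "card M < 2 * p \<longleftrightarrow> (\<exists>j<p. m j \<and> w j)"
proof -
  have E: "e \<in> E \<Longrightarrow> \<exists>j<p. e = {8 * j + 3, 8 * j + 6} \<or>
      w j \<and> e = {8 * j + 3, 8 * j + 5} \<or> \<not> w j \<and> e = {8 * j, 8 * j + 2} \<or>
      m j \<and> e = {8 * j + 3, 8 * j + 4} \<or> \<not> m j \<and> e = {8 * j, Suc (8 * j)}" for e
    unfolding E_def by (auto simp: eval_nat_numeral)
  have E': "{8 * j + 3, 8 * j + 6} \<in> E" "\<not> w j \<Longrightarrow> {8 * j, 8 * j + 2} \<in> E"
    "\<not> m j \<Longrightarrow> {8 * j, Suc (8 * j)} \<in> E" if "j < p" for j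
    unfolding E_def using that by force+
  have "card M = card (star_centre ` \<Union>E)"
  proof (rule card_maximal_matching_stars[OF _ assms(2)])
    fix e assume "e \<in> E"
    then show "\<exists>c\<in>e. \<forall>v\<in>e. star_centre v = c"
      using E[of e] by (auto simp: star_centre)
  qed
  also have "star_centre ` \<Union>E = (\<lambda>j. 8 * j + 3) ` {..<p} \<union> (\<lambda>j. 8 * j) ` {j. j < p \<and> \<not> (m j \<and> w j)}"
    (is "?l = ?r")
  proof
    show "?l \<subseteq> ?r"
    proof
      fix c assume "c \<in> ?l"
      then obtain e v where "e \<in> E" "v \<in> e" "c = star_centre v" by blast
      then show "c \<in> ?r" using E[of e] by (auto simp: star_centre)
    qed
    have "8 * j + 3 \<in> ?l" if "j < p" for j
      using E'(1)[OF that] star_centre(4)[of j] by (metis UnionI image_eqI insertI1)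
    moreover have "8 * j \<in> ?l" if "j < p" "\<not> (m j \<and> w j)" for j
      using E'(2,3)[OF that(1)] that(2) star_centre(1)[of j] by (metis UnionI image_eqI insertI1)
    ultimately show "?r \<subseteq> ?l" by auto
  qed
  also have "card \<dots> = p + card {j. j < p \<and> \<not> (m j \<and> w j)}"
  proof (subst card_Un_disjoint)
    show "(\<lambda>j. 8 * j + 3) ` {..<p} \<inter> (\<lambda>j. 8 * j) ` {j. j < p \<and> \<not> (m j \<and> w j)} = {}"
      by (auto; presburger)
  qed (auto simp: card_image inj_on_def)
  finally have "card M = p + card {j. j < p \<and> \<not> (m j \<and> w j)}" .
  moreover have "card {j. j < p \<and> \<not> (m j \<and> w j)} < p \<longleftrightarrow> (\<exists>j<p. m j \<and> w j)"
  proof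
    assume *: "card {j. j < p \<and> \<not> (m j \<and> w j)} < p"
    show "\<exists>j<p. m j \<and> w j"
    proof (rule ccontr)
      assume "\<not> (\<exists>j<p. m j \<and> w j)"
      then have "{j. j < p \<and> \<not> (m j \<and> w j)} = {..<p}" by auto
      then show False using * by simp
    qed
  next
    assume "\<exists>j<p. m j \<and> w j"
    then have "{j. j < p \<and> \<not> (m j \<and> w j)} \<subset> {..<p}" by auto
    then have "card {j. j < p \<and> \<not> (m j \<and> w j)} < card {..<p}" by (intro psubset_card_mono) auto
    then show "card {j. j < p \<and> \<not> (m j \<and> w j)} < p" by simp
  qed
  ultimately show ?thesis by auto
qed

text \<open>A set bit moves its edge from the star at \<open>8 * j\<close> to the star at
  \<open>8 * j + 3\<close>, which the permanent edge keeps nonempty.\<close>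

interpretation matching: gadget maximal_matching_size "[]" "((8, 3, 0), (8, 6, 0))" "((8, 0, 3), (8, 1, 3))"
  "((8, 0, 3), (8, 2, 3))" "less_dec 2" "\<lambda>p y0 y1. y0 < 2 * p"
proof
  fix p :: nat
  show "length ([] :: nat list) \<le> 2" "admissible maximal_matching_size (8 * p + 8) []"
    by (auto simp: maximal_matching_size_def)
next
  fix p :: nat and w m y
  assume "answer maximal_matching_size (8 * p + 8)
     ({edge (ends ((8, 0, 3), (8, 2, 3)) j (w j)) |j. j < p} \<union>
      {edge (ends ((8, 3, 0), (8, 6, 0)) j False) |j. j < p} \<union>
      {edge (ends ((8, 0, 3), (8, 1, 3)) j (m j)) |j. j < p}) [] y"
  then show "y 0 < 2 * p \<longleftrightarrow> (\<exists>j<p. m j \<and> w j)"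
    using card_matching_gadget[where w = w and p = p and m = m] by (auto simp: maximal_matching_size_def edge_def ends_def)
next
  fix \<sigma> :: machine and p W W'
  assume "mem \<sigma> 10 = p" "8 * p \<le> W'"
  then show "\<exists>h g. (h \<noteq> 0 \<longleftrightarrow> mem \<sigma> 3 < 2 * p) \<and>
    wp W' (less_dec 2) (\<lambda>t \<sigma>'. t \<le> 10 \<and> \<sigma>' = \<sigma>\<lparr>mem := (mem \<sigma>)(20 := h, 21 := g)\<rparr>) \<sigma>"
    by (rule less_dec) simp
qed (auto simp: edge_simps of_bool_def split: if_splits; presburger)+


section \<open>Cycles and spanning forests\<close>

lemma path_of_rtrancl:
  assumes "(u, v) \<in> R\<^sup>*"
  shows "\<exists>xs. xs \<noteq> [] \<and> distinct xs \<and> hd xs = u \<and> last xs = v \<and> successively (\<lambda>x y. (x, y) \<in> R) xs"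
  using assms
proof (induction rule: rtrancl_induct)
  case base
  show ?case by (rule exI[of _ "[u]"]) simp
next
  case (step y z)
  then obtain xs where xs: "xs \<noteq> []" "distinct xs" "hd xs = u" "last xs = y"
    "successively (\<lambda>x y. (x, y) \<in> R) xs"
    by blast
  show ?case
  proof (cases "z \<in> set xs")
    case True
    \<comment> \<open>A step back to a visited vertex cuts the path off there.\<close>
    then obtain ys zs where "xs = ys @ z # zs" by (auto simp: in_set_conv_decomp)
    then show ?thesis
      using xs by (intro exI[of _ "ys @ [z]"]) (auto simp: successively_append_iff hd_append split: if_splits)
  next
    case False
    then show ?thesis
      using xs step.hyps(2) by (intro exI[of _ "xs @ [z]"]) (auto simp: successively_append_iff)
  qed
qed

text \<open>An edge missing from \<open>F\<close> would close a cycle in \<open>E\<close> together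
  with a path of \<open>F\<close> between its ends.\<close>

lemma spanning_forest_of_forest:
  assumes E: "\<And>e. e \<in> E \<Longrightarrow> \<exists>u v. e = {u, v} \<and> u \<noteq> v" and acyclic: "\<nexists>xs. is_cycle E xs"
    and F: "is_spanning_forest E F"
  shows "F = E"
proof (rule ccontr)
  have FE: "F \<subseteq> E" and linked: "\<And>u v. linked E u v \<Longrightarrow> linked F u v"
    using F by (auto simp: is_spanning_forest_def)
  assume "F \<noteq> E"
  then obtain e where e: "e \<in> E" "e \<notin> F" using FE by blast
  then obtain u v where uv: "e = {u, v}" "u \<noteq> v" using E by blast
  have "linked E u v" using e(1) uv(1) by (auto simp: linked_def)
  then have "(u, v) \<in> {(x, y). {x, y} \<in> F}\<^sup>*" using linked by (simp add: linked_def)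
  from path_of_rtrancl[OF this] obtain xs where xs: "xs \<noteq> []" "distinct xs" "hd xs = u" "last xs = v"
    "successively (\<lambda>x y. {x, y} \<in> F) xs"
    by auto
  have nth: "xs ! 0 = u" "xs ! (length xs - 1) = v"
    using xs by (simp_all add: hd_conv_nth last_conv_nth)
  have step: "{xs ! i, xs ! Suc i} \<in> F" if "Suc i < length xs" for i
    using xs(5) that by (simp add: successively_conv_nth)
  \<comment> \<open>A cycle needs three vertices: the ends of \<open>e\<close> differ, and a path of
    two vertices would be the missing edge \<open>e\<close> itself.\<close>
  have "length xs \<noteq> 1" using nth uv(2) by auto
  moreover have "length xs \<noteq> 2"
  proof
    assume "length xs = 2"
    then show False using step[of 0] nth e(2) uv(1) by simp
  qed
  moreover have "length xs \<noteq> 0" using xs(1) by simp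
  ultimately have len: "length xs \<ge> 3" by linarith
  have "{xs ! i, xs ! (Suc i mod length xs)} \<in> E" if "i < length xs" for i
  proof (cases "Suc i < length xs")
    case True
    then show ?thesis using step FE by auto
  next
    case False
    then have "i = length xs - 1" "Suc i = length xs" using that by auto
    then show ?thesis using nth e(1) uv(1) by (simp add: insert_commute)
  qed
  then have "is_cycle E xs" using len xs(2) by (simp add: is_cycle_def)
  then show False using acyclic by blast
qed

text \<open>Predecessor and successor of a vertex are distinct because a cycle has at least three
  vertices.\<close>

lemma cycle_neighbours:
  assumes "is_cycle E xs" "v \<in> set xs"
  shows "\<exists>a\<in>set xs. \<exists>b\<in>set xs. a \<noteq> b \<and> {v, a} \<in> E \<and> {v, b} \<in> E"
proof -
  let ?n = "length xs"
  have n: "?n \<ge> 3" and dist: "distinct xs"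
    and E: "\<And>i. i < ?n \<Longrightarrow> {xs ! i, xs ! (Suc i mod ?n)} \<in> E"
    using assms(1) by (auto simp: is_cycle_def)
  obtain i where i: "i < ?n" "v = xs ! i" using assms(2) by (auto simp: in_set_conv_nth)
  define k where "k = (if i = 0 then ?n - 1 else i - 1)"
  have k: "k < ?n" "Suc k mod ?n = i" using i n by (auto simp: k_def)
  have "Suc i mod ?n \<noteq> k"
    using i n by (cases "Suc i = ?n") (auto simp: k_def split: if_splits)
  moreover have "Suc i mod ?n < ?n" using n by (intro mod_less_divisor) linarith
  ultimately have "xs ! (Suc i mod ?n) \<noteq> xs ! k"
    using k(1) dist by (simp add: nth_eq_iff_index_eq)
  moreover have "{v, xs ! k} \<in> E" using E[OF k(1)] k(2) i(2) by (simp add: insert_commute)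
  ultimately show ?thesis
    using E[OF i(1)] i(2) k(1) \<open>Suc i mod ?n < ?n\<close> by (meson nth_mem)
qed

lemma is_cycle_triangle:
  assumes "distinct [a, b, c]" "{a, b} \<in> E" "{b, c} \<in> E" "{a, c} \<in> E"
  shows "is_cycle E [a, b, c]"
proof -
  have "{[a, b, c] ! i, [a, b, c] ! (Suc i mod 3)} \<in> E" if i: "i < 3" for i
  proof -
    consider "i = 0" | "i = 1" | "i = 2" using i by linarith
    then show ?thesis
    proof cases
      case 1
      then show ?thesis using assms(2) by simp
    next
      case 2
      then have "[a, b, c] ! i = b" "[a, b, c] ! (Suc i mod 3) = c" by simp_all
      then show ?thesis using assms(3) by simp
    next
      case 3
      then have "[a, b, c] ! i = c" "[a, b, c] ! (Suc i mod 3) = a" by simp_all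
      then show ?thesis using assms(4) by (simp add: insert_commute)
    qed
  qed
  then show ?thesis using assms(1) unfolding is_cycle_def by simp
qed

text \<open>
  On the vertices \<open>8 * j + 4\<close>, \<open>8 * j + 5\<close>, \<open>8 * j + 6\<close> there is a triangle if both bits of column \<open>j\<close> are
  set, and a path with at most two edges otherwise; all other edges are isolated.
\<close>

definition triangles :: "nat \<Rightarrow> (nat \<Rightarrow> bool) \<Rightarrow> (nat \<Rightarrow> bool) \<Rightarrow> graph" where
  "triangles p m w = {{8 * j + 2 + 2 * of_bool (w j), 8 * j + 3 + 3 * of_bool (w j)} |j. j < p} \<union>
    {{8 * j + 5, 8 * j + 6} |j. j < p} \<union>
    {{8 * j + 4 * of_bool (m j), Suc (8 * j + 4 * of_bool (m j))} |j. j < p}"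

lemma triangles_cases:
  assumes "e \<in> triangles p m w"
  obtains j where "j < p" "e = {8 * j + 5, 8 * j + 6}"
  | j where "j < p" "w j" "e = {8 * j + 4, 8 * j + 6}"
  | j where "j < p" "\<not> w j" "e = {8 * j + 2, 8 * j + 3}"
  | j where "j < p" "m j" "e = {8 * j + 4, 8 * j + 5}"
  | j where "j < p" "\<not> m j" "e = {8 * j, 8 * j + 1}"
proof -
  consider j where "j < p" "e = {8 * j + 2 + 2 * of_bool (w j), 8 * j + 3 + 3 * of_bool (w j)}"
    | j where "j < p" "e = {8 * j + 5, 8 * j + 6}"
    | j where "j < p" "e = {8 * j + 4 * of_bool (m j), Suc (8 * j + 4 * of_bool (m j))}"
    using assms unfolding triangles_def by blast
  then show thesis
  proof cases
    case 1
    show thesis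
    proof (cases "w j")
      case True
      then have "8 * j + 2 + 2 * of_bool (w j) = 8 * j + 4" "8 * j + 3 + 3 * of_bool (w j) = 8 * j + 6"
        by simp_all
      with 1 that(2)[OF 1(1) True] show thesis by (simp only:)
    next
      case False
      then have "8 * j + 2 + 2 * of_bool (w j) = 8 * j + 2" "8 * j + 3 + 3 * of_bool (w j) = 8 * j + 3"
        by simp_all
      with 1 that(3)[OF 1(1) False] show thesis by (simp only:)
    qed
  next
    case 2
    then show thesis using that(1) by blast
  next
    case 3
    show thesis
    proof (cases "m j")
      case True
      then have "8 * j + 4 * of_bool (m j) = 8 * j + 4" "Suc (8 * j + 4) = 8 * j + 5"
        by simp_all
      with 3 that(4)[OF 3(1) True] show thesis by (simp only:)
    next
      case False
      then have "8 * j + 4 * of_bool (m j) = 8 * j" "Suc (8 * j) = 8 * j + 1"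
        by simp_all
      with 3 that(5)[OF 3(1) False] show thesis by (simp only:)
    qed
  qed
qed

lemma triangles_hit:
  assumes "j < p" "m j" "w j"
  shows "{8 * j + 4, 8 * j + 5} \<in> triangles p m w" "{8 * j + 5, 8 * j + 6} \<in> triangles p m w"
    "{8 * j + 4, 8 * j + 6} \<in> triangles p m w"
proof -
  have "{8 * j + 2 + 2 * of_bool (w j), 8 * j + 3 + 3 * of_bool (w j)} \<in> triangles p m w"
    "{8 * j + 5, 8 * j + 6} \<in> triangles p m w"
    "{8 * j + 4 * of_bool (m j), Suc (8 * j + 4 * of_bool (m j))} \<in> triangles p m w"
    unfolding triangles_def using assms(1) by blast+
  moreover have "8 * j + 2 + 2 * of_bool (w j) = 8 * j + 4" "8 * j + 3 + 3 * of_bool (w j) = 8 * j + 6"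
    "8 * j + 4 * of_bool (m j) = 8 * j + 4" "Suc (8 * j + 4) = 8 * j + 5"
    using assms by simp_all
  ultimately show "{8 * j + 4, 8 * j + 5} \<in> triangles p m w" "{8 * j + 5, 8 * j + 6} \<in> triangles p m w"
    "{8 * j + 4, 8 * j + 6} \<in> triangles p m w"
    by (simp_all only:)
qed

text \<open>Every vertex on a cycle has two neighbours on it. Only \<open>8 * j + 5\<close> and
  \<open>8 * j + 6\<close> can have two neighbours, and then one of these is
  \<open>8 * j + 4\<close>, so the cycle would pass through \<open>8 * j + 4\<close>; this vertex
  has two neighbours only if both bits are set.\<close>

lemma triangles_acyclic:
  assumes no: "\<not> (\<exists>j<p. m j \<and> w j)"
  shows "\<not> is_cycle (triangles p m w) xs"
proof
  let ?E = "triangles p m w"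
  assume cyc: "is_cycle ?E xs"
  \<comment> \<open>The only possible neighbour of a vertex outside the would-be triangles.\<close>
  define other where "other v = (let q = v div 8 in if v mod 8 = 2 then 8 * q + 3
    else if v mod 8 = 3 then 8 * q + 2 else if v mod 8 = 0 then 8 * q + 1 else 8 * q)" for v :: nat
  have neighbour: "v div 8 < p" "v mod 8 = 5 \<Longrightarrow> a = 8 * (v div 8) + 6 \<or> a = 8 * (v div 8) + 4"
      "v mod 8 = 6 \<Longrightarrow> a = 8 * (v div 8) + 5 \<or> a = 8 * (v div 8) + 4"
      "v mod 8 = 4 \<Longrightarrow> w (v div 8) \<and> a = 8 * (v div 8) + 6 \<or> m (v div 8) \<and> a = 8 * (v div 8) + 5"
      "v mod 8 \<notin> {4, 5, 6} \<Longrightarrow> a = other v"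
    if "{v, a} \<in> ?E" for v a
  proof -
    have mods: "(8 * j + i) div 8 = j" "(8 * j + i) mod 8 = i" if "i < 8" for i j :: nat
      using that by simp_all
    have *: "\<exists>j i i'. j < p \<and> v = 8 * j + i \<and> a = 8 * j + i' \<and>
       ((i, i') \<in> {(5, 6), (6, 5), (6, 4), (5, 4), (2, 3), (3, 2), (0, 1), (1, 0)} \<or>
        (i, i') = (4, 6) \<and> w j \<or> (i, i') = (4, 5) \<and> m j)"
      using that
    proof (rule triangles_cases)
      fix j assume j: "j < p" "{v, a} = {8 * j + 5, 8 * j + 6}"
      then have "v = 8 * j + 5 \<and> a = 8 * j + 6 \<or> v = 8 * j + 6 \<and> a = 8 * j + 5"
        by (simp only: doubleton_eq_iff)
      with j(1) show ?thesis by blast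
    next
      fix j assume j: "j < p" "w j" "{v, a} = {8 * j + 4, 8 * j + 6}"
      then have "v = 8 * j + 4 \<and> a = 8 * j + 6 \<or> v = 8 * j + 6 \<and> a = 8 * j + 4"
        by (simp only: doubleton_eq_iff)
      with j(1,2) show ?thesis by blast
    next
      fix j assume j: "j < p" "{v, a} = {8 * j + 2, 8 * j + 3}"
      then have "v = 8 * j + 2 \<and> a = 8 * j + 3 \<or> v = 8 * j + 3 \<and> a = 8 * j + 2"
        by (simp only: doubleton_eq_iff)
      with j(1) show ?thesis by blast
    next
      fix j assume j: "j < p" "m j" "{v, a} = {8 * j + 4, 8 * j + 5}"
      then have "v = 8 * j + 4 \<and> a = 8 * j + 5 \<or> v = 8 * j + 5 \<and> a = 8 * j + 4"
        by (simp only: doubleton_eq_iff)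
      with j(1,2) show ?thesis by blast
    next
      fix j assume j: "j < p" "{v, a} = {8 * j, 8 * j + 1}"
      then have "v = 8 * j + 0 \<and> a = 8 * j + 1 \<or> v = 8 * j + 1 \<and> a = 8 * j + 0"
        by (simp only: doubleton_eq_iff add_0_right)
      with j(1) show ?thesis by blast
    qed
    then obtain j i i' where j: "j < p" "v = 8 * j + i" "a = 8 * j + i'"
      "(i, i') \<in> {(5, 6), (6, 5), (6, 4), (5, 4), (2, 3), (3, 2), (0, 1), (1, 0)} \<or>
        (i, i') = (4, 6) \<and> w j \<or> (i, i') = (4, 5) \<and> m j"
      by blast
    then have "i < 8" by auto
    then have v: "v div 8 = j" "v mod 8 = i" unfolding j(2) by (rule mods)+
    show "v div 8 < p" "v mod 8 = 5 \<Longrightarrow> a = 8 * (v div 8) + 6 \<or> a = 8 * (v div 8) + 4"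
      "v mod 8 = 6 \<Longrightarrow> a = 8 * (v div 8) + 5 \<or> a = 8 * (v div 8) + 4"
      "v mod 8 = 4 \<Longrightarrow> w (v div 8) \<and> a = 8 * (v div 8) + 6 \<or> m (v div 8) \<and> a = 8 * (v div 8) + 5"
      "v mod 8 \<notin> {4, 5, 6} \<Longrightarrow> a = other v"
      unfolding other_def v Let_def j(3) using j(1,4) by auto
  qed
  have apex: "v mod 8 \<in> {5, 6} \<and> (a = 8 * (v div 8) + 4 \<or> b = 8 * (v div 8) + 4)"
    if ab: "{v, a} \<in> ?E" "{v, b} \<in> ?E" "a \<noteq> b" for v a b
  proof -
    note A = neighbour[OF ab(1)] and B = neighbour[OF ab(2)]
    consider "v mod 8 = 5" | "v mod 8 = 6" | "v mod 8 = 4" | "v mod 8 \<notin> {4, 5, 6}" by blast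
    then show ?thesis
    proof cases
      case 1
      then show ?thesis using A(2) B(2) ab(3) by blast
    next
      case 2
      then show ?thesis using A(3) B(3) ab(3) by blast
    next
      case 3
      then show ?thesis using A(1,4) B(4) ab(3) no by blast
    next
      case 4
      then show ?thesis using A(5) B(5) ab(3) by blast
    qed
  qed
  have "xs \<noteq> []" using cyc by (auto simp: is_cycle_def)
  then have "hd xs \<in> set xs" by simp
  from cycle_neighbours[OF cyc this] obtain a b where
    "a \<in> set xs" "b \<in> set xs" "a \<noteq> b" "{hd xs, a} \<in> ?E" "{hd xs, b} \<in> ?E"
    by blast
  then obtain j where "8 * j + 4 \<in> set xs" using apex[of "hd xs" a b] by auto
  from cycle_neighbours[OF cyc this] obtain a b where
    "a \<noteq> b" "{8 * j + 4, a} \<in> ?E" "{8 * j + 4, b} \<in> ?E"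
    by blast
  then have "(8 * j + 4) mod 8 \<in> {5, 6}" using apex by blast
  then show False by simp
qed

text \<open>Bits move edges but never merge them, so the number of edges is always the same.\<close>

lemma triangles_card: "finite (triangles p m w)" "card (triangles p m w) = 3 * p"
proof -
  let ?v = "\<lambda>j. {8 * j + 2 + 2 * of_bool (w j), 8 * j + 3 + 3 * of_bool (w j)}"
  let ?b = "\<lambda>j. {8 * j + 5, 8 * j + 6}"
  let ?r = "\<lambda>j. {8 * j + 4 * of_bool (m j), Suc (8 * j + 4 * of_bool (m j))}"
  have "{f j |j. j < p} = f ` {..<p}" for f :: "nat \<Rightarrow> nat set" by auto
  then have E: "triangles p m w = ?v ` {..<p} \<union> ?b ` {..<p} \<union> ?r ` {..<p}"
    unfolding triangles_def by (simp only:)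
  have inj: "inj_on ?v {..<p}" "inj_on ?b {..<p}" "inj_on ?r {..<p}"
    by (rule inj_onI; auto simp: doubleton_eq_iff of_bool_def split: if_splits; presburger)+
  have disj: "?v ` {..<p} \<inter> ?b ` {..<p} = {}" "(?v ` {..<p} \<union> ?b ` {..<p}) \<inter> ?r ` {..<p} = {}"
    by (auto simp: doubleton_eq_iff of_bool_def split: if_splits; presburger)+
  show "finite (triangles p m w)" unfolding E by simp
  show "card (triangles p m w) = 3 * p"
    unfolding E using inj disj by (simp add: card_Un_disjoint card_image)
qed

text \<open>A spanning forest omits one of the \<open>3 * p\<close> edges iff the graph has a cycle,
  and the only possible cycles are triangles of columns with both bits set.\<close>

lemma card_spanning_forest_triangles:
  assumes "is_spanning_forest (triangles p m w) F"
  shows "card F < 3 * p \<longleftrightarrow> (\<exists>j<p. m j \<and> w j)"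
proof
  assume "\<exists>j<p. m j \<and> w j"
  then obtain j where j: "j < p" "m j" "w j" by blast
  have "is_cycle (triangles p m w) [8 * j + 4, 8 * j + 5, 8 * j + 6]"
    using triangles_hit[where m = m and w = w, OF j] by (intro is_cycle_triangle) simp_all
  then have "F \<noteq> triangles p m w" using assms by (auto simp: is_spanning_forest_def)
  moreover have "F \<subseteq> triangles p m w" using assms by (simp add: is_spanning_forest_def)
  ultimately have "card F < card (triangles p m w)"
    using triangles_card(1) by (intro psubset_card_mono) auto
  then show "card F < 3 * p" by (simp add: triangles_card)
next
  assume lt: "card F < 3 * p"
  show "\<exists>j<p. m j \<and> w j"
  proof (rule ccontr)
    assume no: "\<not> (\<exists>j<p. m j \<and> w j)"
    have "F = triangles p m w"
    proof (rule spanning_forest_of_forest[OF _ _ assms])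
      fix e assume "e \<in> triangles p m w"
      then show "\<exists>u v. e = {u, v} \<and> u \<noteq> v"
        by (rule triangles_cases) (intro exI conjI, assumption, simp)+
    next
      show "\<nexists>xs. is_cycle (triangles p m w) xs" using triangles_acyclic[OF no] by blast
    qed
    then show False using lt by (simp add: triangles_card)
  qed
qed

section \<open>Maximum density\<close>

lemma triangles_density_hit:
  assumes "j < p" "m j" "w j"
  shows "1 \<le> maximum_density (8 * p + 8) (triangles p m w)"
proof -
  let ?U = "{8 * j + 4, 8 * j + 5, 8 * j + 6}"
  let ?S = "{{8 * j + 4, 8 * j + 5}, {8 * j + 5, 8 * j + 6}, {8 * j + 4, 8 * j + 6}}"
  have "?S \<subseteq> {e \<in> triangles p m w. e \<subseteq> ?U}"
    using triangles_hit[where m = m and w = w, OF assms] by blast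
  then have "card ?S \<le> card {e \<in> triangles p m w. e \<subseteq> ?U}"
    using triangles_card(1) by (intro card_mono) auto
  moreover have "card ?S = 3" by (simp add: doubleton_eq_iff)
  ultimately have "1 \<le> density (triangles p m w) ?U"
    by (simp add: density_def)
  also have "\<dots> \<le> maximum_density (8 * p + 8) (triangles p m w)"
    unfolding maximum_density_def using assms(1) by (intro Max_ge) auto
  finally show ?thesis .
qed

text \<open>Without triangles each column consists of paths with at most two edges, so any selection
  of its vertices spans at most \<open>2 / 3\<close> as many edges. Summing over the columns gives
  the bound for every \<open>U\<close>.\<close>

lemma triangles_density_no_hit:
  assumes no: "\<not> (\<exists>j<p. m j \<and> w j)"
  shows "maximum_density (8 * p + 8) (triangles p m w) \<le> 2 / 3"
proof -
  let ?E = "triangles p m w"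
  have "density ?E U \<le> 2 / 3" if U: "U \<subseteq> {..<8 * p + 8}" "U \<noteq> {}" for U
  proof -
    have fin: "finite U" using U(1) finite_subset by blast
    define Ej where "Ej j = {e. e \<subseteq> U \<and> (e = {8 * j + 5, 8 * j + 6} \<or>
      w j \<and> e = {8 * j + 4, 8 * j + 6} \<or> \<not> w j \<and> e = {8 * j + 2, 8 * j + 3} \<or>
      m j \<and> e = {8 * j + 4, 8 * j + 5} \<or> \<not> m j \<and> e = {8 * j, 8 * j + 1})}" for j
    define Uj where "Uj j = U \<inter> {8 * j..<8 * j + 7}" for j
    have "{e \<in> ?E. e \<subseteq> U} \<subseteq> (\<Union>j<p. Ej j)"
    proof
      fix e assume "e \<in> {e \<in> ?E. e \<subseteq> U}"
      then have "e \<in> ?E" "e \<subseteq> U" by auto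
      then show "e \<in> (\<Union>j<p. Ej j)"
        by (elim triangles_cases) (auto simp: Ej_def)
    qed
    moreover have finE: "finite (Ej j)" for j
      by (rule finite_subset[of _ "Pow U"]) (auto simp: Ej_def fin)
    ultimately have "card {e \<in> ?E. e \<subseteq> U} \<le> card (\<Union>j<p. Ej j)"
      by (intro card_mono) auto
    also have "\<dots> \<le> (\<Sum>j<p. card (Ej j))" by (rule card_UN_le) simp
    finally have 1: "card {e \<in> ?E. e \<subseteq> U} \<le> (\<Sum>j<p. card (Ej j))" .
    have 2: "3 * card (Ej j) \<le> 2 * card (Uj j)" if jp: "j < p" for j
    proof -
      \<comment> \<open>The seven membership bits of a column turn the counting into a finite
        Boolean case distinction.\<close>
      define P where "P i \<longleftrightarrow> 8 * j + i \<in> U" for i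
      have "Uj j = (\<lambda>i. 8 * j + i) ` {i \<in> {..<7}. P i}"
      proof
        show "Uj j \<subseteq> (\<lambda>i. 8 * j + i) ` {i \<in> {..<7}. P i}"
        proof
          fix x assume "x \<in> Uj j"
          then show "x \<in> (\<lambda>i. 8 * j + i) ` {i \<in> {..<7}. P i}"
            by (intro image_eqI[of _ _ "x - 8 * j"]) (auto simp: Uj_def P_def)
        qed
      qed (auto simp: Uj_def P_def)
      then have "card (Uj j) = card {i \<in> {..<7}. P i}" by (simp add: card_image inj_on_def)
      also have "\<dots> = (\<Sum>i\<in>{..<7}. of_bool (P i))" by (simp add: sum.If_cases Int_def of_bool_def)
      finally have Uj: "card (Uj j) = of_bool (P 0) + of_bool (P 1) + of_bool (P 2) + of_bool (P 3) +
          of_bool (P 4) + of_bool (P 5) + of_bool (P 6)"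
        by (simp add: eval_nat_numeral)
      define X where "X e = (if e \<subseteq> U then {e} else {})" for e
      have X: "card (X {8 * j + i, 8 * j + i'}) = of_bool (P i \<and> P i')" for i i'
        by (simp add: X_def P_def)
      have le: "card (A \<union> B \<union> C) \<le> card A + card B + card C" for A B C :: "nat set set"
        using card_Un_le[of "A \<union> B" C] card_Un_le[of A B] by linarith
      consider "m j" "\<not> w j" | "\<not> m j" "w j" | "\<not> m j" "\<not> w j" using no jp by blast
      then show ?thesis
      proof cases
        case 1
        then have "Ej j = X {8 * j + 5, 8 * j + 6} \<union> X {8 * j + 2, 8 * j + 3} \<union> X {8 * j + 4, 8 * j + 5}"
          by (auto simp: Ej_def X_def)
        then have "card (Ej j) \<le> of_bool (P 5 \<and> P 6) + of_bool (P 2 \<and> P 3) + of_bool (P 4 \<and> P 5)"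
          using le X by metis
        then show ?thesis unfolding Uj by (auto simp: of_bool_def split: if_splits)
      next
        case 2
        then have "Ej j = X {8 * j + 5, 8 * j + 6} \<union> X {8 * j + 4, 8 * j + 6} \<union> X {8 * j + 0, 8 * j + 1}"
          by (auto simp: Ej_def X_def)
        then have "card (Ej j) \<le> of_bool (P 5 \<and> P 6) + of_bool (P 4 \<and> P 6) + of_bool (P 0 \<and> P 1)"
          using le X by metis
        then show ?thesis unfolding Uj by (auto simp: of_bool_def split: if_splits)
      next
        case 3
        then have "Ej j = X {8 * j + 5, 8 * j + 6} \<union> X {8 * j + 2, 8 * j + 3} \<union> X {8 * j + 0, 8 * j + 1}"
          by (auto simp: Ej_def X_def)
        then have "card (Ej j) \<le> of_bool (P 5 \<and> P 6) + of_bool (P 2 \<and> P 3) + of_bool (P 0 \<and> P 1)"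
          using le X by metis
        then show ?thesis unfolding Uj by (auto simp: of_bool_def split: if_splits)
      qed
    qed
    have "(\<Sum>j<p. card (Uj j)) = card (\<Union>j<p. Uj j)"
      by (rule card_UN_disjoint[symmetric]) (auto simp: Uj_def)
    also have "\<dots> \<le> card U" using fin by (intro card_mono) (auto simp: Uj_def)
    finally have "2 * (\<Sum>j<p. card (Uj j)) \<le> 2 * card U" by simp
    moreover have "3 * (\<Sum>j<p. card (Ej j)) \<le> 2 * (\<Sum>j<p. card (Uj j))"
      unfolding sum_distrib_left by (intro sum_mono 2) simp
    ultimately have "3 * card {e \<in> ?E. e \<subseteq> U} \<le> 2 * card U" using 1 by linarith
    then have "3 * real (card {e \<in> ?E. e \<subseteq> U}) \<le> 2 * real (card U)" by linarith
    moreover have "card U > 0" using U(2) fin by (simp add: card_gt_0_iff)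
    ultimately show ?thesis by (simp add: density_def field_simps)
  qed
  moreover have "{U. U \<subseteq> {..<8 * p + 8} \<and> U \<noteq> {}} \<noteq> {}"
    by (auto intro!: exI[of _ "{0}"])
  ultimately show ?thesis
    unfolding maximum_density_def by (subst Max_le_iff) auto
qed

text \<open>The threshold \<open>2 / 3\<close> works since \<open>1 \<le> \<rho>\<close> forces an
  estimate of at least \<open>1 / \<alpha> > 2 / 3\<close> when \<open>\<alpha>\<close> is positive,
  while an estimate never exceeds \<open>\<rho>\<close>.\<close>

lemma approximation_separates:
  fixes y0 y1 :: nat and \<alpha> \<rho> :: real
  assumes "\<alpha> < 3 / 2" "\<rho> \<le> \<alpha> * (real y0 / real y1)" "real y0 / real y1 \<le> \<rho>"
  shows "1 \<le> \<rho> \<Longrightarrow> y1 \<noteq> 0 \<and> 2 * y1 < 3 * y0"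
    and "\<rho> \<le> 2 / 3 \<Longrightarrow> \<not> (y1 \<noteq> 0 \<and> 2 * y1 < 3 * y0)"
proof -
  let ?x = "real y0 / real y1"
  assume "1 \<le> \<rho>"
  then have ax: "1 \<le> \<alpha> * ?x" using assms(2) by linarith
  have "2 / 3 < ?x"
  proof (rule ccontr)
    assume "\<not> 2 / 3 < ?x"
    then have "?x \<le> 2 / 3" by simp
    \<comment> \<open>A positive estimate is required for the strict inequality below; a zero one
      would contradict \<open>1 \<le> \<alpha> * ?x\<close>.\<close>
    moreover have "?x \<noteq> 0"
    proof
      assume "?x = 0"
      then have "\<alpha> * ?x = 0" by (simp only: mult_zero_right)
      then show False using ax by linarith
    qed
    moreover have "?x \<ge> 0" by simp
    ultimately have "\<alpha> * ?x < 3 / 2 * ?x" using assms(1) by (intro mult_strict_right_mono) linarith+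
    then show False using ax \<open>?x \<le> 2 / 3\<close> by linarith
  qed
  moreover from this have "y1 \<noteq> 0" by (intro notI) simp
  ultimately have "2 * real y1 < 3 * real y0" by (simp add: field_simps)
  then show "y1 \<noteq> 0 \<and> 2 * y1 < 3 * y0" using \<open>y1 \<noteq> 0\<close> by linarith
next
  assume "\<rho> \<le> 2 / 3"
  then have x: "real y0 / real y1 \<le> 2 / 3" using assms(3) by linarith
  show "\<not> (y1 \<noteq> 0 \<and> 2 * y1 < 3 * y0)"
  proof
    assume *: "y1 \<noteq> 0 \<and> 2 * y1 < 3 * y0"
    then have "3 * real y0 \<le> 2 * real y1" using x by (simp add: field_simps)
    then show False using * by linarith
  qed
qed

lemma triangles_eq:
  "{edge (ends ((8, 2, 2), (8, 3, 3)) j (w j)) |j. j < p} \<union>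
    {edge (ends ((8, 5, 0), (8, 6, 0)) j False) |j. j < p} \<union>
    {edge (ends ((8, 0, 4), (8, 1, 4)) j (m j)) |j. j < p} = triangles p m w"
  by (simp add: triangles_def edge_def ends_def)

interpretation forest: gadget minimum_spanning_forest_size "[]" "((8, 5, 0), (8, 6, 0))"
  "((8, 0, 4), (8, 1, 4))" "((8, 2, 2), (8, 3, 3))" "less_dec 3" "\<lambda>p y0 y1. y0 < 3 * p"
proof
  fix p :: nat
  show "length ([] :: nat list) \<le> 2" "admissible minimum_spanning_forest_size (8 * p + 8) []"
    by (auto simp: minimum_spanning_forest_size_def)
next
  fix p :: nat and w m y
  assume "answer minimum_spanning_forest_size (8 * p + 8)
     ({edge (ends ((8, 2, 2), (8, 3, 3)) j (w j)) |j. j < p} \<union>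
      {edge (ends ((8, 5, 0), (8, 6, 0)) j False) |j. j < p} \<union>
      {edge (ends ((8, 0, 4), (8, 1, 4)) j (m j)) |j. j < p}) [] y"
  then show "y 0 < 3 * p \<longleftrightarrow> (\<exists>j<p. m j \<and> w j)"
    unfolding triangles_eq using card_spanning_forest_triangles
    by (auto simp: minimum_spanning_forest_size_def is_minimum_spanning_forest_def)
next
  fix \<sigma> :: machine and p W W'
  assume "mem \<sigma> 10 = p" "8 * p \<le> W'"
  then show "\<exists>h g. (h \<noteq> 0 \<longleftrightarrow> mem \<sigma> 3 < 3 * p) \<and>
    wp W' (less_dec 3) (\<lambda>t \<sigma>'. t \<le> 10 \<and> \<sigma>' = \<sigma>\<lparr>mem := (mem \<sigma>)(20 := h, 21 := g)\<rparr>) \<sigma>"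
    by (rule less_dec) simp
qed (auto simp: edge_simps of_bool_def split: if_splits; presburger)+

text \<open>The graph of the spanning forest gadget serves again: a hit gives density at least
  \<open>1\<close>, no hit at most \<open>2 / 3\<close>.\<close>

lemma density_gadget:
  assumes "\<alpha> < 3 / 2"
  shows "gadget (maximum_density_approximation \<alpha>) [] ((8, 5, 0), (8, 6, 0)) ((8, 0, 4), (8, 1, 4))
    ((8, 2, 2), (8, 3, 3)) ratio_dec (\<lambda>p y0 y1. y1 \<noteq> 0 \<and> 2 * y1 < 3 * y0)"
proof
  fix p :: nat
  show "length ([] :: nat list) \<le> 2" "admissible (maximum_density_approximation \<alpha>) (8 * p + 8) []"
    by (auto simp: maximum_density_approximation_def)
next
  fix p :: nat and w m y
  assume "answer (maximum_density_approximation \<alpha>) (8 * p + 8)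
     ({edge (ends ((8, 2, 2), (8, 3, 3)) j (w j)) |j. j < p} \<union>
      {edge (ends ((8, 5, 0), (8, 6, 0)) j False) |j. j < p} \<union>
      {edge (ends ((8, 0, 4), (8, 1, 4)) j (m j)) |j. j < p}) [] y"
  then have "maximum_density (8 * p + 8) (triangles p m w) \<le> \<alpha> * (real (y 0) / real (y 1))"
    "real (y 0) / real (y 1) \<le> maximum_density (8 * p + 8) (triangles p m w)"
    unfolding triangles_eq by (simp_all add: maximum_density_approximation_def Let_def)
  from approximation_separates[OF assms this]
  show "(y 1 \<noteq> 0 \<and> 2 * y 1 < 3 * y 0) \<longleftrightarrow> (\<exists>j<p. m j \<and> w j)"
    using triangles_density_hit[of _ p m w] triangles_density_no_hit[of p m w] by blast
next
  fix \<sigma> :: machine and p W W'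
  assume "mem \<sigma> 3 \<le> W" "mem \<sigma> 4 \<le> W" "3 * W \<le> W'"
  then show "\<exists>h g. (h \<noteq> 0 \<longleftrightarrow> mem \<sigma> 4 \<noteq> 0 \<and> 2 * mem \<sigma> 4 < 3 * mem \<sigma> 3) \<and>
    wp W' ratio_dec (\<lambda>t \<sigma>'. t \<le> 10 \<and> \<sigma>' = \<sigma>\<lparr>mem := (mem \<sigma>)(20 := h, 21 := g)\<rparr>) \<sigma>"
    by (rule ratio_dec)
qed (auto simp: edge_simps of_bool_def split: if_splits; presburger)+

theorem theorem8:
  fixes \<epsilon> :: real
  assumes "OMv_conjecture"
    and "\<epsilon> > 0"
  shows "(\<nexists>A. fully_retroactive_within connectivity A (\<lambda>n. real n powr (1 - \<epsilon>)))
    \<and> (\<nexists>A. fully_retroactive_within maximal_matching_size A (\<lambda>n. real n powr (1 - \<epsilon>)))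
    \<and> (\<nexists>A. fully_retroactive_within minimum_spanning_forest_size A (\<lambda>n. real n powr (1 - \<epsilon>)))
    \<and> (\<nexists>A. fully_retroactive_within (maximum_density_approximation (3 / 2 - \<epsilon>)) A
            (\<lambda>n. real n powr (1 - \<epsilon>)))"
  using connectivity.lower_bound[OF assms] matching.lower_bound[OF assms] forest.lower_bound[OF assms]
    gadget.lower_bound[OF density_gadget assms] assms(2)
  by simp

end
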